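(* Let $K>0$, and let $(m_n)_{n\ge 1}$ be a sequence of positive integers with $\lim_{n\to\infty}\frac{m_n}{n}=\infty$ and $\log^{3/2}m_n=o(\sqrt{n/\log n})$. For each $n$, let $A=A(n)$ be an $m_n\times n$ random matrix whose entries are mutually independent centered $K$-subgaussian variables of unit variances. Then the spherical mean width $\mathcal{W}(P)$ of the polyhedron $P=P(n)=\{x\in\mathbb{R}^n:\ Ax\le\mathbf{1}\}$ satisfies $$\lim_{n\to\infty}\sqrt{2\log(m_n/n)}\,\mathcal{W}(P)=2\quad\text{almost surely.}$$
   Context: A random variable $\xi$ is $K$-subgaussian (for $K>0$) if $\mathbb{E}\exp(\xi^2/K^2)\le 2$. $\mathbf{1}$ is the vector of all ones and inequalities between vectors are coordinate-wise. The spherical mean width is $\mathcal{W}(P)=2\,\mathbb{E}_c\max\{\langle c,x\rangle:\ x\in P\}$ (with supremum in place of maximum if needed, values in $[0,+\infty]$), where $c$ is uniformly distributed on the unit Euclidean sphere of $\mathbb{R}^n$, independent of $A$, and $\mathbb{E}_c$ is the expectation with respect to the randomness of $c$ only; thus $\mathcal{W}(P)$ is a random variable depending on $A$. The matrices $A(n)$, $n\ge1$, are defined on a common probability space. *)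

theory Defs
  imports "HOL-Probability.Probability" "HOL-Library.Landau_Symbols"
begin

text \<open>
  The dimension \<open>n\<close> varies within the statement, so \<open>\<real>\<^sup>n\<close> is the set of functions
  \<open>nat \<Rightarrow> real\<close> that are extensional on \<open>{..<n}\<close>, i.e. the space of the product measure
  \<open>\<Pi>\<^sub>M i\<in>{..<n}. lborel\<close>.  An \<open>m \<times> n\<close> matrix is a function of two indices,
  of which only the entries with \<open>i < m\<close> and \<open>j < n\<close> are used.
\<close>

definition subgaussian :: "'w measure \<Rightarrow> real \<Rightarrow> ('w \<Rightarrow> real) \<Rightarrow> bool" where
  "subgaussian M K X \<longleftrightarrow>
     X \<in> borel_measurable M \<and> (\<integral>\<^sup>+ \<omega>. ennreal (exp ((X \<omega>)\<^sup>2 / K\<^sup>2)) \<partial>M) \<le> 2"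

definition unit_ball :: "nat \<Rightarrow> (nat \<Rightarrow> real) set" where
  "unit_ball n = {x \<in> {..<n} \<rightarrow>\<^sub>E UNIV. L2_set x {..<n} \<le> 1}"

definition unit_sphere :: "nat \<Rightarrow> (nat \<Rightarrow> real) set" where
  "unit_sphere n = {x \<in> {..<n} \<rightarrow>\<^sub>E UNIV. L2_set x {..<n} = 1}"

text \<open>
  The uniform distribution on the unit sphere, for \<open>n \<ge> 1\<close>, is the normalised cone measure:
  the law of \<open>x / \<parallel>x\<parallel>\<close> for \<open>x\<close> uniform in the unit ball.  The origin, where
  this quotient is \<open>0\<close>, is a null set.
\<close>

definition sphere_uniform :: "nat \<Rightarrow> (nat \<Rightarrow> real) measure" where
  "sphere_uniform n =
     distr (uniform_measure (\<Pi>\<^sub>M i\<in>{..<n}. lborel) (unit_ball n)) (\<Pi>\<^sub>M i\<in>{..<n}. borel)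
       (\<lambda>x. \<lambda>i\<in>{..<n}. x i / L2_set x {..<n})"

definition polyhedron_le_one :: "nat \<Rightarrow> nat \<Rightarrow> (nat \<Rightarrow> nat \<Rightarrow> real) \<Rightarrow> (nat \<Rightarrow> real) set" where
  "polyhedron_le_one m n a = {x \<in> {..<n} \<rightarrow>\<^sub>E UNIV. \<forall>i<m. (\<Sum>j<n. a i j * x j) \<le> 1}"

text \<open>
  \<open>ennreal\<close> truncates negative inner products to \<open>0\<close>.  For sets containing the origin, such as
  \<open>polyhedron_le_one m n a\<close>, the supremum is nonnegative anyway and the truncation has no effect;
  for other sets this is not the mean width.
\<close>

definition mean_width :: "nat \<Rightarrow> (nat \<Rightarrow> real) set \<Rightarrow> ennreal" where
  "mean_width n S = 2 * (\<integral>\<^sup>+ c. (SUP x\<in>S. ennreal (\<Sum>j<n. c j * x j)) \<partial>sphere_uniform n)"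

lemma unit_ball_sets [measurable]: "unit_ball n \<in> sets (\<Pi>\<^sub>M i\<in>{..<n}. (lborel :: real measure))"
proof -
  have "unit_ball n = {x \<in> space (\<Pi>\<^sub>M i\<in>{..<n}. (lborel :: real measure)).
      sqrt (\<Sum>i<n. (x i)\<^sup>2) \<le> 1}"
    by (simp add: unit_ball_def space_PiM L2_set_def)
  also have "\<dots> \<in> sets (\<Pi>\<^sub>M i\<in>{..<n}. (lborel :: real measure))"
    by measurable
  finally show ?thesis .
qed

lemma emeasure_unit_ball:
  assumes "n \<ge> 1"
  shows "emeasure (\<Pi>\<^sub>M i\<in>{..<n}. (lborel :: real measure)) (unit_ball n) \<noteq> 0"
    and "emeasure (\<Pi>\<^sub>M i\<in>{..<n}. (lborel :: real measure)) (unit_ball n) \<noteq> \<infinity>"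
proof -
  interpret product_sigma_finite "\<lambda>_. lborel :: real measure"
    by standard
  let ?L = "\<Pi>\<^sub>M i\<in>{..<n}. (lborel :: real measure)"
  define r where "r = 1 / real n"
  have r: "r > 0" using assms by (simp add: r_def)
  have cube: "emeasure ?L (PiE {..<n} (\<lambda>_. {-s..s})) = ennreal (2 * s) ^ n" if "s \<ge> 0" for s :: real
    using that by (subst emeasure_PiM) auto
  have "PiE {..<n} (\<lambda>_. {-r..r}) \<subseteq> unit_ball n"
  proof
    fix x assume x: "x \<in> PiE {..<n} (\<lambda>_. {-r..r})"
    have "L2_set x {..<n} \<le> (\<Sum>i<n. \<bar>x i\<bar>)" by (rule L2_set_le_sum_abs)
    also have "\<dots> \<le> (\<Sum>i<n. r)"
    proof (rule sum_mono)
      fix i assume "i \<in> {..<n}"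
      then have "x i \<in> {-r..r}" using x by (auto simp: PiE_def)
      then show "\<bar>x i\<bar> \<le> r" by auto
    qed
    also have "\<dots> = 1" using assms by (simp add: r_def)
    finally show "x \<in> unit_ball n" using x by (auto simp: unit_ball_def PiE_def)
  qed
  then have "emeasure ?L (PiE {..<n} (\<lambda>_. {-r..r})) \<le> emeasure ?L (unit_ball n)"
    by (rule emeasure_mono) (rule unit_ball_sets)
  then have "ennreal (2 * r) ^ n \<le> emeasure ?L (unit_ball n)"
    using cube[of r] r by simp
  moreover have "ennreal (2 * r) ^ n > 0"
    using r by (simp add: ennreal_power)
  ultimately show "emeasure ?L (unit_ball n) \<noteq> 0" by auto
  have "unit_ball n \<subseteq> PiE {..<n} (\<lambda>_. {-1..1})"
  proof
    fix x assume x: "x \<in> unit_ball n"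
    have "x i \<in> {-1..1}" if "i < n" for i
    proof -
      have "\<bar>x i\<bar> \<le> L2_set (\<lambda>i. \<bar>x i\<bar>) {..<n}"
        by (rule member_le_L2_set) (use that in auto)
      also have "\<dots> = L2_set x {..<n}" by (simp add: L2_set_def)
      also have "\<dots> \<le> 1" using x by (simp add: unit_ball_def)
      finally have "\<bar>x i\<bar> \<le> 1" .
      then show ?thesis by (simp add: abs_le_iff)
    qed
    then show "x \<in> PiE {..<n} (\<lambda>_. {-1..1})" using x by (auto simp: unit_ball_def PiE_def)
  qed
  moreover have "PiE {..<n} (\<lambda>_. {-1..1}) \<in> sets ?L" by (rule sets_PiM_I_finite) auto
  ultimately have "emeasure ?L (unit_ball n) \<le> emeasure ?L (PiE {..<n} (\<lambda>_. {-1..1}))"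
    by (rule emeasure_mono)
  then have "emeasure ?L (unit_ball n) \<le> ennreal (2 * 1) ^ n"
    using cube[of 1] by simp
  also have "\<dots> < \<infinity>"
    by (subst ennreal_power) (simp_all add: ennreal_less_top del: ennreal_numeral)
  finally show "emeasure ?L (unit_ball n) \<noteq> \<infinity>" by auto
qed

lemma normalise_measurable [measurable]:
  "(\<lambda>x. \<lambda>i\<in>{..<n}. x i / L2_set x {..<n})
     \<in> (\<Pi>\<^sub>M i\<in>{..<n}. (lborel :: real measure)) \<rightarrow>\<^sub>M (\<Pi>\<^sub>M i\<in>{..<n}. (borel :: real measure))"
  unfolding L2_set_def by measurable

lemma prob_space_sphere_uniform:
  assumes "n \<ge> 1"
  shows "prob_space (sphere_uniform n)"
  unfolding sphere_uniform_def
  by (intro prob_space.prob_space_distr prob_space_uniform_measure emeasure_unit_ball assms)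
     (use normalise_measurable in \<open>simp cong: measurable_cong_sets\<close>)

lemma AE_sphere_uniform:
  assumes "n \<ge> 1"
  shows "AE c in sphere_uniform n. c \<in> unit_sphere n"
proof -
  interpret product_sigma_finite "\<lambda>_. lborel :: real measure"
    by standard
  let ?L = "\<Pi>\<^sub>M i\<in>{..<n}. (lborel :: real measure)"
  let ?f = "\<lambda>x. \<lambda>i\<in>{..<n}. x i / L2_set x {..<n}"
  define N where "N = PiE {..<n} (\<lambda>i. if i = 0 then {0::real} else UNIV)"
  have "emeasure ?L N = (\<Prod>i<n. emeasure lborel (if i = 0 then {0::real} else UNIV))"
    unfolding N_def by (rule emeasure_PiM) auto
  also have "\<dots> = 0"
    using assms by (intro prod_zero) (auto intro!: bexI[of _ 0])
  finally have N: "N \<in> null_sets ?L"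
    unfolding N_def by (auto intro!: sets_PiM_I_finite)
  have f: "?f x \<in> unit_sphere n" if x: "x \<in> space ?L" "x \<notin> N" for x
  proof -
    have "x 0 \<noteq> 0"
      using x by (auto simp: N_def space_PiM PiE_def Pi_def split: if_splits)
    then have ne: "L2_set x {..<n} > 0"
      using assms by (auto simp: L2_set_def intro!: sum_pos2[of _ 0])
    have "L2_set (?f x) {..<n} = L2_set (\<lambda>i. x i / L2_set x {..<n}) {..<n}"
      by (rule L2_set_cong) auto
    also have "\<dots> = L2_set (\<lambda>i. (1 / L2_set x {..<n}) * x i) {..<n}"
      by simp
    also have "\<dots> = (1 / L2_set x {..<n}) * L2_set x {..<n}"
      by (rule L2_set_right_distrib[symmetric]) simp
    also have "\<dots> = 1" using ne by simp
    finally show ?thesis by (simp add: unit_sphere_def)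
  qed
  have S: "{c \<in> space (\<Pi>\<^sub>M i\<in>{..<n}. (borel :: real measure)). c \<in> unit_sphere n}
      \<in> sets (\<Pi>\<^sub>M i\<in>{..<n}. (borel :: real measure))"
  proof -
    have "{c \<in> space (\<Pi>\<^sub>M i\<in>{..<n}. (borel :: real measure)). c \<in> unit_sphere n} =
        {c \<in> space (\<Pi>\<^sub>M i\<in>{..<n}. (borel :: real measure)). sqrt (\<Sum>i<n. (c i)\<^sup>2) = 1}"
      by (auto simp: unit_sphere_def space_PiM L2_set_def)
    also have "\<dots> \<in> sets (\<Pi>\<^sub>M i\<in>{..<n}. (borel :: real measure))"
      by measurable
    finally show ?thesis .
  qed
  have "AE x in ?L. x \<in> unit_ball n \<longrightarrow> ?f x \<in> unit_sphere n"
    using AE_not_in[OF N] AE_space by eventually_elim (use f in blast)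
  then have "AE x in uniform_measure ?L (unit_ball n). ?f x \<in> unit_sphere n"
    by (rule AE_uniform_measureI[rotated]) simp
  moreover have "?f \<in> uniform_measure ?L (unit_ball n) \<rightarrow>\<^sub>M (\<Pi>\<^sub>M i\<in>{..<n}. (borel :: real measure))"
    using normalise_measurable by (simp cong: measurable_cong_sets)
  ultimately show ?thesis
    unfolding sphere_uniform_def by (subst AE_distr_iff[OF _ S])
qed

end

(* For a direction c whose coordinates are small, <a_i, c> is nearly Gaussian up to moderate deviations.
   Write L = sqrt (2 ln (m/n)).

   Upper bound. For l = (1-e) L weight the rows with <a_i, c> = (1 +- e) l by exp (l <a_i, c>). By
   Bernstein's inequality over a net, the weighted average D of these rows is d c + D' with
   d >= (1-e) l and a small remainder D' orthogonal to c. As D is a convex combination of rows,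
   <D, x> <= 1 on the polyhedron P, hence <c, x> <= (1 + |D'| |x|) / d; and P is contained in a ball of
   constant radius.

   Lower bound. Only a few rows have <a_i, c> > (1+e) L, and their squares sum to a small multiple
   of n. A duality argument and the restricted isometry property of the transposed matrix give a
   vector w of norm at most e with <a_i, c - w> <= (1+2e) L for all i, so (c - w) / ((1+2e) L) lies
   in P.

   For fixed c both events fail with exponentially small probability. A random c is spread up to
   probability O(1/n^2), so Fubini, Markov and Borel-Cantelli finish the proof. *)

theory Submission
  imports Defs "HOL-Real_Asymp.Real_Asymp"
begin

section \<open>Moment generating functions of subgaussian variables\<close>

text \<open>The largest of the m products <a_i, c> is typically of order sqrt (2 ln m), which
  exceeds L when m/n grows slowly, so c cannot simply be scaled into P at the right level. Up to a
  small multiple of n / L^2 rows may be violated; w repairs them because every such block of rows,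
  transposed, is well conditioned at scale sqrt n. The Gaussian approximation has to survive a tilt
  by \<nu> close to L. Its third-order error is \<nu>^3 times the sum of the |c_j|^3, at most
  \<nu>^3 \<tau> when all |c_j| \<le> \<tau>; for \<tau> of order sqrt (ln n / n) the growth
  hypothesis makes this vanish. The tilt stops at (1-\<epsilon>) L so that the largest weight, exp
  ((1/2+\<epsilon>) \<nu>^2), stays below m/n by a factor exp (const L^2). This factor pays for a
  net of exp (O(n)) directions. For fixed spread c the failure probability is brought below 1/n^3.
  Markov's inequality at level 1/n for the measure of failing directions costs one factor n, and
  1/n^2 is summable. The directions that still fail are harmless, since P is bounded and L/n tends
  to 0.\<close>

lemma exp_taylor3:
  fixes u :: real
  shows "\<bar>exp u - 1 - u - u\<^sup>2 / 2\<bar> \<le> \<bar>u\<bar> ^ 3 * exp \<bar>u\<bar> / 6"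
proof -
  obtain t where t: "\<bar>t\<bar> \<le> \<bar>u\<bar>" "exp u = (\<Sum>m<3. u ^ m / fact m) + exp t / fact 3 * u ^ 3"
    using Maclaurin_exp_le[of u 3] by blast
  have eq: "exp u - 1 - u - u\<^sup>2 / 2 = exp t * u ^ 3 / 6"
    using t(2) by (simp add: eval_nat_numeral)
  have "\<bar>exp u - 1 - u - u\<^sup>2 / 2\<bar> = exp t * \<bar>u\<bar> ^ 3 / 6"
    unfolding eq by (simp add: abs_mult power_abs)
  also have "\<dots> \<le> exp \<bar>u\<bar> * \<bar>u\<bar> ^ 3 / 6"
    using t(1) by (intro divide_right_mono mult_right_mono) auto
  finally show ?thesis by (simp add: mult.commute)
qed

lemma power_le_fact_exp:
  fixes x :: real
  assumes "x \<ge> 0"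
  shows "x ^ n \<le> fact n * exp x"
proof -
  have s: "(\<lambda>n. x ^ n / fact n) sums exp x"
    using exp_converges[of x] by (simp add: divide_inverse mult.commute)
  have "(\<Sum>k\<in>{n}. x ^ k / fact k) \<le> (\<Sum>k. x ^ k / fact k)"
    using s assms by (intro sum_le_suminf) (auto simp: sums_iff)
  then show ?thesis using s by (simp add: sums_iff field_simps)
qed

context prob_space
begin

lemma subgaussian_exp_square:
  assumes "subgaussian M K X"
  shows "integrable M (\<lambda>\<omega>. exp ((X \<omega>)\<^sup>2 / K\<^sup>2))" (is "integrable M ?f")
    and "expectation (\<lambda>\<omega>. exp ((X \<omega>)\<^sup>2 / K\<^sup>2)) \<le> 2"
proof -
  have [measurable]: "X \<in> borel_measurable M" and le: "(\<integral>\<^sup>+ \<omega>. ennreal (?f \<omega>) \<partial>M) \<le> 2"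
    using assms by (auto simp: subgaussian_def)
  show int: "integrable M ?f"
    using le by (intro integrableI_nonneg) (auto simp: less_top[symmetric] top_unique)
  have "ennreal (expectation ?f) \<le> ennreal 2"
    using le int by (subst nn_integral_eq_integral[symmetric]) auto
  then show "expectation ?f \<le> 2" by (subst (asm) ennreal_le_iff) auto
qed

lemma subgaussian_exp_abs:
  assumes sg: "subgaussian M K X" and K: "K > 0"
  shows "integrable M (\<lambda>\<omega>. exp (r * \<bar>X \<omega>\<bar>))"
    and "expectation (\<lambda>\<omega>. exp (r * \<bar>X \<omega>\<bar>)) \<le> 2 * exp (K\<^sup>2 * r\<^sup>2 / 4)"
proof -
  have [measurable]: "X \<in> borel_measurable M" using sg by (auto simp: subgaussian_def)
  have pw: "exp (r * \<bar>x\<bar>) \<le> exp (K\<^sup>2 * r\<^sup>2 / 4) * exp (x\<^sup>2 / K\<^sup>2)" for x :: real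
  proof -
    have "0 \<le> (K * r / 2 - \<bar>x\<bar> / K)\<^sup>2" by simp
    also have "\<dots> = K\<^sup>2 * r\<^sup>2 / 4 + x\<^sup>2 / K\<^sup>2 - r * \<bar>x\<bar>"
      using K by (simp add: power2_eq_square field_simps)
    finally show ?thesis by (simp add: exp_add[symmetric])
  qed
  have int: "integrable M (\<lambda>\<omega>. exp (K\<^sup>2 * r\<^sup>2 / 4) * exp ((X \<omega>)\<^sup>2 / K\<^sup>2))"
    using subgaussian_exp_square[OF sg] by simp
  show i2: "integrable M (\<lambda>\<omega>. exp (r * \<bar>X \<omega>\<bar>))"
    by (rule Bochner_Integration.integrable_bound[OF int]) (use pw in auto)
  have "expectation (\<lambda>\<omega>. exp (r * \<bar>X \<omega>\<bar>)) \<le> expectation (\<lambda>\<omega>. exp (K\<^sup>2 * r\<^sup>2 / 4) * exp ((X \<omega>)\<^sup>2 / K\<^sup>2))"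
    by (rule integral_mono[OF i2 int]) (use pw in auto)
  also have "\<dots> \<le> exp (K\<^sup>2 * r\<^sup>2 / 4) * 2"
    using subgaussian_exp_square[OF sg] by (simp del: times_divide_eq_right)
  finally show "expectation (\<lambda>\<omega>. exp (r * \<bar>X \<omega>\<bar>)) \<le> 2 * exp (K\<^sup>2 * r\<^sup>2 / 4)" by simp
qed

lemma subgaussian_integrable:
  assumes sg: "subgaussian M K X" and K: "K > 0"
  shows "integrable M X" "integrable M (\<lambda>\<omega>. (X \<omega>)\<^sup>2)" "integrable M (\<lambda>\<omega>. exp (t * X \<omega>))"
proof -
  have [measurable]: "X \<in> borel_measurable M" using sg by (auto simp: subgaussian_def)
  note i = subgaussian_exp_abs(1)[OF sg K]
  show "integrable M X"
    by (rule Bochner_Integration.integrable_bound[OF i[of 1]])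
       (auto intro!: AE_I2 intro: order_trans[OF _ exp_ge_add_one_self])
  show "integrable M (\<lambda>\<omega>. (X \<omega>)\<^sup>2)"
  proof (rule Bochner_Integration.integrable_bound)
    show "integrable M (\<lambda>\<omega>. 2 * exp (1 * \<bar>X \<omega>\<bar>))" using i by (intro integrable_mult_right) 
    show "AE \<omega> in M. norm ((X \<omega>)\<^sup>2) \<le> norm (2 * exp (1 * \<bar>X \<omega>\<bar>))"
      using power_le_fact_exp[of "\<bar>X _\<bar>" 2] by (auto simp: fact_2)
  qed simp
  show "integrable M (\<lambda>\<omega>. exp (t * X \<omega>))"
    by (rule Bochner_Integration.integrable_bound[OF i[of "\<bar>t\<bar>"]])
       (auto simp: abs_mult[symmetric])
qed

end

text \<open>The bound of \<open>subgaussian_exp_abs\<close> on E exp (2 |X|): for |t| \<le> 1 the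
  cubic Taylor remainder of exp (t x) is at most |t|^3 exp (2 |x|).\<close>

definition mgf_const :: "real \<Rightarrow> real" where
  "mgf_const K = 2 * exp (K\<^sup>2)"

text \<open>Write H for \<open>mgf_const K\<close>. The mgf is at least 1 + x with |x| \<le> (1/2 +
  H) t^2, and ln (1 + x) \<ge> x - 2 x^2. The second summand pays for this quadratic loss, by t^4
  \<le> |t|^3.\<close>

definition mgf_lower_const :: "real \<Rightarrow> real" where
  "mgf_lower_const K = mgf_const K + 2 * (1 / 2 + mgf_const K)\<^sup>2"

lemma mgf_const_ge2: "mgf_const K \<ge> 2"
  by (simp add: mgf_const_def)

locale standard_subgaussian = prob_space M for M :: "'w measure" +
  fixes K :: real and X :: "'w \<Rightarrow> real"
  assumes K_pos: "K > 0" and sg: "subgaussian M K X"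
    and mean0: "expectation X = 0" and var1: "variance X = 1"
begin

lemma second_moment: "expectation (\<lambda>\<omega>. (X \<omega>)\<^sup>2) = 1"
  using var1 by (simp add: mean0)

lemma mgf_taylor:
  assumes t: "\<bar>t\<bar> \<le> 1"
  shows "\<bar>expectation (\<lambda>\<omega>. exp (t * X \<omega>)) - 1 - t\<^sup>2 / 2\<bar> \<le> mgf_const K * \<bar>t\<bar> ^ 3"
proof -
  let ?g = "\<lambda>\<omega>. exp (t * X \<omega>) - 1 - t * X \<omega> - t\<^sup>2 / 2 * (X \<omega>)\<^sup>2"
  note i = subgaussian_integrable[OF sg K_pos]
  have pw: "\<bar>exp (t * x) - 1 - t * x - t\<^sup>2 / 2 * x\<^sup>2\<bar> \<le> \<bar>t\<bar> ^ 3 * exp (2 * \<bar>x\<bar>)" for x :: real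
  proof -
    have "\<bar>exp (t * x) - 1 - t * x - t\<^sup>2 / 2 * x\<^sup>2\<bar> \<le> \<bar>t * x\<bar> ^ 3 * exp \<bar>t * x\<bar> / 6"
      using exp_taylor3[of "t * x"] by (simp add: power_mult_distrib)
    also have "\<dots> \<le> \<bar>t\<bar> ^ 3 * \<bar>x\<bar> ^ 3 * exp \<bar>x\<bar> / 6"
      using t by (auto simp: abs_mult power_mult_distrib mult_left_le_one_le intro!: mult_left_mono)
    also have "\<dots> \<le> \<bar>t\<bar> ^ 3 * (6 * exp \<bar>x\<bar>) * exp \<bar>x\<bar> / 6"
      using power_le_fact_exp[of "\<bar>x\<bar>" 3]
      by (intro divide_right_mono mult_right_mono mult_left_mono) (auto simp: fact_numeral)
    also have "\<dots> = \<bar>t\<bar> ^ 3 * exp (2 * \<bar>x\<bar>)"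
      by (simp add: mult_exp_exp algebra_simps)
    finally show ?thesis .
  qed
  have ig: "integrable M ?g"
    using i by (intro Bochner_Integration.integrable_diff) auto
  have "expectation ?g = expectation (\<lambda>\<omega>. exp (t * X \<omega>)) - 1 - t\<^sup>2 / 2"
    using i mean0 second_moment by (simp add: prob_space)
  moreover have "\<bar>expectation ?g\<bar> \<le> expectation (\<lambda>\<omega>. \<bar>t\<bar> ^ 3 * exp (2 * \<bar>X \<omega>\<bar>))"
    using subgaussian_exp_abs(1)[OF sg K_pos, of 2] ig pw
    by (intro order_trans[OF integral_abs_bound] integral_mono) auto
  moreover have "\<dots> \<le> \<bar>t\<bar> ^ 3 * (2 * exp (K\<^sup>2))"
    using subgaussian_exp_abs(2)[OF sg K_pos, of 2] by (auto intro!: mult_left_mono)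
  ultimately show ?thesis by (simp add: mgf_const_def mult.commute)
qed

lemma mgf_upper:
  assumes t: "\<bar>t\<bar> \<le> 1"
  shows "expectation (\<lambda>\<omega>. exp (t * X \<omega>)) \<le> exp (t\<^sup>2 / 2 + mgf_const K * \<bar>t\<bar> ^ 3)"
  using mgf_taylor[OF t] exp_ge_add_one_self[of "t\<^sup>2 / 2 + mgf_const K * \<bar>t\<bar> ^ 3"] by linarith

text \<open>No factor may stand in front of the exponential, because \<open>row_mgf_global\<close>
  multiplies this bound over all entries of a row. For |t| > 1 the factor 2 of the subgaussian bound
  is at most exp 1 and is absorbed into exp (t^2).\<close>

lemma mgf_global:
  "expectation (\<lambda>\<omega>. exp (t * X \<omega>)) \<le> exp ((1 / 2 + mgf_const K) * t\<^sup>2)"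
proof (cases "\<bar>t\<bar> \<le> 1")
  case True
  have "\<bar>t\<bar> ^ 3 \<le> \<bar>t\<bar>\<^sup>2" using True by (intro power_decreasing) auto
  then have "mgf_const K * \<bar>t\<bar> ^ 3 \<le> mgf_const K * t\<^sup>2"
    using mgf_const_ge2[of K] by (intro mult_left_mono) auto
  then have "exp (t\<^sup>2 / 2 + mgf_const K * \<bar>t\<bar> ^ 3) \<le> exp ((1 / 2 + mgf_const K) * t\<^sup>2)"
    by (simp add: algebra_simps)
  with mgf_upper[OF True] show ?thesis by linarith
next
  case False
  then have t1: "1 \<le> t\<^sup>2" using abs_le_square_iff[of 1 t] by simp
  have "expectation (\<lambda>\<omega>. exp (t * X \<omega>)) \<le> expectation (\<lambda>\<omega>. exp (\<bar>t\<bar> * \<bar>X \<omega>\<bar>))"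
    using subgaussian_exp_abs(1)[OF sg K_pos, of "\<bar>t\<bar>"] subgaussian_integrable(3)[OF sg K_pos, of t]
    by (intro integral_mono) (auto simp: abs_mult[symmetric])
  also have "\<dots> \<le> 2 * exp (K\<^sup>2 * t\<^sup>2 / 4)"
    using subgaussian_exp_abs(2)[OF sg K_pos, of "\<bar>t\<bar>"] by simp
  also have "\<dots> \<le> exp 1 * exp (K\<^sup>2 * t\<^sup>2 / 4)"
    using exp_ge_add_one_self[of 1] by (intro mult_right_mono) auto
  also have "\<dots> = exp (1 + K\<^sup>2 * t\<^sup>2 / 4)" by (simp add: exp_add)
  also have "\<dots> \<le> exp ((1 / 2 + mgf_const K) * t\<^sup>2)"
  proof -
    have "mgf_const K \<ge> 2 * (1 + K\<^sup>2)"
      unfolding mgf_const_def by (intro mult_left_mono exp_ge_add_one_self) auto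
    then have "1 / 2 + mgf_const K \<ge> 1 + K\<^sup>2 / 4" using zero_le_power2[of K] by argo
    then have "(1 / 2 + mgf_const K) * t\<^sup>2 \<ge> (1 + K\<^sup>2 / 4) * t\<^sup>2"
      by (rule mult_right_mono) simp
    moreover have "(1 + K\<^sup>2 / 4) * t\<^sup>2 \<ge> 1 + K\<^sup>2 * t\<^sup>2 / 4" using t1 by (simp add: algebra_simps)
    ultimately show ?thesis by simp
  qed
  finally show ?thesis .
qed

lemma mgf_lower:
  assumes t: "\<bar>t\<bar> * mgf_const K \<le> 1 / 2"
  shows "expectation (\<lambda>\<omega>. exp (t * X \<omega>))
    \<ge> exp (t\<^sup>2 / 2 - mgf_lower_const K * \<bar>t\<bar> ^ 3)"
proof -
  define H where "H = mgf_const K"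
  have H: "H \<ge> 2" using mgf_const_ge2 by (simp add: H_def)
  have "\<bar>t\<bar> * 2 \<le> \<bar>t\<bar> * H" using H by (intro mult_left_mono) auto
  then have t1: "\<bar>t\<bar> \<le> 1 / 4" using t by (simp add: H_def)
  \<comment> \<open>The Taylor lower bound for the mgf, minus 1. The hypothesis on t puts it into
    [-1/2, 1/2], where ln (1 + x) \<ge> x - 2 x^2.\<close>
  define x where "x = t\<^sup>2 / 2 - H * \<bar>t\<bar> ^ 3"
  have t32: "\<bar>t\<bar> ^ 3 \<le> \<bar>t\<bar>\<^sup>2" "\<bar>t\<bar> ^ 4 \<le> \<bar>t\<bar> ^ 3" using t1 by (intro power_decreasing; simp)+
  have "H * \<bar>t\<bar> ^ 3 = (\<bar>t\<bar> * H) * \<bar>t\<bar>\<^sup>2" by (simp add: power2_eq_square power3_eq_cube)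
  also have "\<dots> \<le> 1 / 2 * 1"
    using t t1 power_le_one[of "\<bar>t\<bar>" 2] by (intro mult_mono) (auto simp: H_def)
  finally have xl: "x \<ge> - (1 / 2)" using zero_le_power2[of t] unfolding x_def by linarith
  have "H * \<bar>t\<bar> ^ 3 \<le> H * t\<^sup>2" using t32 H by (intro mult_left_mono) auto
  moreover have "0 \<le> H * \<bar>t\<bar> ^ 3" "0 \<le> H * t\<^sup>2" using H by auto
  ultimately have "\<bar>x\<bar> \<le> 1 / 2 * t\<^sup>2 + H * t\<^sup>2"
    using zero_le_power2[of t] unfolding x_def abs_le_iff by linarith
  then have "\<bar>x\<bar> \<le> (1 / 2 + H) * t\<^sup>2" by (simp only: distrib_right)
  then have "\<bar>x\<bar>\<^sup>2 \<le> ((1 / 2 + H) * t\<^sup>2)\<^sup>2" by (intro power_mono) auto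
  also have "\<dots> = (1 / 2 + H)\<^sup>2 * \<bar>t\<bar> ^ 4" by (simp add: power_mult_distrib flip: power_mult)
  also have "\<dots> \<le> (1 / 2 + H)\<^sup>2 * \<bar>t\<bar> ^ 3" using t32 by (intro mult_left_mono) auto
  finally have x2: "x\<^sup>2 \<le> (1 / 2 + H)\<^sup>2 * \<bar>t\<bar> ^ 3" by simp
  have "t\<^sup>2 \<le> 1" using t1 by (simp add: abs_square_le_1)
  moreover have "0 \<le> H * \<bar>t\<bar> ^ 3" using H by auto
  ultimately have "x \<le> 1 / 2" unfolding x_def by linarith
  then have "\<bar>ln (1 + x) - x\<bar> \<le> 2 * x\<^sup>2"
    using xl by (intro abs_ln_one_plus_x_minus_x_bound) auto
  then have "x - 2 * x\<^sup>2 \<le> ln (1 + x)" by linarith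
  then have "exp (x - 2 * x\<^sup>2) \<le> 1 + x"
    using xl by (subst (asm) ln_ge_iff) auto
  also have "1 + x \<le> expectation (\<lambda>\<omega>. exp (t * X \<omega>))"
    using mgf_taylor[of t] t1 by (simp add: x_def H_def)
  finally have "exp (x - 2 * x\<^sup>2) \<le> expectation (\<lambda>\<omega>. exp (t * X \<omega>))" .
  moreover have "exp (t\<^sup>2 / 2 - (H + 2 * (1 / 2 + H)\<^sup>2) * \<bar>t\<bar> ^ 3) \<le> exp (x - 2 * x\<^sup>2)"
  proof -
    have "t\<^sup>2 / 2 - (H + 2 * (1 / 2 + H)\<^sup>2) * \<bar>t\<bar> ^ 3 = x - 2 * ((1 / 2 + H)\<^sup>2 * \<bar>t\<bar> ^ 3)"
      by (simp add: x_def algebra_simps)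
    then show ?thesis using x2 by simp
  qed
  ultimately show ?thesis unfolding H_def mgf_lower_const_def by linarith
qed

end

section \<open>Rows of a subgaussian matrix\<close>

definition dot :: "nat set \<Rightarrow> (nat \<Rightarrow> real) \<Rightarrow> (nat \<Rightarrow> real) \<Rightarrow> real" where
  "dot J u v = (\<Sum>j\<in>J. u j * v j)"

lemma dot_add_left: "dot J (\<lambda>j. u j + v j) w = dot J u w + dot J v w"
  and dot_diff_left: "dot J (\<lambda>j. u j - v j) w = dot J u w - dot J v w"
  and dot_scale_left: "dot J (\<lambda>j. c * u j) w = c * dot J u w"
  and dot_add_right: "dot J w (\<lambda>j. u j + v j) = dot J w u + dot J w v"
  and dot_diff_right: "dot J w (\<lambda>j. u j - v j) = dot J w u - dot J w v"
  and dot_scale_right: "dot J w (\<lambda>j. c * u j) = c * dot J w u"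
  by (simp_all add: dot_def sum.distrib sum_subtractf sum_distrib_left algebra_simps)

lemma dot_commute: "dot J u v = dot J v u"
  by (simp add: dot_def mult.commute)

lemma dot_self: "dot J u u = (L2_set u J)\<^sup>2"
  by (simp add: dot_def L2_set_def power2_eq_square sum_nonneg)

lemma L2_set_sq: "(L2_set u J)\<^sup>2 = (\<Sum>j\<in>J. (u j)\<^sup>2)"
  by (simp add: L2_set_def sum_nonneg)

lemma abs_dot_le: "\<bar>dot J u v\<bar> \<le> L2_set u J * L2_set v J"
proof -
  have "\<bar>dot J u v\<bar> \<le> (\<Sum>j\<in>J. \<bar>u j\<bar> * \<bar>v j\<bar>)"
    unfolding dot_def by (intro order_trans[OF sum_abs]) (simp add: abs_mult)
  also have "\<dots> \<le> L2_set u J * L2_set v J" by (rule L2_set_mult_ineq)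
  finally show ?thesis .
qed

lemma dot_le: "dot J u v \<le> L2_set u J * L2_set v J"
  using abs_dot_le[of J u v] by linarith

lemma L2_set_scale: "L2_set (\<lambda>j. c * u j) J = \<bar>c\<bar> * L2_set u J"
  by (simp add: L2_set_def power_mult_distrib sum_distrib_left[symmetric] real_sqrt_mult)

lemma measurable_dot [measurable]:
  assumes "\<And>j. j \<in> J \<Longrightarrow> (\<lambda>x. u x j) \<in> borel_measurable N" "\<And>j. j \<in> J \<Longrightarrow> (\<lambda>x. v x j) \<in> borel_measurable N"
  shows "(\<lambda>x. dot J (u x) (v x)) \<in> borel_measurable N"
  unfolding dot_def using assms by measurable

section \<open>Independence and exponential moments\<close>

context prob_space
begin

text \<open>Used in \<open>transposed\<close>, where the injection swaps the two indices.\<close>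

lemma indep_vars_reindex_inj:
  assumes ind: "indep_vars (\<lambda>_. N) X (f ` I)" and inj: "inj_on f I"
  shows "indep_vars (\<lambda>_. N) (\<lambda>i. X (f i)) I"
  unfolding indep_vars_def2
proof (intro conjI ballI)
  show "random_variable N (X (f i))" if "i \<in> I" for i
    using ind that by (auto simp: indep_vars_def2)
  let ?F = "\<lambda>x. {X x -` A \<inter> space M | A. A \<in> sets N}"
  have iset: "indep_sets ?F (f ` I)" using ind by (auto simp: indep_vars_def2)
  show "indep_sets (\<lambda>i. ?F (f i)) I"
  proof (rule indep_setsI)
    show "?F (f i) \<subseteq> events" if "i \<in> I" for i
      using iset that by (auto simp: indep_sets_def)
    fix A J assume J: "J \<noteq> {}" "J \<subseteq> I" "finite J" and A: "\<forall>j\<in>J. A j \<in> ?F (f j)"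
    have injJ: "inj_on f J" using inj J(2) by (rule inj_on_subset)
    define A' where "A' x = A (the_inv_into J f x)" for x
    have A'f: "A' (f j) = A j" if "j \<in> J" for j
      using the_inv_into_f_f[OF injJ that] by (simp add: A'_def)
    have "prob (\<Inter>x\<in>f ` J. A' x) = (\<Prod>x\<in>f ` J. prob (A' x))"
      using J A A'f by (intro indep_setsD[OF iset]) auto
    then show "prob (\<Inter>j\<in>J. A j) = (\<Prod>j\<in>J. prob (A j))"
      using A'f by (simp add: prod.reindex[OF injJ])
  qed
qed

text \<open>Markov's inequality for the exponential of the sum. It is stated with nonnegative
  integrals, so that no integrability has to be supplied; the Chernoff parameter is part of
  \<open>F\<close>.\<close>

lemma chernoff_sum:
  assumes fin: "finite I" and ind: "indep_vars (\<lambda>_. borel) F I"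
    and mgf: "\<And>i. i \<in> I \<Longrightarrow> (\<integral>\<^sup>+\<omega>. ennreal (exp (F i \<omega>)) \<partial>M) \<le> ennreal (exp b)"
  shows "prob {\<omega> \<in> space M. t \<le> (\<Sum>i\<in>I. F i \<omega>)} \<le> exp (real (card I) * b - t)"
proof -
  have [measurable]: "F i \<in> borel_measurable M" if "i \<in> I" for i
    using ind that by (auto simp: indep_vars_def2)
  have "indep_vars (\<lambda>_. borel) (\<lambda>i \<omega>. ennreal (exp (F i \<omega>))) I"
    by (rule indep_vars_compose2[OF ind]) measurable
  then have "(\<integral>\<^sup>+\<omega>. (\<Prod>i\<in>I. ennreal (exp (F i \<omega>))) \<partial>M) = (\<Prod>i\<in>I. \<integral>\<^sup>+\<omega>. ennreal (exp (F i \<omega>)) \<partial>M)"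
    by (intro indep_vars_nn_integral fin) auto
  also have "\<dots> \<le> (\<Prod>i\<in>I. ennreal (exp b))"
    using mgf by (intro prod_mono_ennreal)
  also have "\<dots> = ennreal (exp (real (card I) * b))"
    by (simp add: ennreal_power exp_of_nat_mult)
  finally have le: "(\<integral>\<^sup>+\<omega>. (\<Prod>i\<in>I. ennreal (exp (F i \<omega>))) \<partial>M) \<le> ennreal (exp (real (card I) * b))" .
  have prod: "(\<Prod>i\<in>I. ennreal (exp (F i \<omega>))) = ennreal (exp (\<Sum>i\<in>I. F i \<omega>))" for \<omega>
    by (simp add: exp_sum fin prod_ennreal)
  have "emeasure M {\<omega> \<in> space M. t \<le> (\<Sum>i\<in>I. F i \<omega>)} \<le>
      emeasure M {\<omega> \<in> space M. 1 \<le> ennreal (exp (- t)) * ennreal (exp (\<Sum>i\<in>I. F i \<omega>))}"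
  proof (rule emeasure_mono)
    have "1 \<le> ennreal (exp (- t)) * ennreal (exp x)" if "t \<le> x" for x
      using that by (simp add: ennreal_mult[symmetric] exp_add[symmetric] flip: ennreal_1)
    then show "{\<omega> \<in> space M. t \<le> (\<Sum>i\<in>I. F i \<omega>)} \<subseteq> {\<omega> \<in> space M. 1 \<le> ennreal (exp (- t)) * ennreal (exp (\<Sum>i\<in>I. F i \<omega>))}"
      by auto
  qed measurable
  also have "\<dots> \<le> ennreal (exp (- t)) * (\<integral>\<^sup>+\<omega>. ennreal (exp (\<Sum>i\<in>I. F i \<omega>)) * indicator (space M) \<omega> \<partial>M)"
    by (intro nn_integral_Markov_inequality) measurable
  also have "(\<integral>\<^sup>+\<omega>. ennreal (exp (\<Sum>i\<in>I. F i \<omega>)) * indicator (space M) \<omega> \<partial>M) = (\<integral>\<^sup>+\<omega>. ennreal (exp (\<Sum>i\<in>I. F i \<omega>)) \<partial>M)"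
    by (intro nn_integral_cong) (auto simp: indicator_def)
  also have "\<dots> \<le> ennreal (exp (real (card I) * b))"
    using le by (simp add: prod)
  finally have "emeasure M {\<omega> \<in> space M. t \<le> (\<Sum>i\<in>I. F i \<omega>)} \<le> ennreal (exp (- t)) * ennreal (exp (real (card I) * b))"
    by (simp add: mult_left_mono)
  also have "\<dots> = ennreal (exp (real (card I) * b - t))"
    by (simp add: ennreal_mult[symmetric] exp_add[symmetric])
  finally show ?thesis
    by (simp add: emeasure_eq_measure)
qed

text \<open>Integrating the mgf bound against a Gaussian in \<open>t\<close> turns it into an exponential square bound.\<close>

lemma exp_square_of_mgf:
  assumes [measurable]: "X \<in> borel_measurable M" and G: "G > 0"
    and mgf: "\<And>t. (\<integral>\<^sup>+\<omega>. ennreal (exp (t * X \<omega>)) \<partial>M) \<le> ennreal (exp (G * t\<^sup>2))"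
  shows "(\<integral>\<^sup>+\<omega>. ennreal (exp ((X \<omega>)\<^sup>2 / (8 * G))) \<partial>M) \<le> 2"
proof -
  interpret pair_sigma_finite M lborel
    by (intro pair_sigma_finite.intro sigma_finite_measure_axioms lborel.sigma_finite_measure_axioms)
  \<comment> \<open>With t = g / ?r the mgf bound becomes exp (g^2 / 4), half of what the standard
    Gaussian density takes away. The rest is sqrt 2 times the density of variance 2, of mass sqrt 2
    \<le> 2.\<close>
  let ?r = "2 * sqrt G"
  have int1: "(\<integral>\<^sup>+x. ennreal (normal_density \<mu> \<sigma> x) \<partial>lborel) = 1" if "\<sigma> > 0" for \<mu> \<sigma> :: real
    using that by (subst nn_integral_eq_integral) auto
  have gauss: "(\<integral>\<^sup>+g. ennreal (exp (x / ?r * g)) * ennreal (std_normal_density g) \<partial>lborel) = ennreal (exp (x\<^sup>2 / (8 * G)))" for x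
  proof -
    have sq: "?r\<^sup>2 = 4 * G" using G by (simp add: power_mult_distrib)
    have "exp (x / ?r * g) * std_normal_density g = exp (x\<^sup>2 / (8 * G)) * normal_density (x / ?r) 1 g" for g
    proof -
      have "x / ?r * g + (- g\<^sup>2 / 2) = x\<^sup>2 / (8 * G) + (- (g - x / ?r)\<^sup>2 / 2)"
        using sq by (simp add: power2_diff power_divide diff_divide_distrib add_divide_distrib mult_ac)
      then have "exp (x / ?r * g) * exp (- g\<^sup>2 / 2) = exp (x\<^sup>2 / (8 * G)) * exp (- (g - x / ?r)\<^sup>2 / 2)"
        by (metis exp_add)
      then show ?thesis by (simp add: normal_density_def)
    qed
    then have "(\<integral>\<^sup>+g. ennreal (exp (x / ?r * g)) * ennreal (std_normal_density g) \<partial>lborel)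
      = (\<integral>\<^sup>+g. ennreal (exp (x\<^sup>2 / (8 * G))) * ennreal (normal_density (x / ?r) 1 g) \<partial>lborel)"
      by (simp add: ennreal_mult[symmetric])
    also have "\<dots> = ennreal (exp (x\<^sup>2 / (8 * G)))"
      by (subst nn_integral_cmult) (simp_all add: int1)
    finally show ?thesis .
  qed
  have "(\<integral>\<^sup>+\<omega>. ennreal (exp ((X \<omega>)\<^sup>2 / (8 * G))) \<partial>M)
      = (\<integral>\<^sup>+\<omega>. \<integral>\<^sup>+g. ennreal (exp (X \<omega> / ?r * g)) * ennreal (std_normal_density g) \<partial>lborel \<partial>M)"
    by (simp only: gauss)
  also have "\<dots> = (\<integral>\<^sup>+g. \<integral>\<^sup>+\<omega>. ennreal (exp (X \<omega> / ?r * g)) * ennreal (std_normal_density g) \<partial>M \<partial>lborel)"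
    by (rule Fubini'[symmetric]) (measurable)
  also have "\<dots> \<le> (\<integral>\<^sup>+g. ennreal (sqrt 2) * ennreal (normal_density 0 (sqrt 2) g) \<partial>lborel)"
  proof (rule nn_integral_mono)
    fix g :: real
    have "(\<integral>\<^sup>+\<omega>. ennreal (exp (X \<omega> / ?r * g)) * ennreal (std_normal_density g) \<partial>M)
        = (\<integral>\<^sup>+\<omega>. ennreal (exp (g / ?r * X \<omega>)) \<partial>M) * ennreal (std_normal_density g)"
      by (subst nn_integral_multc) (simp_all add: mult.commute)
    also have "\<dots> \<le> ennreal (exp (G * (g / ?r)\<^sup>2)) * ennreal (std_normal_density g)"
      by (intro mult_right_mono mgf) auto
    also have "\<dots> = ennreal (sqrt 2) * ennreal (normal_density 0 (sqrt 2) g)"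
    proof -
      have "G * (g / ?r)\<^sup>2 = g\<^sup>2 / 4" using G by (simp add: power_divide power_mult_distrib)
      then have "exp (G * (g / ?r)\<^sup>2) * exp (- g\<^sup>2 / 2) = exp (- g\<^sup>2 / 4)"
        by (simp add: mult_exp_exp)
      then have "exp (G * (g / ?r)\<^sup>2) * std_normal_density g = sqrt 2 * normal_density 0 (sqrt 2) g"
        by (simp add: normal_density_def real_sqrt_mult field_simps)
      then show ?thesis by (simp add: ennreal_mult[symmetric])
    qed
    finally show "(\<integral>\<^sup>+\<omega>. ennreal (exp (X \<omega> / ?r * g)) * ennreal (std_normal_density g) \<partial>M)
      \<le> ennreal (sqrt 2) * ennreal (normal_density 0 (sqrt 2) g)" .
  qed
  also have "\<dots> = ennreal (sqrt 2)"
    by (subst nn_integral_cmult) (simp_all add: int1)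
  also have "\<dots> \<le> ennreal 2" by (intro ennreal_leI) (simp add: real_le_lsqrt)
  finally show ?thesis by simp
qed

end

text \<open>The rate that \<open>exp_square_of_mgf\<close> yields for
  \<open>G = 1 / 2 + mgf_const K\<close>, the constant of \<open>row_mgf_global\<close>. The
  constants for boundedness and restricted isometry are expressed through it.\<close>

definition sq_rate :: "real \<Rightarrow> real" where
  "sq_rate K = 1 / (8 * (1 / 2 + mgf_const K))"

lemma sq_rate_pos: "sq_rate K > 0" and sq_rate_le: "sq_rate K \<le> 1"
  using mgf_const_ge2[of K] by (auto simp: sq_rate_def field_simps)

text \<open>Arbitrary finite index sets make submatrices and transposes instances of the same
  locale, so each bound for rows is also available for the columns of any block of rows.\<close>

locale subgaussian_matrix = prob_space M for M :: "'w measure" +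
  fixes K :: real and P Q :: "nat set" and a :: "nat \<Rightarrow> nat \<Rightarrow> 'w \<Rightarrow> real"
  assumes K_pos: "K > 0" and finite_P: "finite P" and finite_Q: "finite Q"
    and indep: "indep_vars (\<lambda>_. borel) (\<lambda>(i, j). a i j) (P \<times> Q)"
    and entry_sg: "\<And>i j. i \<in> P \<Longrightarrow> j \<in> Q \<Longrightarrow> subgaussian M K (a i j)"
    and entry_mean: "\<And>i j. i \<in> P \<Longrightarrow> j \<in> Q \<Longrightarrow> expectation (a i j) = 0"
    and entry_var: "\<And>i j. i \<in> P \<Longrightarrow> j \<in> Q \<Longrightarrow> variance (a i j) = 1"
begin

lemma entry: "i \<in> P \<Longrightarrow> j \<in> Q \<Longrightarrow> standard_subgaussian M K (a i j)"
  by (intro standard_subgaussian.intro standard_subgaussian_axioms.intro prob_space_axioms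
      K_pos entry_sg entry_mean entry_var)

lemma entry_measurable [measurable]: "i \<in> P \<Longrightarrow> j \<in> Q \<Longrightarrow> a i j \<in> borel_measurable M"
  using entry_sg by (auto simp: subgaussian_def)

lemma submatrix:
  assumes "P' \<subseteq> P" "Q' \<subseteq> Q"
  shows "subgaussian_matrix M K P' Q' a"
proof (intro subgaussian_matrix.intro subgaussian_matrix_axioms.intro prob_space_axioms K_pos)
  show "finite P'" "finite Q'"
    using assms finite_P finite_Q by (auto intro: finite_subset)
  show "indep_vars (\<lambda>_. borel) (\<lambda>(i, j). a i j) (P' \<times> Q')"
    using assms by (intro indep_vars_subset[OF indep]) auto
qed (use assms in \<open>auto intro: entry_sg entry_mean entry_var\<close>)

lemma transposed: "subgaussian_matrix M K Q P (\<lambda>j i. a i j)"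
proof (intro subgaussian_matrix.intro subgaussian_matrix_axioms.intro prob_space_axioms
    K_pos finite_P finite_Q entry_sg entry_mean entry_var)
  have "indep_vars (\<lambda>_. borel) (\<lambda>x. (case (snd x, fst x) of (i, j) \<Rightarrow> a i j)) (Q \<times> P)"
  proof (rule indep_vars_reindex_inj)
    have "(\<lambda>x. (snd x, fst x)) ` (Q \<times> P) = P \<times> Q" by force
    then show "indep_vars (\<lambda>_. borel) (\<lambda>(i, j). a i j) ((\<lambda>x. (snd x, fst x)) ` (Q \<times> P))"
      using indep by simp
  qed (auto simp: inj_on_def)
  then show "indep_vars (\<lambda>_. borel) (\<lambda>(i, j). a j i) (Q \<times> P)"
    by (simp add: case_prod_unfold)
qed

lemma row_indep:
  assumes "\<And>i. i \<in> P \<Longrightarrow> g i \<in> borel_measurable (\<Pi>\<^sub>M j\<in>Q. borel)"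
  shows "indep_vars (\<lambda>_. borel) (\<lambda>i \<omega>. g i (\<lambda>j\<in>Q. a i j \<omega>)) P"
proof -
  have "indep_vars (\<lambda>i. PiM ({i} \<times> Q) (\<lambda>_. borel)) (\<lambda>i \<omega>. restrict (\<lambda>x. (case x of (i, j) \<Rightarrow> a i j) \<omega>) ({i} \<times> Q)) P"
    by (rule indep_vars_restrict[OF indep]) (auto simp: disjoint_family_on_def)
  then have "indep_vars (\<lambda>_. borel) (\<lambda>i \<omega>. g i (\<lambda>j\<in>Q. restrict (\<lambda>x. (case x of (i, j) \<Rightarrow> a i j) \<omega>) ({i} \<times> Q) (i, j))) P"
  proof (rule indep_vars_compose2)
    fix i assume i: "i \<in> P"
    have "(\<lambda>x. \<lambda>j\<in>Q. x (i, j)) \<in> PiM ({i} \<times> Q) (\<lambda>_. borel) \<rightarrow>\<^sub>M (\<Pi>\<^sub>M j\<in>Q. (borel :: real measure))"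
      by (intro measurable_restrict measurable_component_singleton) auto
    then show "(\<lambda>x. g i (\<lambda>j\<in>Q. x (i, j))) \<in> borel_measurable (PiM ({i} \<times> Q) (\<lambda>_. borel))"
      using assms[OF i] by (rule measurable_compose)
  qed
  moreover have "(\<lambda>j\<in>Q. restrict (\<lambda>x. (case x of (i, j) \<Rightarrow> a i j) \<omega>) ({i} \<times> Q) (i, j)) = (\<lambda>j\<in>Q. a i j \<omega>)" for i \<omega>
    by auto
  ultimately show ?thesis by simp
qed

abbreviation row :: "nat \<Rightarrow> 'w \<Rightarrow> nat \<Rightarrow> real" where
  "row i \<omega> \<equiv> (\<lambda>j. a i j \<omega>)"

lemma row_exp:
  assumes i: "i \<in> P"
  shows "integrable M (\<lambda>\<omega>. exp (dot Q v (row i \<omega>)))"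
    and "expectation (\<lambda>\<omega>. exp (dot Q v (row i \<omega>))) = (\<Prod>j\<in>Q. expectation (\<lambda>\<omega>. exp (v j * a i j \<omega>)))"
proof -
  have ind: "indep_vars (\<lambda>_. borel) (\<lambda>x \<omega>. exp (v (snd x) * a (fst x) (snd x) \<omega>)) (Pair i ` Q)"
  proof -
    have "indep_vars (\<lambda>_. borel) (\<lambda>(i, j). a i j) (Pair i ` Q)"
      by (rule indep_vars_subset[OF indep]) (use i in auto)
    from indep_vars_compose2[OF this, of "\<lambda>x y. exp (v (snd x) * y)" "\<lambda>_. borel"]
    show ?thesis by (simp add: case_prod_beta)
  qed
  have int: "integrable M (\<lambda>\<omega>. exp (v (snd x) * a (fst x) (snd x) \<omega>))" if "x \<in> Pair i ` Q" for x
    using that i by (auto intro!: subgaussian_integrable(3)[OF entry_sg K_pos])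
  have inj: "inj_on (Pair i) Q" by (auto simp: inj_on_def)
  have eq: "(\<Prod>x\<in>Pair i ` Q. exp (v (snd x) * a (fst x) (snd x) \<omega>)) = exp (dot Q v (row i \<omega>))" for \<omega>
    using finite_Q by (simp add: prod.reindex[OF inj] dot_def exp_sum)
  show "integrable M (\<lambda>\<omega>. exp (dot Q v (row i \<omega>)))"
    using indep_vars_integrable[OF _ ind int] finite_Q by (simp add: eq)
  show "expectation (\<lambda>\<omega>. exp (dot Q v (row i \<omega>))) = (\<Prod>j\<in>Q. expectation (\<lambda>\<omega>. exp (v j * a i j \<omega>)))"
    using indep_vars_lebesgue_integral[OF _ ind int] finite_Q by (simp add: eq prod.reindex[OF inj])
qed

lemma row_mgf_global:
  assumes i: "i \<in> P"
  shows "expectation (\<lambda>\<omega>. exp (dot Q v (row i \<omega>))) \<le> exp ((1 / 2 + mgf_const K) * (L2_set v Q)\<^sup>2)"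
proof -
  have "(\<Prod>j\<in>Q. expectation (\<lambda>\<omega>. exp (v j * a i j \<omega>))) \<le> (\<Prod>j\<in>Q. exp ((1 / 2 + mgf_const K) * (v j)\<^sup>2))"
    using i by (intro prod_mono conjI standard_subgaussian.mgf_global[OF entry]) auto
  then show ?thesis
    by (simp add: row_exp[OF i] exp_sum[OF finite_Q, symmetric] L2_set_sq sum_distrib_left)
qed

lemma row_mgf_upper:
  assumes i: "i \<in> P" and v: "\<And>j. j \<in> Q \<Longrightarrow> \<bar>v j\<bar> \<le> 1"
  shows "expectation (\<lambda>\<omega>. exp (dot Q v (row i \<omega>)))
    \<le> exp ((L2_set v Q)\<^sup>2 / 2 + mgf_const K * (\<Sum>j\<in>Q. \<bar>v j\<bar> ^ 3))"
proof -
  have "(\<Prod>j\<in>Q. expectation (\<lambda>\<omega>. exp (v j * a i j \<omega>)))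
      \<le> (\<Prod>j\<in>Q. exp ((v j)\<^sup>2 / 2 + mgf_const K * \<bar>v j\<bar> ^ 3))"
    using i v by (intro prod_mono conjI standard_subgaussian.mgf_upper[OF entry]) auto
  then show ?thesis
    by (simp add: row_exp[OF i] exp_sum[OF finite_Q, symmetric] L2_set_sq sum_distrib_left
        sum_divide_distrib sum.distrib)
qed

lemma row_mgf_lower:
  assumes i: "i \<in> P" and v: "\<And>j. j \<in> Q \<Longrightarrow> \<bar>v j\<bar> * mgf_const K \<le> 1 / 2"
  shows "expectation (\<lambda>\<omega>. exp (dot Q v (row i \<omega>)))
    \<ge> exp ((L2_set v Q)\<^sup>2 / 2 - mgf_lower_const K * (\<Sum>j\<in>Q. \<bar>v j\<bar> ^ 3))"
proof -
  have "(\<Prod>j\<in>Q. expectation (\<lambda>\<omega>. exp (v j * a i j \<omega>)))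
      \<ge> (\<Prod>j\<in>Q. exp ((v j)\<^sup>2 / 2 - mgf_lower_const K * \<bar>v j\<bar> ^ 3))"
    using i v by (intro prod_mono conjI standard_subgaussian.mgf_lower[OF entry]) auto
  then show ?thesis
    by (simp add: row_exp[OF i] exp_sum[OF finite_Q, symmetric] L2_set_sq sum_distrib_left
        sum_divide_distrib sum_subtractf)
qed

lemma row_exp_square:
  assumes i: "i \<in> P" and v: "L2_set v Q \<le> 1"
  shows "(\<integral>\<^sup>+\<omega>. ennreal (exp (sq_rate K * (dot Q v (row i \<omega>))\<^sup>2)) \<partial>M) \<le> 2"
proof -
  have v2: "(L2_set v Q)\<^sup>2 \<le> 1" using v by (simp add: power_le_one)
  have "(\<integral>\<^sup>+\<omega>. ennreal (exp ((dot Q v (row i \<omega>))\<^sup>2 / (8 * (1 / 2 + mgf_const K)))) \<partial>M) \<le> 2"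
  proof (rule exp_square_of_mgf)
    show "(\<lambda>\<omega>. dot Q v (row i \<omega>)) \<in> borel_measurable M" using i by measurable
    show "1 / 2 + mgf_const K > 0" using mgf_const_ge2[of K] by simp
    fix t :: real
    have "(\<integral>\<^sup>+\<omega>. ennreal (exp (t * dot Q v (row i \<omega>))) \<partial>M)
        = (\<integral>\<^sup>+\<omega>. ennreal (exp (dot Q (\<lambda>j. t * v j) (row i \<omega>))) \<partial>M)"
      by (simp add: dot_scale_left)
    also have "\<dots> = ennreal (expectation (\<lambda>\<omega>. exp (dot Q (\<lambda>j. t * v j) (row i \<omega>))))"
      by (intro nn_integral_eq_integral row_exp i) auto
    also have "\<dots> \<le> ennreal (exp ((1 / 2 + mgf_const K) * (L2_set (\<lambda>j. t * v j) Q)\<^sup>2))"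
      by (intro ennreal_leI row_mgf_global i)
    also have "\<dots> \<le> ennreal (exp ((1 / 2 + mgf_const K) * t\<^sup>2))"
      using v2 mgf_const_ge2[of K]
      by (intro ennreal_leI) (auto simp: L2_set_scale power_mult_distrib mult_left_le intro!: mult_left_mono)
    finally show "(\<integral>\<^sup>+\<omega>. ennreal (exp (t * dot Q v (row i \<omega>))) \<partial>M) \<le> ennreal (exp ((1 / 2 + mgf_const K) * t\<^sup>2))" .
  qed
  then show ?thesis by (simp add: sq_rate_def)
qed

lemma row_second_moment:
  assumes i: "i \<in> P"
  shows "integrable M (\<lambda>\<omega>. (dot Q v (row i \<omega>))\<^sup>2)"
    and "expectation (\<lambda>\<omega>. (dot Q v (row i \<omega>))\<^sup>2) = (L2_set v Q)\<^sup>2"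
proof -
  have E: "integrable M (\<lambda>\<omega>. a i j \<omega> * a i k \<omega>) \<and>
      expectation (\<lambda>\<omega>. a i j \<omega> * a i k \<omega>) = (if j = k then 1 else 0)" if jk: "j \<in> Q" "k \<in> Q" for j k
  proof (cases "j = k")
    case True
    then show ?thesis
      using standard_subgaussian.second_moment[OF entry[OF i jk(1)]]
        subgaussian_integrable(2)[OF entry_sg[OF i jk(1)] K_pos]
      by (simp add: power2_eq_square)
  next
    case False
    have ind: "indep_vars (\<lambda>_. borel) (\<lambda>(i, j). a i j) {(i, j), (i, k)}"
      by (rule indep_vars_subset[OF indep]) (use i jk in auto)
    have int: "integrable M (case x of (i, j) \<Rightarrow> a i j)" if "x \<in> {(i, j), (i, k)}" for x
      using that i jk by (auto intro!: subgaussian_integrable(1)[OF entry_sg K_pos])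
    show ?thesis
      using indep_vars_lebesgue_integral[OF _ ind int] indep_vars_integrable[OF _ ind int] False i jk
      by (simp add: entry_mean)
  qed
  have sq: "(dot Q v (row i \<omega>))\<^sup>2 = (\<Sum>j\<in>Q. \<Sum>k\<in>Q. v j * v k * (a i j \<omega> * a i k \<omega>))" for \<omega>
    by (simp add: dot_def power2_eq_square sum_product algebra_simps)
  show "integrable M (\<lambda>\<omega>. (dot Q v (row i \<omega>))\<^sup>2)"
    unfolding sq using E by (intro Bochner_Integration.integrable_sum integrable_mult_right) auto
  have "expectation (\<lambda>\<omega>. (dot Q v (row i \<omega>))\<^sup>2) = (\<Sum>j\<in>Q. \<Sum>k\<in>Q. v j * v k * (if j = k then 1 else 0))"
    unfolding sq using E by (subst Bochner_Integration.integral_sum; simp)+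
  also have "\<dots> = (L2_set v Q)\<^sup>2"
    using finite_Q unfolding L2_set_sq by (simp add: power2_eq_square if_distrib cong: if_cong)
  finally show "expectation (\<lambda>\<omega>. (dot Q v (row i \<omega>))\<^sup>2) = (L2_set v Q)\<^sup>2" .
qed

end

section \<open>Nets and uniform lower bounds\<close>

text \<open>
  Rounding the coordinates of a point of the unit ball towards \<open>0\<close> lands in the net, at distance at
  most \<open>\<delta>\<close>.
\<close>

definition lattice_net :: "real \<Rightarrow> nat set \<Rightarrow> (nat \<Rightarrow> real) set" where
  "lattice_net \<delta> Q = {x \<in> Q \<rightarrow>\<^sub>E UNIV.
     (\<forall>j\<in>Q. \<exists>z::int. x j = \<delta> / sqrt (real (card Q)) * of_int z) \<and> L2_set x Q \<le> 1}"

lemma sum_exp_neg_abs_le: "(\<Sum>z\<in>{- int R..int R}. exp (- \<bar>real_of_int z\<bar>)) \<le> 3"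
proof -
  have half: "exp (- real k) \<le> (1 / 2) ^ k" for k
  proof -
    have "exp (- 1 :: real) \<le> 1 / 2"
      using exp_ge_add_one_self[of 1] by (simp add: exp_minus field_simps)
    then have "exp (- 1 :: real) ^ k \<le> (1 / 2) ^ k" by (intro power_mono) auto
    then show ?thesis by (simp add: exp_of_nat_mult[symmetric])
  qed
  \<comment> \<open>The bound 3 alone would not be inductive; the subtracted term is the remaining
    tail of the geometric series with ratio 1/2.\<close>
  have "(\<Sum>z\<in>{- int R..int R}. exp (- \<bar>real_of_int z\<bar>)) \<le> 3 - 2 * (1 / 2) ^ R"
  proof (induction R)
    case (Suc R)
    have "{- int (Suc R)..int (Suc R)} = insert (- int (Suc R)) (insert (int (Suc R)) {- int R..int R})"
      by auto
    then have "(\<Sum>z\<in>{- int (Suc R)..int (Suc R)}. exp (- \<bar>real_of_int z\<bar>))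
        = 2 * exp (- real (Suc R)) + (\<Sum>z\<in>{- int R..int R}. exp (- \<bar>real_of_int z\<bar>))"
      by simp
    also have "\<dots> \<le> 2 * (1 / 2) ^ Suc R + (3 - 2 * (1 / 2) ^ R)"
      using Suc half[of "Suc R"] by linarith
    also have "\<dots> = 3 - 2 * (1 / 2) ^ Suc R" by simp
    finally show ?case .
  qed simp
  also have "\<dots> \<le> 3" by simp
  finally show ?thesis .
qed

lemma sum_abs_le_sqrt_card: "(\<Sum>j\<in>Q. \<bar>x j\<bar>) \<le> sqrt (real (card Q)) * L2_set x Q"
proof -
  have "(\<Sum>j\<in>Q. \<bar>1\<bar> * \<bar>x j\<bar>) \<le> L2_set (\<lambda>_. 1) Q * L2_set x Q" by (rule L2_set_mult_ineq)
  then show ?thesis by (simp add: L2_set_def)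
qed

text \<open>By Cauchy-Schwarz the integer coordinates z of a net point satisfy sum |z_j| \<le> q /
  \<delta>, where q is the dimension. Hence 1 \<le> exp (q / \<delta> - sum |z_j|) on the net, and
  summing this over a whole box factorises, with at most 3 \<le> exp 2 per coordinate.\<close>

lemma card_lattice_net:
  assumes fin: "finite Q" and ne: "Q \<noteq> {}" and \<delta>: "\<delta> > 0"
  shows "finite (lattice_net \<delta> Q)"
    and "real (card (lattice_net \<delta> Q)) \<le> exp ((2 + 1 / \<delta>) * real (card Q))"
proof -
  let ?q = "real (card Q)"
  define g where "g = \<delta> / sqrt ?q"
  have q: "?q > 0" using fin ne by (simp add: card_gt_0_iff)
  have g: "g > 0" using q \<delta> by (simp add: g_def)
  define R where "R = nat \<lceil>?q / \<delta>\<rceil>"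
  define Z where "Z = {- int R..int R}"
  define W where "W = {z \<in> Q \<rightarrow>\<^sub>E Z. (\<Sum>j\<in>Q. \<bar>real_of_int (z j)\<bar>) \<le> ?q / \<delta>}"
  have finPi: "finite (Q \<rightarrow>\<^sub>E Z)" using fin by (intro finite_PiE) (auto simp: Z_def)
  have finW: "finite W" unfolding W_def using finPi by simp
  have sub: "lattice_net \<delta> Q \<subseteq> (\<lambda>z. \<lambda>j\<in>Q. g * of_int (z j)) ` W"
  proof
    fix x assume x: "x \<in> lattice_net \<delta> Q"
    then obtain z0 where z0: "\<And>j. j \<in> Q \<Longrightarrow> x j = g * of_int (z0 j)"
      unfolding lattice_net_def g_def by (auto simp: Bex_def) metis
    define z where "z = restrict z0 Q"
    have xz: "x = (\<lambda>j\<in>Q. g * of_int (z j))"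
      using x z0 unfolding lattice_net_def z_def by (auto simp: PiE_def extensional_def)
    have "g * (\<Sum>j\<in>Q. \<bar>real_of_int (z j)\<bar>) = (\<Sum>j\<in>Q. \<bar>x j\<bar>)"
      using g by (simp add: xz sum_distrib_left abs_mult)
    also have "\<dots> \<le> sqrt ?q * L2_set x Q" by (rule sum_abs_le_sqrt_card)
    also have "\<dots> \<le> sqrt ?q * 1" using x by (intro mult_left_mono) (auto simp: lattice_net_def)
    finally have "(\<Sum>j\<in>Q. \<bar>real_of_int (z j)\<bar>) \<le> sqrt ?q / g" using g by (simp add: field_simps)
    also have "sqrt ?q / g = ?q / \<delta>" using q \<delta> by (simp add: g_def field_simps)
    finally have sz: "(\<Sum>j\<in>Q. \<bar>real_of_int (z j)\<bar>) \<le> ?q / \<delta>" .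
    have "z j \<in> Z" if "j \<in> Q" for j
    proof -
      have "\<bar>real_of_int (z j)\<bar> \<le> (\<Sum>j\<in>Q. \<bar>real_of_int (z j)\<bar>)"
        by (rule member_le_sum) (use that fin in auto)
      then have "\<bar>real_of_int (z j)\<bar> \<le> of_int \<lceil>?q / \<delta>\<rceil>" using sz by linarith
      then have "\<bar>z j\<bar> \<le> \<lceil>?q / \<delta>\<rceil>" by linarith
      moreover have "0 \<le> ?q / \<delta>" using q \<delta> by simp
      then have "0 \<le> \<lceil>?q / \<delta>\<rceil>" by linarith
      ultimately show ?thesis unfolding Z_def R_def by auto
    qed
    then have "z \<in> W" using sz by (auto simp: W_def z_def)
    then show "x \<in> (\<lambda>z. \<lambda>j\<in>Q. g * of_int (z j)) ` W" using xz by blast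
  qed
  show "finite (lattice_net \<delta> Q)" using finite_subset[OF sub] finW by auto
  have "real (card (lattice_net \<delta> Q)) \<le> real (card W)"
    using card_mono[OF finite_imageI[OF finW] sub] card_image_le[OF finW] by (meson of_nat_mono order_trans)
  also have "\<dots> = (\<Sum>z\<in>W. 1)" by simp
  also have "\<dots> \<le> (\<Sum>z\<in>W. exp (?q / \<delta>) * (\<Prod>j\<in>Q. exp (- \<bar>real_of_int (z j)\<bar>)))"
  proof (rule sum_mono)
    fix z assume "z \<in> W"
    then have "0 \<le> ?q / \<delta> + (\<Sum>j\<in>Q. - \<bar>real_of_int (z j)\<bar>)" by (simp add: W_def sum_negf)
    then have "1 \<le> exp (?q / \<delta> + (\<Sum>j\<in>Q. - \<bar>real_of_int (z j)\<bar>))" by simp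
    then show "1 \<le> exp (?q / \<delta>) * (\<Prod>j\<in>Q. exp (- \<bar>real_of_int (z j)\<bar>))"
      by (simp add: exp_add exp_sum[OF fin])
  qed
  also have "\<dots> \<le> (\<Sum>z\<in>Q \<rightarrow>\<^sub>E Z. exp (?q / \<delta>) * (\<Prod>j\<in>Q. exp (- \<bar>real_of_int (z j)\<bar>)))"
    by (rule sum_mono2[OF finPi]) (auto simp: W_def intro!: mult_nonneg_nonneg prod_nonneg)
  also have "\<dots> = exp (?q / \<delta>) * (\<Prod>j\<in>Q. \<Sum>z\<in>Z. exp (- \<bar>real_of_int z\<bar>))"
    using fin by (subst prod_sum_PiE) (auto simp: Z_def sum_distrib_left)
  also have "\<dots> \<le> exp (?q / \<delta>) * (\<Prod>j\<in>Q. exp 2)"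
  proof (intro mult_left_mono prod_mono conjI)
    show "(\<Sum>z\<in>Z. exp (- \<bar>real_of_int z\<bar>)) \<le> exp 2"
      using sum_exp_neg_abs_le[of R] exp_ge_add_one_self[of 2] unfolding Z_def by linarith
  qed (auto intro: sum_nonneg)
  also have "\<dots> = exp ((2 + 1 / \<delta>) * ?q)"
    by (simp add: exp_of_nat_mult[symmetric] exp_add[symmetric] algebra_simps)
  finally show "real (card (lattice_net \<delta> Q)) \<le> exp ((2 + 1 / \<delta>) * real (card Q))" .
qed

lemma lattice_net_round:
  assumes fin: "finite Q" and ne: "Q \<noteq> {}" and \<delta>: "\<delta> > 0" and x: "L2_set x Q \<le> 1"
  obtains y where "y \<in> lattice_net \<delta> Q" "L2_set (\<lambda>j. x j - y j) Q \<le> \<delta>"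
proof -
  let ?q = "real (card Q)"
  define g where "g = \<delta> / sqrt ?q"
  have q: "?q > 0" using fin ne by (simp add: card_gt_0_iff)
  have g: "g > 0" using q \<delta> by (simp add: g_def)
  define tr :: "real \<Rightarrow> int" where "tr r = (if r \<ge> 0 then \<lfloor>r\<rfloor> else \<lceil>r\<rceil>)" for r
  have tr: "\<bar>of_int (tr r)\<bar> \<le> \<bar>r\<bar>" "\<bar>r - of_int (tr r)\<bar> \<le> 1" for r
  proof -
    have "r \<ge> 0 \<Longrightarrow> 0 \<le> real_of_int \<lfloor>r\<rfloor>" "r < 0 \<Longrightarrow> real_of_int \<lceil>r\<rceil> \<le> 0" by auto
    then show "\<bar>of_int (tr r)\<bar> \<le> \<bar>r\<bar>" "\<bar>r - of_int (tr r)\<bar> \<le> 1"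
      unfolding tr_def using floor_correct[of r] ceiling_correct[of r] by (cases "r \<ge> 0"; simp; linarith)+
  qed
  define y where "y = (\<lambda>j\<in>Q. g * of_int (tr (x j / g)))"
  have y1: "\<bar>y j\<bar> \<le> \<bar>x j\<bar>" if "j \<in> Q" for j
    using tr(1)[of "x j / g"] g that by (simp add: y_def abs_mult field_simps)
  have y2: "\<bar>x j - y j\<bar> \<le> g" if "j \<in> Q" for j
  proof -
    have "g * \<bar>x j / g - of_int (tr (x j / g))\<bar> \<le> g * 1"
      using tr(2)[of "x j / g"] g by (intro mult_left_mono) auto
    moreover have "g * \<bar>x j / g - of_int (tr (x j / g))\<bar> = \<bar>x j - y j\<bar>"
    proof -
      have "g * (x j / g - of_int (tr (x j / g))) = x j - y j"
        using g that by (simp add: y_def right_diff_distrib)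
      then show ?thesis using g by (metis abs_mult abs_of_pos)
    qed
    ultimately show ?thesis by simp
  qed
  have "L2_set y Q \<le> L2_set x Q"
    unfolding L2_set_def using y1 by (intro real_sqrt_le_mono sum_mono) (simp add: abs_le_square_iff)
  then have "y \<in> lattice_net \<delta> Q"
    using x unfolding lattice_net_def by (auto simp: y_def g_def)
  moreover have "L2_set (\<lambda>j. x j - y j) Q \<le> \<delta>"
  proof -
    have "(\<Sum>j\<in>Q. (x j - y j)\<^sup>2) \<le> (\<Sum>j\<in>Q. g\<^sup>2)"
      using y2 g by (intro sum_mono) (simp add: abs_le_square_iff[symmetric])
    also have "\<dots> = \<delta>\<^sup>2" using q by (simp add: g_def power_divide)
    finally show ?thesis using \<delta> by (simp add: L2_set_def real_le_lsqrt)
  qed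
  ultimately show ?thesis by (rule that)
qed

text \<open>The direction of v is tested after rounding, which loses at most half of the norm of
  v.\<close>

lemma L2_set_le_of_net:
  assumes fin: "finite Q" and ne: "Q \<noteq> {}"
    and net: "\<And>\<theta>. \<theta> \<in> lattice_net (1 / 2) Q \<Longrightarrow> dot Q \<theta> v \<le> t"
  shows "L2_set v Q \<le> 2 * t"
proof (cases "L2_set v Q = 0")
  case True
  obtain y where "y \<in> lattice_net (1 / 2) Q" using lattice_net_round[OF fin ne, of "1 / 2" "\<lambda>_. 0"]
    by (auto simp: L2_set_def)
  moreover have "\<bar>dot Q y v\<bar> \<le> 0" using abs_dot_le[of Q y v] True by simp
  ultimately show ?thesis using net True by fastforce
next
  case False
  define r where "r = L2_set v Q"
  have r: "r > 0" using False L2_set_nonneg[of v Q] unfolding r_def by linarith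
  define x where "x j = 1 / r * v j" for j
  have "L2_set x Q = 1" unfolding x_def L2_set_scale using r by (simp add: r_def)
  then obtain y where y: "y \<in> lattice_net (1 / 2) Q" "L2_set (\<lambda>j. x j - y j) Q \<le> 1 / 2"
    using lattice_net_round[OF fin ne, of "1 / 2" x] by auto
  have "dot Q x v = 1 / r * r\<^sup>2" unfolding x_def dot_scale_left r_def by (simp add: dot_self)
  then have "dot Q x v = r" using r by (simp add: power2_eq_square)
  moreover have "dot Q (\<lambda>j. x j - y j) v \<le> 1 / 2 * r"
    using y(2) r by (intro order_trans[OF dot_le] mult_mono) (auto simp: r_def)
  ultimately have "r \<le> t + 1 / 2 * r"
    using net[OF y(1)] by (simp add: dot_diff_left)
  then show ?thesis by (simp add: r_def)
qed

text \<open>The l1 norm of a matrix-vector product. It is preferred to the l2 norm because |u| \<le>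
  2 - u for u \<le> 1 lets \<open>polyhedron_bounded\<close> estimate it from one-sided constraints;
  where an l2 bound is wanted, Cauchy-Schwarz supplies it.\<close>

definition l1_dot :: "nat set \<Rightarrow> nat set \<Rightarrow> (nat \<Rightarrow> nat \<Rightarrow> real) \<Rightarrow> (nat \<Rightarrow> real) \<Rightarrow> real" where
  "l1_dot P Q X v = (\<Sum>i\<in>P. \<bar>dot Q v (X i)\<bar>)"

lemma l1_dot_diff: "l1_dot P Q X v \<le> l1_dot P Q X u + l1_dot P Q X (\<lambda>j. v j - u j)"
  unfolding l1_dot_def sum.distrib[symmetric] dot_diff_left by (intro sum_mono) linarith

lemma l1_dot_scale: "l1_dot P Q X (\<lambda>j. c * v j) = \<bar>c\<bar> * l1_dot P Q X v"
  unfolding l1_dot_def dot_scale_left by (simp add: abs_mult sum_distrib_left)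

text \<open>Let M be the supremum over the unit ball. Rounding to the net gives M \<le> B + \<delta>
  M, and \<delta> \<le> 1/2 lets the left side absorb the last term; for this M has to be known
  finite first.\<close>

lemma l1_dot_bound_of_net:
  assumes fin: "finite Q" and ne: "Q \<noteq> {}" and \<delta>: "0 < \<delta>" "\<delta> \<le> 1 / 2"
    and up: "\<And>x. x \<in> lattice_net \<delta> Q \<Longrightarrow> l1_dot P Q X x \<le> B"
    and v: "L2_set v Q \<le> r" and r: "r > 0"
  shows "l1_dot P Q X v \<le> 2 * B * r"
proof -
  let ?S = "l1_dot P Q X"
  define U where "U = {x. L2_set x Q \<le> 1}"
  define M where "M = (SUP x\<in>U. ?S x)"
  have bdd: "bdd_above (?S ` U)"
  proof (rule bdd_aboveI2)
    fix x assume x: "x \<in> U"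
    have "\<bar>dot Q x (X i)\<bar> \<le> 1 * L2_set (X i) Q" for i
      using x by (intro order_trans[OF abs_dot_le] mult_right_mono) (auto simp: U_def)
    then show "?S x \<le> (\<Sum>i\<in>P. L2_set (X i) Q)" unfolding l1_dot_def by (intro sum_mono) simp
  qed
  have U0: "(\<lambda>_. 0) \<in> U" by (simp add: U_def L2_set_def)
  have le: "?S x \<le> M" if "x \<in> U" for x unfolding M_def using bdd that by (rule cSUP_upper2) simp
  have "?S x \<le> B + \<delta> * M" if x: "x \<in> U" for x
  proof -
    obtain y where y: "y \<in> lattice_net \<delta> Q" "L2_set (\<lambda>j. x j - y j) Q \<le> \<delta>"
      using lattice_net_round[OF fin ne \<delta>(1), of x] x by (auto simp: U_def)
    have "(\<lambda>j. 1 / \<delta> * (x j - y j)) \<in> U"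
      using y(2) \<delta> unfolding U_def mem_Collect_eq L2_set_scale by (simp add: field_simps)
    from le[OF this] have "?S (\<lambda>j. x j - y j) \<le> \<delta> * M"
      using \<delta> unfolding l1_dot_scale by (simp add: field_simps)
    then show ?thesis using up[OF y(1)] l1_dot_diff[of P Q X x y] by linarith
  qed
  then have "M \<le> B + \<delta> * M" unfolding M_def using U0 by (intro cSUP_least) auto
  moreover have "0 \<le> M" using le[OF U0] by (simp add: l1_dot_def dot_def)
  then have "\<delta> * M \<le> 1 / 2 * M" using \<delta> by (intro mult_right_mono) auto
  ultimately have M2: "M \<le> 2 * B" by linarith
  have "(\<lambda>j. 1 / r * v j) \<in> U"
    using v r unfolding U_def mem_Collect_eq L2_set_scale by (simp add: field_simps)
  from le[OF this] have "?S v \<le> M * r"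
    using r unfolding l1_dot_scale by (simp add: field_simps)
  also have "\<dots> \<le> 2 * B * r" using M2 r by (intro mult_right_mono) auto
  finally show ?thesis .
qed

text \<open>The direction of v rounds to a net point of norm at least 1/2, where the value is at
  least b. By \<open>l1_dot_bound_of_net\<close> the rounding error costs at most 2 B \<delta> \<le>
  b / 2.\<close>

lemma l1_dot_lower_of_net:
  assumes fin: "finite Q" and ne: "Q \<noteq> {}" and \<delta>: "0 < \<delta>" "\<delta> \<le> 1 / 2"
    and up: "\<And>x. x \<in> lattice_net \<delta> Q \<Longrightarrow> l1_dot P Q X x \<le> B"
    and low: "\<And>x. x \<in> lattice_net \<delta> Q \<Longrightarrow> 1 / 2 \<le> L2_set x Q \<Longrightarrow> b \<le> l1_dot P Q X x"
    and \<delta>B: "4 * \<delta> * B \<le> b"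
  shows "b / 2 * L2_set v Q \<le> l1_dot P Q X v"
proof (cases "L2_set v Q = 0")
  case True
  then show ?thesis by (simp add: l1_dot_def sum_nonneg)
next
  case False
  define r where "r = L2_set v Q"
  have r: "r > 0" using False L2_set_nonneg[of v Q] unfolding r_def by linarith
  define x where "x j = 1 / r * v j" for j
  have x1: "L2_set x Q = 1" unfolding x_def L2_set_scale using r by (simp add: r_def)
  then obtain y where y: "y \<in> lattice_net \<delta> Q" "L2_set (\<lambda>j. x j - y j) Q \<le> \<delta>"
    using lattice_net_round[OF fin ne \<delta>(1), of x] by auto
  have "L2_set x Q \<le> L2_set (\<lambda>j. x j - y j) Q + L2_set y Q"
    using L2_set_triangle_ineq[of "\<lambda>j. x j - y j" y Q] by simp
  then have "1 / 2 \<le> L2_set y Q" using x1 y(2) \<delta> by simp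
  then have "b \<le> l1_dot P Q X y" by (rule low[OF y(1)])
  also have "\<dots> \<le> l1_dot P Q X x + l1_dot P Q X (\<lambda>j. y j - x j)" by (rule l1_dot_diff)
  also have "l1_dot P Q X (\<lambda>j. y j - x j) \<le> 2 * B * \<delta>"
  proof (rule l1_dot_bound_of_net[OF fin ne \<delta> up _ \<delta>(1)])
    show "L2_set (\<lambda>j. y j - x j) Q \<le> \<delta>" using y(2) by (simp add: L2_set_def power2_commute)
  qed
  finally have "b / 2 \<le> l1_dot P Q X x" using \<delta>B by (simp add: mult_ac)
  moreover have "l1_dot P Q X x = 1 / r * l1_dot P Q X v"
    using r unfolding x_def l1_dot_scale by simp
  ultimately show ?thesis using r by (simp add: r_def[symmetric] field_simps)
qed

lemma exp_neg_le_quadratic: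
  fixes u :: real assumes "u \<ge> 0"
  shows "exp (- u) \<le> 1 - u + u\<^sup>2 / 2"
proof -
  obtain t where "exp (- u) = (\<Sum>m<3. (- u) ^ m / fact m) + exp t / fact 3 * (- u) ^ 3"
    using Maclaurin_exp_le[of "- u" 3] by blast
  moreover have "exp t / fact 3 * (- u) ^ 3 \<le> 0" using assms by (simp add: mult_nonneg_nonpos)
  ultimately show ?thesis by (simp add: eval_nat_numeral)
qed

section \<open>Lower bounds for the l1 norm, uniform over all vectors\<close>

context subgaussian_matrix
begin

lemma sq_upper_tail:
  assumes v: "L2_set v Q \<le> 1"
  shows "prob {\<omega> \<in> space M. t \<le> sq_rate K * (\<Sum>i\<in>P. (dot Q v (row i \<omega>))\<^sup>2)} \<le> exp (real (card P) - t)"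
proof -
  have ind: "indep_vars (\<lambda>_. borel) (\<lambda>i \<omega>. sq_rate K * (dot Q v (\<lambda>j\<in>Q. a i j \<omega>))\<^sup>2) P"
    by (rule row_indep) measurable
  have eq: "dot Q v (\<lambda>j\<in>Q. a i j \<omega>) = dot Q v (row i \<omega>)" for i \<omega> by (simp add: dot_def)
  have "prob {\<omega> \<in> space M. t \<le> (\<Sum>i\<in>P. sq_rate K * (dot Q v (row i \<omega>))\<^sup>2)} \<le> exp (real (card P) * 1 - t)"
  proof (rule chernoff_sum[OF finite_P ind[unfolded eq]])
    fix i assume "i \<in> P"
    then have "(\<integral>\<^sup>+\<omega>. ennreal (exp (sq_rate K * (dot Q v (row i \<omega>))\<^sup>2)) \<partial>M) \<le> ennreal 2"
      using row_exp_square[OF _ v] by simp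
    also have "\<dots> \<le> ennreal (exp 1)" using exp_ge_add_one_self[of 1] by (intro ennreal_leI) simp
    finally show "(\<integral>\<^sup>+\<omega>. ennreal (exp (sq_rate K * (dot Q v (row i \<omega>))\<^sup>2)) \<partial>M) \<le> ennreal (exp 1)" .
  qed
  then show ?thesis by (simp add: sum_distrib_left)
qed

text \<open>The first absolute moment is bounded below through the second and the fourth: |x| \<ge>
  (x^2 - x^4 / A^2) / A holds for all real x, the second moment is at least 1/4, and the fourth is
  controlled by the exponential square moment. The parameter l is a small multiple of 1/A, so that
  this linear gain dominates the second-order term of exp (- l |x|).\<close>

lemma row_abs_mgf:
  assumes i: "i \<in> P" and v: "1 / 2 \<le> L2_set v Q" "L2_set v Q \<le> 1"
  defines "l \<equiv> sq_rate K / 48"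
  shows "(\<integral>\<^sup>+\<omega>. ennreal (exp (- l * \<bar>dot Q v (row i \<omega>)\<bar>)) \<partial>M) \<le> ennreal (exp (- (l\<^sup>2 / 2)))"
proof -
  let ?s = "sq_rate K" let ?\<xi> = "\<lambda>\<omega>. dot Q v (row i \<omega>)"
  note s = sq_rate_pos[of K]
  define A where "A = 6 / ?s"  \<comment> \<open>makes the quartic term below at most half of the quadratic one\<close>
  have A: "A > 0" "l = 1 / (8 * A)" "36 / ?s\<^sup>2 = A\<^sup>2"
    using s by (auto simp: A_def l_def power_divide)
  have [measurable]: "?\<xi> \<in> borel_measurable M" using i by measurable
  define E where "E \<omega> = exp (?s * (?\<xi> \<omega>)\<^sup>2)" for \<omega>
  have [measurable]: "E \<in> borel_measurable M" unfolding E_def by measurable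
  have le2: "(\<integral>\<^sup>+\<omega>. ennreal (E \<omega>) \<partial>M) \<le> 2" unfolding E_def by (rule row_exp_square[OF i v(2)])
  have intE: "integrable M E"
    using le2 by (intro integrableI_nonneg) (auto simp: less_top[symmetric] top_unique E_def)
  have EE: "expectation E \<le> 2"
  proof -
    have "ennreal (expectation E) \<le> ennreal 2"
      using le2 intE by (subst nn_integral_eq_integral[symmetric]) (auto simp: E_def)
    then show ?thesis by (subst (asm) ennreal_le_iff) auto
  qed
  have pw: "\<bar>x\<bar> \<ge> (x\<^sup>2 - x ^ 4 / A\<^sup>2) / A" for x :: real
  proof (cases "\<bar>x\<bar> \<le> A")
    case True
    have "x\<^sup>2 - x ^ 4 / A\<^sup>2 \<le> x\<^sup>2" by simp
    also have "\<dots> = \<bar>x\<bar> * \<bar>x\<bar>" by (simp add: power2_eq_square)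
    also have "\<dots> \<le> \<bar>x\<bar> * A" using True by (intro mult_left_mono) auto
    finally show ?thesis using A by (simp add: field_simps)
  next
    case False
    then have "A\<^sup>2 \<le> x\<^sup>2" using A by (simp add: abs_le_square_iff[symmetric])
    then have "A\<^sup>2 * x\<^sup>2 \<le> x ^ 4" using mult_right_mono[of "A\<^sup>2" "x\<^sup>2" "x\<^sup>2"] by (simp add: power2_eq_square power4_eq_xxxx mult.assoc)
    then have "x\<^sup>2 - x ^ 4 / A\<^sup>2 \<le> 0" using A by (simp add: field_simps)
    then have "(x\<^sup>2 - x ^ 4 / A\<^sup>2) / A \<le> 0" using A by (simp add: divide_nonpos_pos)
    then show ?thesis by linarith
  qed
  have four: "x ^ 4 \<le> 2 / ?s\<^sup>2 * exp (?s * x\<^sup>2)" for x :: real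
  proof -
    have "(?s * x\<^sup>2)\<^sup>2 \<le> 2 * exp (?s * x\<^sup>2)"
      using power_le_fact_exp[of "?s * x\<^sup>2" 2] s by (simp add: fact_2)
    then show ?thesis using s by (simp add: field_simps power_mult_distrib flip: power_mult)
  qed
  let ?g = "\<lambda>\<omega>. 1 - l / A * (?\<xi> \<omega>)\<^sup>2 + l / A * (2 / ?s\<^sup>2 / A\<^sup>2 * E \<omega>) + l\<^sup>2 / 2 * (?\<xi> \<omega>)\<^sup>2"
  have l: "l > 0" using s by (simp add: l_def)
  have ub: "exp (- l * \<bar>?\<xi> \<omega>\<bar>) \<le> ?g \<omega>" for \<omega>
  proof -
    have "exp (- l * \<bar>?\<xi> \<omega>\<bar>) \<le> 1 - l * \<bar>?\<xi> \<omega>\<bar> + l\<^sup>2 / 2 * (?\<xi> \<omega>)\<^sup>2"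
      using exp_neg_le_quadratic[of "l * \<bar>?\<xi> \<omega>\<bar>"] l by (simp add: power_mult_distrib)
    moreover have "l * (((?\<xi> \<omega>)\<^sup>2 - (?\<xi> \<omega>) ^ 4 / A\<^sup>2) / A) \<le> l * \<bar>?\<xi> \<omega>\<bar>"
      using pw l by (intro mult_left_mono) auto
    moreover have "l / A * ((?\<xi> \<omega>) ^ 4 / A\<^sup>2) \<le> l / A * (2 / ?s\<^sup>2 * E \<omega> / A\<^sup>2)"
      using four[of "?\<xi> \<omega>"] l A unfolding E_def by (intro mult_left_mono divide_right_mono) auto
    ultimately show ?thesis
      by (simp add: diff_divide_distrib right_diff_distrib power2_eq_square mult_ac)
  qed
  note i2 = row_second_moment[OF i, of v]
  have "(\<integral>\<^sup>+\<omega>. ennreal (exp (- l * \<bar>?\<xi> \<omega>\<bar>)) \<partial>M) \<le> (\<integral>\<^sup>+\<omega>. ennreal (?g \<omega>) \<partial>M)"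
    using ub by (intro nn_integral_mono ennreal_leI) auto
  also have "\<dots> = ennreal (expectation ?g)"
  proof (rule nn_integral_eq_integral)
    show "integrable M ?g" using i2 intE by auto
    show "AE \<omega> in M. 0 \<le> ?g \<omega>" using ub by (auto intro: order_trans[OF exp_ge_zero])
  qed
  also have "expectation ?g = 1 - l / A * (L2_set v Q)\<^sup>2 + l / A * (2 / ?s\<^sup>2 / A\<^sup>2 * expectation E) + l\<^sup>2 / 2 * (L2_set v Q)\<^sup>2"
    using i2 intE by (simp add: prob_space)
  also have "\<dots> \<le> 1 - l / A * (1 / 4) + l / A * (1 / 9) + l\<^sup>2 / 2 * 1"
  proof -
    have "(1 / 2)\<^sup>2 \<le> (L2_set v Q)\<^sup>2" using v by (intro power_mono) auto
    then have v2: "1 / 4 \<le> (L2_set v Q)\<^sup>2" "(L2_set v Q)\<^sup>2 \<le> 1"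
      using v by (auto simp: power2_eq_square power_le_one mult_le_one)
    have "2 / ?s\<^sup>2 / A\<^sup>2 = 1 / 18" using s by (simp add: A_def power_divide)
    then have "2 / ?s\<^sup>2 / A\<^sup>2 * expectation E \<le> 1 / 9" using EE by simp
    then have "l / A * (2 / ?s\<^sup>2 / A\<^sup>2 * expectation E) \<le> l / A * (1 / 9)"
      using l A by (intro mult_left_mono) auto
    moreover have "l / A * (1 / 4) \<le> l / A * (L2_set v Q)\<^sup>2"
      using l A v2 by (intro mult_left_mono) auto
    moreover have "l\<^sup>2 / 2 * (L2_set v Q)\<^sup>2 \<le> l\<^sup>2 / 2 * 1"
      using v2 by (intro mult_left_mono) auto
    ultimately show ?thesis by (intro add_mono diff_mono order_refl)
  qed
  \<comment> \<open>As l / A = 8 l^2, the gain is 8 (1/4 - 1/9) l^2 = (10/9) l^2. It covers the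
    second-order term l^2 / 2 and leaves more than l^2 / 2.\<close>
  also have "\<dots> \<le> 1 - l\<^sup>2 / 2"
  proof -
    have "l / A = 8 * l\<^sup>2" using A(1,2) by (simp add: power2_eq_square field_simps)
    then show ?thesis by simp
  qed
  also have "\<dots> \<le> exp (- (l\<^sup>2 / 2))"
    using exp_ge_add_one_self[of "- (l\<^sup>2 / 2)"] by simp
  finally show ?thesis by (simp add: ennreal_leI)
qed

lemma l1_lower_tail:
  assumes v: "1 / 2 \<le> L2_set v Q" "L2_set v Q \<le> 1"
  shows "prob {\<omega> \<in> space M. l1_dot P Q (\<lambda>i. row i \<omega>) v \<le> sq_rate K / 192 * real (card P)}
     \<le> exp (- ((sq_rate K)\<^sup>2 / 9216) * real (card P))"
proof -
  define l where "l = sq_rate K / 48"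
  have l: "l > 0" using sq_rate_pos[of K] by (simp add: l_def)
  have ind: "indep_vars (\<lambda>_. borel) (\<lambda>i \<omega>. - l * \<bar>dot Q v (\<lambda>j\<in>Q. a i j \<omega>)\<bar>) P"
    by (rule row_indep) measurable
  have eq: "dot Q v (\<lambda>j\<in>Q. a i j \<omega>) = dot Q v (row i \<omega>)" for i \<omega> by (simp add: dot_def)
  \<comment> \<open>The threshold l / 4 = s / 192 per row, with s = \<open>sq_rate K\<close>, spends
    half of the exponent l^2 / 2 given by \<open>row_abs_mgf\<close>; the other half is l^2 / 4 =
    s^2 / 9216.\<close>
  have "prob {\<omega> \<in> space M. - l * (l / 4) * real (card P) \<le> (\<Sum>i\<in>P. - l * \<bar>dot Q v (row i \<omega>)\<bar>)}
      \<le> exp (real (card P) * (- (l\<^sup>2 / 2)) - (- l * (l / 4) * real (card P)))"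
    by (rule chernoff_sum[OF finite_P ind[unfolded eq]]) (use row_abs_mgf[OF _ v] in \<open>simp add: l_def\<close>)
  moreover have "(- l * (l / 4) * real (card P) \<le> (\<Sum>i\<in>P. - l * \<bar>dot Q v (row i \<omega>)\<bar>))
      = (l1_dot P Q (\<lambda>i. row i \<omega>) v \<le> sq_rate K / 192 * real (card P))" for \<omega>
  proof -
    let ?x = "l1_dot P Q (\<lambda>i. row i \<omega>) v"
    have "(\<Sum>i\<in>P. - l * \<bar>dot Q v (row i \<omega>)\<bar>) = - (l * ?x)"
      by (simp add: l1_dot_def sum_distrib_left sum_negf)
    moreover have "- l * (l / 4) * real (card P) = - (l * (l / 4 * real (card P)))" by simp
    ultimately have "(- l * (l / 4) * real (card P) \<le> (\<Sum>i\<in>P. - l * \<bar>dot Q v (row i \<omega>)\<bar>))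
      = (l * ?x \<le> l * (l / 4 * real (card P)))" by linarith
    also have "\<dots> = (?x \<le> l / 4 * real (card P))" using l by (subst mult_le_cancel_left_pos) auto
    finally show ?thesis by (simp add: l_def)
  qed
  moreover have "real (card P) * (- (l\<^sup>2 / 2)) - (- l * (l / 4) * real (card P)) = - ((sq_rate K)\<^sup>2 / 9216) * real (card P)"
    by (simp add: l_def power2_eq_square algebra_simps)
  ultimately show ?thesis by simp
qed

text \<open>The lower tail is used at net points of norm at least 1/2, the upper tail at all net
  points. The exceptional event is a finite union over the net, hence measurable, although the
  conclusion is quantified over all vectors.\<close>

lemma l1_uniform_lower:
  assumes ne: "P \<noteq> {}" "Q \<noteq> {}"
  obtains B where "B \<in> events"
    "prob B \<le> 2 * exp ((2 + 1536 / (sq_rate K)\<^sup>2) * real (card Q) - (sq_rate K)\<^sup>2 / 9216 * real (card P))"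
    "\<And>\<omega> v. \<omega> \<in> space M - B \<Longrightarrow> sq_rate K / 384 * real (card P) * L2_set v Q \<le> l1_dot P Q (\<lambda>i. row i \<omega>) v"
proof -
  let ?s = "sq_rate K" let ?p = "real (card P)" let ?c = "?s\<^sup>2 / 9216"
  note s = sq_rate_pos[of K] sq_rate_le[of K]
  \<comment> \<open>The largest mesh with 4 \<delta> B \<le> b in
    \<open>l1_dot_lower_of_net\<close>, for B = (2 / s) p and b = (s / 192) p.\<close>
  define \<delta> where "\<delta> = ?s\<^sup>2 / 1536"
  have s2: "?s\<^sup>2 \<le> 1" using s by (simp add: power_le_one)
  have \<delta>: "0 < \<delta>" "\<delta> \<le> 1 / 2" using s s2 by (auto simp: \<delta>_def)
  let ?N = "lattice_net \<delta> Q"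
  note net = card_lattice_net[OF finite_Q ne(2) \<delta>(1)]
  define B1 where "B1 x = {\<omega> \<in> space M. l1_dot P Q (\<lambda>i. row i \<omega>) x \<le> ?s / 192 * ?p}" for x
  define B2 where "B2 x = {\<omega> \<in> space M. 2 * ?p \<le> ?s * (\<Sum>i\<in>P. (dot Q x (row i \<omega>))\<^sup>2)}" for x
  have meas: "B1 x \<in> events" "B2 x \<in> events" for x
    unfolding B1_def B2_def l1_dot_def by measurable
  define B where "B = (\<Union>x\<in>{x\<in>?N. 1 / 2 \<le> L2_set x Q}. B1 x) \<union> (\<Union>x\<in>?N. B2 x)"
  have Bm: "B \<in> events" unfolding B_def using meas net(1) by (intro sets.Un sets.finite_UN) auto
  have "prob B \<le> (\<Sum>x\<in>{x\<in>?N. 1 / 2 \<le> L2_set x Q}. prob (B1 x)) + (\<Sum>x\<in>?N. prob (B2 x))"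
    unfolding B_def using meas net(1)
    by (intro order_trans[OF measure_Un_le] add_mono measure_UNION_le sets.finite_UN) auto
  also have "\<dots> \<le> (\<Sum>x\<in>{x\<in>?N. 1 / 2 \<le> L2_set x Q}. exp (- ?c * ?p)) + (\<Sum>x\<in>?N. exp (- ?c * ?p))"
  proof (intro add_mono sum_mono)
    show "prob (B1 x) \<le> exp (- ?c * ?p)" if "x \<in> {x\<in>?N. 1 / 2 \<le> L2_set x Q}" for x
      unfolding B1_def using that by (intro l1_lower_tail) (auto simp: lattice_net_def)
    show "prob (B2 x) \<le> exp (- ?c * ?p)" if "x \<in> ?N" for x
    proof -
      have "prob (B2 x) \<le> exp (?p - 2 * ?p)"
        unfolding B2_def using that by (intro sq_upper_tail) (auto simp: lattice_net_def)
      also have "\<dots> \<le> exp (- ?c * ?p)" using s2 mult_right_mono[of "?s\<^sup>2" 9216 ?p] by simp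
      finally show ?thesis .
    qed
  qed
  also have "\<dots> \<le> real (card ?N) * exp (- ?c * ?p) + real (card ?N) * exp (- ?c * ?p)"
    using net(1) by (auto intro!: mult_right_mono card_mono)
  also have "\<dots> \<le> 2 * (exp ((2 + 1 / \<delta>) * real (card Q)) * exp (- ?c * ?p))"
    using mult_right_mono[OF net(2), of "exp (- ?c * ?p)"] by simp
  also have "\<dots> = 2 * exp ((2 + 1536 / ?s\<^sup>2) * real (card Q) - ?c * ?p)"
    by (simp add: \<delta>_def exp_add[symmetric])
  finally have PB: "prob B \<le> 2 * exp ((2 + 1536 / ?s\<^sup>2) * real (card Q) - ?c * ?p)" .
  have "?s / 384 * ?p * L2_set v Q \<le> l1_dot P Q (\<lambda>i. row i \<omega>) v" if \<omega>: "\<omega> \<in> space M - B" for \<omega> v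
  proof -
    have "?s / 192 * ?p / 2 * L2_set v Q \<le> l1_dot P Q (\<lambda>i. row i \<omega>) v"
    proof (rule l1_dot_lower_of_net[OF finite_Q ne(2) \<delta>])
      show "l1_dot P Q (\<lambda>i. row i \<omega>) x \<le> 2 / ?s * ?p" if x: "x \<in> ?N" for x
      proof -
        let ?d = "\<lambda>i. dot Q x (row i \<omega>)"
        have "\<omega> \<notin> B2 x" using \<omega> x by (auto simp: B_def)
        then have "?s * (\<Sum>i\<in>P. (?d i)\<^sup>2) \<le> 2 * ?p" using \<omega> by (auto simp: B2_def)
        then have sq: "(\<Sum>i\<in>P. (?d i)\<^sup>2) \<le> 2 / ?s * ?p" using s by (simp add: field_simps)
        have "l1_dot P Q (\<lambda>i. row i \<omega>) x \<le> sqrt ?p * L2_set ?d P"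
          unfolding l1_dot_def by (rule sum_abs_le_sqrt_card)
        also have "\<dots> \<le> sqrt ?p * sqrt (2 / ?s * ?p)"
          unfolding L2_set_def using sq by (intro mult_left_mono real_sqrt_le_mono) auto
        also have "\<dots> = sqrt (2 / ?s) * ?p" by (simp add: real_sqrt_mult real_sqrt_divide)
        also have "sqrt (2 / ?s) \<le> 2 / ?s"
        proof -
          have "1 \<le> 2 / ?s" using s by (simp add: field_simps)
          moreover have "sqrt y \<le> y" if "1 \<le> y" for y :: real
            using mult_left_mono[of 1 "sqrt y" "sqrt y"] that by simp
          ultimately show ?thesis by blast
        qed
        finally show ?thesis by (simp add: mult_right_mono)
      qed
      show "?s / 192 * ?p \<le> l1_dot P Q (\<lambda>i. row i \<omega>) x" if "x \<in> ?N" "1 / 2 \<le> L2_set x Q" for x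
        using \<omega> that by (auto simp: B_def B1_def)
      show "4 * \<delta> * (2 / ?s * ?p) \<le> ?s / 192 * ?p"
        using s by (simp add: \<delta>_def power2_eq_square field_simps)
    qed
    then show ?thesis by simp
  qed
  with Bm PB show ?thesis by (rule that)
qed

end

section \<open>Duality and restricted isometry\<close>

lemma dot_cong: "(\<And>j. j \<in> J \<Longrightarrow> u j = u' j) \<Longrightarrow> (\<And>j. j \<in> J \<Longrightarrow> v j = v' j) \<Longrightarrow> dot J u v = dot J u' v'"
  by (simp add: dot_def)

lemma sum_weighted_dot:
  "(\<Sum>i\<in>I. y i * dot J u (X i)) = dot J u (\<lambda>j. \<Sum>i\<in>I. y i * X i j)"
proof -
  have "(\<Sum>i\<in>I. y i * dot J u (X i)) = (\<Sum>i\<in>I. \<Sum>j\<in>J. u j * (y i * X i j))"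
    by (simp add: dot_def sum_distrib_left mult_ac)
  also have "\<dots> = (\<Sum>j\<in>J. \<Sum>i\<in>I. u j * (y i * X i j))" by (rule sum.swap)
  finally show ?thesis by (simp add: dot_def sum_distrib_left)
qed

text \<open>The topology is the product topology on \<open>nat \<Rightarrow> real\<close>. Pinning
  the coordinates outside \<open>J\<close> to 0 exhibits the ball as a closed subset of a product of
  compact sets, so Tychonoff's theorem applies.\<close>

lemma compact_L2_ball:
  assumes fin: "finite J"
  shows "compact {w. (\<forall>j. j \<notin> J \<longrightarrow> w j = 0) \<and> L2_set w J \<le> (\<rho>::real)}" (is "compact ?W")
proof -
  define S where "S j = (if j \<in> J then {-\<rho>..\<rho>} else {0::real})" for j
  have "compactin (product_topology (\<lambda>i. euclidean) UNIV) (PiE UNIV S)"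
    unfolding compactin_PiE by (auto simp: S_def)
  then have cS: "compact (PiE UNIV S)"
    by (simp add: euclidean_product_topology)
  have "closed {w. L2_set w J \<le> \<rho>}"
    unfolding L2_set_def
    by (intro closed_Collect_le continuous_on_real_sqrt continuous_on_sum continuous_on_power
        continuous_on_const continuous_on_product_coordinates)
  then have "compact (PiE UNIV S \<inter> {w. L2_set w J \<le> \<rho>})" using cS by (intro compact_Int_closed)
  also have "PiE UNIV S \<inter> {w. L2_set w J \<le> \<rho>} = ?W"
  proof (intro equalityI subsetI)
    fix w assume w: "w \<in> ?W"
    have "\<bar>w j\<bar> \<le> \<rho>" if "j \<in> J" for j
      using member_le_L2_set[OF fin that, of "\<lambda>j. \<bar>w j\<bar>"] w by (simp add: L2_set_def)
    then show "w \<in> PiE UNIV S \<inter> {w. L2_set w J \<le> \<rho>}"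
      using w by (auto simp: S_def abs_le_iff minus_le_iff)
  next
    fix w assume "w \<in> PiE UNIV S \<inter> {w. L2_set w J \<le> \<rho>}"
    then show "w \<in> ?W" by (auto simp: S_def PiE_def Pi_def split: if_splits)
  qed
  finally show ?thesis .
qed

text \<open>
  The correction \<open>w\<close> minimises the squared total violation over the ball of radius \<open>\<rho>\<close>; the vector
  \<open>y\<close> of remaining violations then satisfies \<open>\<rho> \<parallel>A\<^sup>T y\<parallel> \<le> \<langle>A\<^sup>T y, w\<rangle>\<close>. Since \<open>y\<close> has small
  support, the restricted isometry property forces \<open>y = 0\<close>.
\<close>

lemma exists_small_correction:
  fixes X :: "nat \<Rightarrow> nat \<Rightarrow> real"
  assumes fin: "finite P" "finite J"
    and T: "T \<ge> 0" and \<eta>: "\<eta> > 0" and \<rho>: "\<rho> > 0" and c0: "c0 \<ge> 0"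
    and rip: "\<And>I y. I \<subseteq> P \<Longrightarrow> card I \<le> 2 * k \<Longrightarrow> c0 * L2_set y I \<le> L2_set (\<lambda>j. \<Sum>i\<in>I. y i * X i j) J"
    and sums: "\<And>I. I \<subseteq> P \<Longrightarrow> card I = k \<Longrightarrow> L2_set (\<lambda>j. \<Sum>i\<in>I. X i j) J \<le> C"
    and B: "card {i \<in> P. T < dot J c (X i)} \<le> k"
      "(\<Sum>i\<in>{i \<in> P. T < dot J c (X i)}. (dot J c (X i))\<^sup>2) \<le> (c0 * \<rho>)\<^sup>2"
    and k: "\<rho> * C < \<eta> * real k"
  obtains w where "L2_set w J \<le> \<rho>" "\<And>i. i \<in> P \<Longrightarrow> dot J c (X i) - dot J w (X i) \<le> T + \<eta>"
proof -
  define W where "W = {w. (\<forall>j. j \<notin> J \<longrightarrow> w j = 0) \<and> L2_set w J \<le> \<rho>}"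
  define b where "b i = dot J c (X i) - T - \<eta>" for i
  define F where "F w = (\<Sum>i\<in>P. (max 0 (b i - dot J w (X i)))\<^sup>2)" for w
  have "continuous_on W F"
    unfolding F_def dot_def
    by (intro continuous_on_sum continuous_on_power continuous_on_max continuous_on_diff
        continuous_on_mult continuous_on_const continuous_on_subset[OF continuous_on_product_coordinates]) auto
  moreover have "compact W" unfolding W_def by (rule compact_L2_ball[OF fin(2)])
  moreover have "(\<lambda>_. 0) \<in> W" using \<rho> by (simp add: W_def L2_set_def)
  ultimately obtain w where w: "w \<in> W" and min: "\<And>w'. w' \<in> W \<Longrightarrow> F w \<le> F w'"
    using continuous_attains_inf[of W F] by auto
  have w\<rho>: "L2_set w J \<le> \<rho>" using w by (simp add: W_def)
  define y where "y i = max 0 (b i - dot J w (X i))" for i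
  define v where "v j = (\<Sum>i\<in>P. y i * X i j)" for j
  \<comment> \<open>First-order optimality of w, where v is minus half the gradient of F at w.
    Comparing F along the segment from w to w' replaces differentiation.\<close>
  have var: "dot J w' v \<le> dot J w v" if w': "w' \<in> W" for w'
  proof -
    define e where "e i = dot J w' (X i) - dot J w (X i)" for i
    define E where "E = (\<Sum>i\<in>P. (e i)\<^sup>2)"
    have E0: "E \<ge> 0" by (simp add: E_def sum_nonneg)
    have small: "2 * (\<Sum>i\<in>P. y i * e i) \<le> s * E" if s: "0 < s" "s \<le> 1" for s :: real
    proof -
      define z where "z j = (1 - s) * w j + s * w' j" for j
      have "L2_set z J \<le> L2_set (\<lambda>j. (1 - s) * w j) J + L2_set (\<lambda>j. s * w' j) J"
        unfolding z_def by (rule L2_set_triangle_ineq)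
      also have "\<dots> = (1 - s) * L2_set w J + s * L2_set w' J"
        using s by (simp add: L2_set_scale)
      also have "\<dots> \<le> (1 - s) * \<rho> + s * \<rho>"
        using s w w' by (intro add_mono mult_left_mono) (auto simp: W_def)
      finally have "z \<in> W" using w w' by (simp add: W_def z_def algebra_simps)
      then have "F w \<le> F z" by (rule min)
      also have "F z \<le> (\<Sum>i\<in>P. (y i)\<^sup>2 - 2 * s * (y i * e i) + s\<^sup>2 * (e i)\<^sup>2)"
        unfolding F_def
      proof (rule sum_mono)
        fix i
        let ?u = "b i - dot J w (X i)"
        have "dot J z (X i) = dot J w (X i) + s * e i"
          unfolding z_def dot_add_left dot_scale_left e_def by (simp add: algebra_simps)
        then have "b i - dot J z (X i) = ?u - s * e i" by simp
        moreover have "max 0 (?u - s * e i) \<le> \<bar>y i - s * e i\<bar>" unfolding y_def by linarith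
        ultimately have "(max 0 (b i - dot J z (X i)))\<^sup>2 \<le> \<bar>y i - s * e i\<bar>\<^sup>2"
          by (intro power_mono) auto
        then show "(max 0 (b i - dot J z (X i)))\<^sup>2 \<le> (y i)\<^sup>2 - 2 * s * (y i * e i) + s\<^sup>2 * (e i)\<^sup>2"
          by (simp add: power2_diff power_mult_distrib algebra_simps)
      qed
      also have "\<dots> = F w - 2 * s * (\<Sum>i\<in>P. y i * e i) + s\<^sup>2 * E"
        by (simp add: sum.distrib sum_subtractf sum_distrib_left F_def y_def E_def)
      finally have "s * (2 * (\<Sum>i\<in>P. y i * e i)) \<le> s * (s * E)"
        by (simp add: power2_eq_square algebra_simps)
      then show ?thesis using s by (simp only: mult_le_cancel_left_pos)
    qed
    have "(\<Sum>i\<in>P. y i * e i) \<le> 0"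
    proof (rule ccontr)
      assume neg: "\<not> ?thesis"
      define q where "q = (\<Sum>i\<in>P. y i * e i)"
      have q: "q > 0" using neg by (simp add: q_def)
      \<comment> \<open>Small enough for s E \<le> q, which is incompatible with 2 q \<le> s E when
        q > 0.\<close>
      define s where "s = min 1 (q / (E + 1))"
      have s: "0 < s" "s \<le> 1" using q E0 by (auto simp: s_def)
      have "s * E \<le> q / (E + 1) * E" using E0 by (intro mult_right_mono) (auto simp: s_def)
      also have "\<dots> \<le> q" using q E0 by (simp add: field_simps)
      finally show False using small[OF s] q unfolding q_def by linarith
    qed
    moreover have "(\<Sum>i\<in>P. y i * e i) = dot J w' v - dot J w v"
      unfolding e_def v_def sum_weighted_dot[symmetric] by (simp add: right_diff_distrib sum_subtractf)
    ultimately show ?thesis by simp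
  qed
  \<comment> \<open>The competitor in \<open>var\<close> is the boundary point of the ball in the
    direction of v.\<close>
  have dual: "\<rho> * L2_set v J \<le> dot J w v"
  proof (cases "L2_set v J = 0")
    case True
    then show ?thesis using abs_dot_le[of J w v] by simp
  next
    case False
    define n where "n = L2_set v J"
    have n: "n > 0" using False L2_set_nonneg[of v J] unfolding n_def by linarith
    define u where "u j = (if j \<in> J then \<rho> / n * v j else 0)" for j
    have "L2_set u J = L2_set (\<lambda>j. \<rho> / n * v j) J" by (rule L2_set_cong[OF refl]) (simp add: u_def)
    also have "\<dots> = \<rho>" using n \<rho> unfolding L2_set_scale by (simp add: n_def[symmetric])
    finally have "u \<in> W" by (auto simp: W_def u_def)
    have "dot J u v = dot J (\<lambda>j. \<rho> / n * v j) v" by (rule dot_cong) (simp_all add: u_def)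
    also have "\<dots> = \<rho> / n * n\<^sup>2" unfolding dot_scale_left by (simp add: dot_self n_def)
    also have "\<dots> = \<rho> * n" using n by (simp add: power2_eq_square)
    finally show ?thesis using var[OF \<open>u \<in> W\<close>] by (simp add: n_def)
  qed
  define BB where "BB = {i \<in> P. T < dot J c (X i)}"
  define I where "I = {i \<in> P. y i > 0}"
  have finI: "finite I" "finite BB" using fin by (auto simp: I_def BB_def)
  have y0: "y i \<ge> 0" for i by (simp add: y_def)
  have I0: "y i = 0" if "i \<in> P - I" for i using that y0[of i] by (auto simp: I_def)
  \<comment> \<open>A row satisfied by c at level T but violated by c - w at level T + \<eta> has
    <w, X_i> \<le> -\<eta>. Summing over k such rows contradicts the bound on block sums, so fewer
    than k violations are new.\<close>
  have cardT: "card (I - BB) < k"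
  proof (rule ccontr)
    assume "\<not> ?thesis"
    then obtain I' where I': "I' \<subseteq> I - BB" "card I' = k"
      using finI by (meson not_less obtain_subset_with_card_n)
    have "(\<Sum>i\<in>I'. dot J w (X i)) \<le> (\<Sum>i\<in>I'. - \<eta>)"
    proof (rule sum_mono)
      fix i assume "i \<in> I'"
      then have "i \<in> P" "y i > 0" "\<not> T < dot J c (X i)" using I' by (auto simp: I_def BB_def)
      then show "dot J w (X i) \<le> - \<eta>" by (auto simp: y_def b_def)
    qed
    then have 1: "(\<Sum>i\<in>I'. 1 * dot J w (X i)) \<le> - (\<eta> * real k)" using I' by (simp add: mult.commute)
    have "- dot J w (\<lambda>j. \<Sum>i\<in>I'. 1 * X i j) \<le> \<rho> * C"
    proof -
      have "L2_set (\<lambda>j. \<Sum>i\<in>I'. X i j) J \<le> C"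
        by (rule sums) (use I' in \<open>auto simp: I_def\<close>)
      then have "L2_set w J * L2_set (\<lambda>j. \<Sum>i\<in>I'. X i j) J \<le> \<rho> * C"
        using w\<rho> \<rho> by (intro mult_mono) auto
      then show ?thesis using abs_dot_le[of J w "\<lambda>j. \<Sum>i\<in>I'. X i j"] by simp
    qed
    with 1 k show False unfolding sum_weighted_dot by linarith
  qed
  have "I \<subseteq> BB \<union> (I - BB)" by auto
  then have "card I \<le> card (BB \<union> (I - BB))" using finI by (intro card_mono) auto
  also have "\<dots> \<le> card BB + card (I - BB)" by (rule card_Un_le)
  also have "\<dots> \<le> 2 * k" using cardT B(1) by (simp add: BB_def)
  finally have cI: "card I \<le> 2 * k" .
  have sumI: "(\<Sum>i\<in>P. y i * f i) = (\<Sum>i\<in>I. y i * f i)" for f :: "nat \<Rightarrow> real"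
    using I0 fin by (intro sum.mono_neutral_right) (auto simp: I_def)
  have "c0 * L2_set y I \<le> L2_set (\<lambda>j. \<Sum>i\<in>I. y i * X i j) J"
    by (rule rip[OF _ cI]) (auto simp: I_def)
  then have rip': "c0 * L2_set y P \<le> L2_set v J"
  proof -
    have "L2_set y I = L2_set y P"
      using sumI[of y] by (simp add: L2_set_def power2_eq_square)
    moreover have "(\<lambda>j. \<Sum>i\<in>I. y i * X i j) = v" by (simp add: v_def sumI fun_eq_iff)
    ultimately show ?thesis using \<open>c0 * L2_set y I \<le> _\<close> by simp
  qed
  have yB: "(\<Sum>i\<in>P. y i * (dot J c (X i) - T)) \<le> L2_set y P * (c0 * \<rho>)"
  proof -
    have "(\<Sum>i\<in>P. y i * (dot J c (X i) - T)) \<le> (\<Sum>i\<in>P. if i \<in> BB then y i * dot J c (X i) else 0)"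
    proof (rule sum_mono)
      fix i assume "i \<in> P"
      show "y i * (dot J c (X i) - T) \<le> (if i \<in> BB then y i * dot J c (X i) else 0)"
        using y0[of i] T \<open>i \<in> P\<close> by (auto simp: BB_def right_diff_distrib mult_nonneg_nonpos intro!: mult_left_mono)
    qed
    also have "\<dots> = (\<Sum>i\<in>BB. y i * dot J c (X i))"
      using fin by (simp add: sum.If_cases BB_def Int_def)
    also have "\<dots> \<le> L2_set y BB * L2_set (\<lambda>i. dot J c (X i)) BB"
      using dot_le[of BB y "\<lambda>i. dot J c (X i)"] by (simp add: dot_def)
    also have "\<dots> \<le> L2_set y P * (c0 * \<rho>)"
    proof (rule mult_mono)
      show "L2_set y BB \<le> L2_set y P"
        unfolding L2_set_def using fin by (intro real_sqrt_le_mono sum_mono2) (auto simp: BB_def)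
      show "L2_set (\<lambda>i. dot J c (X i)) BB \<le> c0 * \<rho>"
        unfolding L2_set_def using B(2) c0 \<rho> by (intro real_le_lsqrt) (auto simp: BB_def)
    qed auto
    finally show ?thesis .
  qed
  \<comment> \<open>Each y_i equals its violation wherever it is positive, so the sum of squares is
    linear in the violations. By \<open>rip'\<close> the gain from the initially violated rows is at
    most \<rho> times the norm of v, and by \<open>dual\<close> the term in w already takes this
    much back.\<close>
  have "(\<Sum>i\<in>P. (y i)\<^sup>2) = (\<Sum>i\<in>P. y i * (b i - dot J w (X i)))"
    by (intro sum.cong) (auto simp: y_def max_def power2_eq_square)
  also have "\<dots> = (\<Sum>i\<in>P. y i * (dot J c (X i) - T)) - \<eta> * (\<Sum>i\<in>P. y i) - dot J w v"
    unfolding v_def sum_weighted_dot[symmetric]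
    by (simp add: b_def algebra_simps sum.distrib sum_subtractf sum_distrib_left)
  also have "\<dots> \<le> 0"
  proof -
    have "L2_set y P * (c0 * \<rho>) \<le> \<rho> * L2_set v J"
      using mult_left_mono[OF rip', of \<rho>] \<rho> by (simp add: mult_ac)
    moreover have "0 \<le> \<eta> * (\<Sum>i\<in>P. y i)" using \<eta> y0 by (simp add: sum_nonneg)
    ultimately show ?thesis using yB dual by linarith
  qed
  finally have "(\<Sum>i\<in>P. (y i)\<^sup>2) = 0" by (meson antisym sum_nonneg zero_le_power2)
  then have "y i = 0" if "i \<in> P" for i using that fin by (simp add: sum_nonneg_eq_0_iff)
  then have "dot J c (X i) - dot J w (X i) \<le> T + \<eta>" if "i \<in> P" for i
    using that unfolding y_def b_def by (fastforce simp: max_def split: if_splits)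
  with w\<rho> show ?thesis by (rule that)
qed

lemma dot_le_of_weights:
  fixes X :: "nat \<Rightarrow> nat \<Rightarrow> real"
  assumes y: "\<And>i. i \<in> P \<Longrightarrow> y i \<ge> 0" and Y: "(\<Sum>i\<in>P. y i) > 0"
    and \<mu>: "\<mu> > 0" "\<And>i. i \<in> P \<Longrightarrow> y i \<noteq> 0 \<Longrightarrow> \<mu> \<le> dot J c (X i)"
    and D: "L2_set (\<lambda>j. (\<Sum>i\<in>P. y i * X i j) - (\<Sum>i\<in>P. y i * dot J c (X i)) * c j) J \<le> \<beta> * (\<Sum>i\<in>P. y i)"
    and x: "\<And>i. i \<in> P \<Longrightarrow> dot J x (X i) \<le> 1" "L2_set x J \<le> R"
    and R: "R \<ge> 0" "\<beta> \<ge> 0"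
  shows "dot J c x \<le> (1 + \<beta> * R) / \<mu>"
\<comment> \<open>Replacing d by its lower bound Y \<mu> in d <c, x> requires <c, x> \<ge> 0;
  otherwise the claim holds because its right side is nonnegative.\<close>
proof (cases "dot J c x \<le> 0")
  case True
  then show ?thesis using \<mu>(1) R by (smt (verit, best) divide_nonneg_pos mult_nonneg_nonneg)
next
  case False
  define Y where "Y = (\<Sum>i\<in>P. y i)"
  define d where "d = (\<Sum>i\<in>P. y i * dot J c (X i))"
  let ?D = "\<lambda>j. (\<Sum>i\<in>P. y i * X i j) - d * c j"
  have "(\<Sum>i\<in>P. y i * dot J x (X i)) \<le> (\<Sum>i\<in>P. y i * 1)"
    using x y by (intro sum_mono mult_left_mono) auto
  then have "dot J x (\<lambda>j. \<Sum>i\<in>P. y i * X i j) \<le> Y" by (simp add: sum_weighted_dot Y_def)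
  moreover have "dot J x ?D = dot J x (\<lambda>j. \<Sum>i\<in>P. y i * X i j) - d * dot J c x"
    unfolding dot_diff_right dot_scale_right by (simp add: dot_commute)
  moreover have "\<bar>dot J x ?D\<bar> \<le> R * (\<beta> * Y)"
    using D x(2) R by (intro order_trans[OF abs_dot_le] mult_mono) (auto simp: d_def Y_def)
  ultimately have 1: "d * dot J c x \<le> Y * (1 + \<beta> * R)" by (simp add: algebra_simps)
  have "(\<Sum>i\<in>P. y i * \<mu>) \<le> d"
    unfolding d_def
  proof (rule sum_mono)
    fix i assume i: "i \<in> P"
    show "y i * \<mu> \<le> y i * dot J c (X i)"
      using \<mu>(2)[OF i] y[OF i] by (cases "y i = 0") (auto intro!: mult_left_mono)
  qed
  then have "Y * \<mu> * dot J c x \<le> d * dot J c x"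
    using False by (intro mult_right_mono) (auto simp: Y_def sum_distrib_right)
  with 1 have "Y * (\<mu> * dot J c x) \<le> Y * (1 + \<beta> * R)" by (simp add: mult_ac)
  moreover have "Y > 0" using Y by (simp add: Y_def)
  ultimately have "\<mu> * dot J c x \<le> 1 + \<beta> * R" by (simp only: mult_le_cancel_left_pos)
  then show ?thesis using \<mu>(1) by (simp add: field_simps)
qed

text \<open>For u \<le> 1 one has |u| \<le> 2 - u. So the l1 norm of the products is at most twice
  the number of rows minus the inner product of x with the sum of the rows, and that sum is too
  short to offset the lower bound \<open>l1\<close>.\<close>

lemma polyhedron_bounded:
  fixes X :: "nat \<Rightarrow> nat \<Rightarrow> real"
  assumes \<kappa>: "\<kappa> > 0" and fin: "finite P" "P \<noteq> {}"
    and l1: "\<kappa> * real (card P) * L2_set x J \<le> l1_dot P J X x"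
    and s: "L2_set (\<lambda>j. \<Sum>i\<in>P. X i j) J \<le> \<kappa> / 2 * real (card P)"
    and x: "\<And>i. i \<in> P \<Longrightarrow> dot J x (X i) \<le> 1"
  shows "L2_set x J \<le> 4 / \<kappa>"
proof -
  let ?m = "real (card P)"
  have m: "?m > 0" using fin by (simp add: card_gt_0_iff)
  have "l1_dot P J X x \<le> (\<Sum>i\<in>P. 2 - dot J x (X i))"
    unfolding l1_dot_def using x by (intro sum_mono) (force simp: abs_if)
  also have "\<dots> = 2 * ?m - dot J x (\<lambda>j. \<Sum>i\<in>P. X i j)"
    using sum_weighted_dot[where y = "\<lambda>_. 1" and I = P and u = x and J = J and X = X] by (simp add: sum_subtractf)
  also have "\<dots> \<le> 2 * ?m + L2_set x J * (\<kappa> / 2 * ?m)"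
  proof -
    have "L2_set x J * L2_set (\<lambda>j. \<Sum>i\<in>P. X i j) J \<le> L2_set x J * (\<kappa> / 2 * ?m)"
      using s by (intro mult_left_mono) auto
    then show ?thesis using abs_dot_le[of J x "\<lambda>j. \<Sum>i\<in>P. X i j"] by linarith
  qed
  finally have "?m * (\<kappa> * L2_set x J) \<le> ?m * 4" using l1 by (simp add: field_simps)
  then have "\<kappa> * L2_set x J \<le> 4" using m by (simp only: mult_le_cancel_left_pos)
  then show ?thesis using \<kappa> by (simp add: field_simps)
qed

section \<open>Boundedness of the polyhedron and restricted isometry\<close>

context subgaussian_matrix
begin

text \<open>This is \<open>sq_upper_tail\<close> for the transposed block, tested on the constant
  unit vector on \<open>I\<close>.\<close>

lemma row_sum_tail:
  assumes I: "I \<subseteq> P" "I \<noteq> {}"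
  shows "{\<omega> \<in> space M. t * real (card I) < sq_rate K * (L2_set (\<lambda>j. \<Sum>i\<in>I. a i j \<omega>) Q)\<^sup>2} \<in> events" (is "?B \<in> _")
    and "prob {\<omega> \<in> space M. t * real (card I) < sq_rate K * (L2_set (\<lambda>j. \<Sum>i\<in>I. a i j \<omega>) Q)\<^sup>2}
      \<le> exp (real (card Q) - t)"
proof -
  have finI: "finite I" using I finite_P finite_subset by auto
  interpret T: subgaussian_matrix M K Q I "\<lambda>j i. a i j"
    using subgaussian_matrix.transposed[OF submatrix[of I Q]] I by simp
  let ?k = "real (card I)"
  have k: "?k > 0" using finI I by (simp add: card_gt_0_iff)
  define v where "v = (\<lambda>i::nat. 1 / sqrt ?k)"
  have "L2_set v I = 1" using k by (simp add: L2_set_def v_def power_divide)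
  then have le: "prob {\<omega> \<in> space M. t \<le> sq_rate K * (\<Sum>j\<in>Q. (dot I v (T.row j \<omega>))\<^sup>2)} \<le> exp (real (card Q) - t)"
    by (intro T.sq_upper_tail) simp
  have sq: "(\<Sum>j\<in>Q. (dot I v (T.row j \<omega>))\<^sup>2) = (L2_set (\<lambda>j. \<Sum>i\<in>I. a i j \<omega>) Q)\<^sup>2 / ?k" for \<omega>
    using k unfolding dot_def v_def L2_set_sq
    by (simp add: sum_distrib_left[symmetric] sum_divide_distrib[symmetric] power_divide)
  have [measurable]: "a i j \<in> borel_measurable M" if "i \<in> I" "j \<in> Q" for i j
    using that I by auto
  show "?B \<in> events"
    unfolding L2_set_def by measurable
  have "prob ?B \<le> prob {\<omega> \<in> space M. t \<le> sq_rate K * (\<Sum>j\<in>Q. (dot I v (T.row j \<omega>))\<^sup>2)}"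
  proof (rule finite_measure_mono)
    show "{\<omega> \<in> space M. t \<le> sq_rate K * (\<Sum>j\<in>Q. (dot I v (T.row j \<omega>))\<^sup>2)} \<in> events"
      by measurable
    show "?B \<subseteq> {\<omega> \<in> space M. t \<le> sq_rate K * (\<Sum>j\<in>Q. (dot I v (T.row j \<omega>))\<^sup>2)}"
    proof safe
      fix \<omega> assume "t * ?k < sq_rate K * (L2_set (\<lambda>j. \<Sum>i\<in>I. a i j \<omega>) Q)\<^sup>2"
      then show "t \<le> sq_rate K * (\<Sum>j\<in>Q. (dot I v (T.row j \<omega>))\<^sup>2)"
        unfolding sq using k by (simp add: pos_le_divide_eq)
    qed
  qed
  with le show "prob ?B \<le> exp (real (card Q) - t)" by (rule order_trans[rotated])
qed

lemma bounded_polyhedron_event: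
  assumes ne: "P \<noteq> {}" "Q \<noteq> {}"
  defines "\<kappa> \<equiv> sq_rate K / 384"
  assumes m: "2 * real (card Q) \<le> sq_rate K * (\<kappa> / 2)\<^sup>2 * real (card P)"
  obtains B where "B \<in> events"
    "prob B \<le> 2 * exp ((2 + 1536 / (sq_rate K)\<^sup>2) * real (card Q) - (sq_rate K)\<^sup>2 / 9216 * real (card P))
       + exp (- real (card Q))"
    "\<And>\<omega> x. \<omega> \<in> space M - B \<Longrightarrow> (\<And>i. i \<in> P \<Longrightarrow> dot Q x (row i \<omega>) \<le> 1) \<Longrightarrow> L2_set x Q \<le> 4 / \<kappa>"
proof -
  let ?s = "sq_rate K" let ?p = "real (card P)" let ?q = "real (card Q)"
  obtain B1 where B1: "B1 \<in> events"
    "prob B1 \<le> 2 * exp ((2 + 1536 / ?s\<^sup>2) * ?q - ?s\<^sup>2 / 9216 * ?p)"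
    "\<And>\<omega> v. \<omega> \<in> space M - B1 \<Longrightarrow> ?s / 384 * ?p * L2_set v Q \<le> l1_dot P Q (\<lambda>i. row i \<omega>) v"
    using l1_uniform_lower[OF ne] by blast
  \<comment> \<open>The threshold 2 q leaves probability exp (- q); hypothesis \<open>m\<close>
    turns it into the bound \<kappa> / 2 per row that \<open>polyhedron_bounded\<close> asks
    for.\<close>
  define B2 where "B2 = {\<omega> \<in> space M. 2 * ?q * ?p < ?s * (L2_set (\<lambda>j. \<Sum>i\<in>P. a i j \<omega>) Q)\<^sup>2}"
  have B2: "B2 \<in> events" "prob B2 \<le> exp (?q - 2 * ?q)"
    unfolding B2_def by (rule row_sum_tail[OF order_refl ne(1)])+
  have \<kappa>: "\<kappa> > 0" using sq_rate_pos[of K] by (simp add: \<kappa>_def)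
  show ?thesis
  proof (rule that[of "B1 \<union> B2"])
    show "B1 \<union> B2 \<in> events" using B1 B2 by auto
    show "prob (B1 \<union> B2) \<le> 2 * exp ((2 + 1536 / ?s\<^sup>2) * ?q - ?s\<^sup>2 / 9216 * ?p) + exp (- ?q)"
      using B1 B2 by (intro order_trans[OF measure_Un_le] add_mono) auto
    fix \<omega> x assume \<omega>: "\<omega> \<in> space M - (B1 \<union> B2)" and x: "\<And>i. i \<in> P \<Longrightarrow> dot Q x (row i \<omega>) \<le> 1"
    show "L2_set x Q \<le> 4 / \<kappa>"
    proof (rule polyhedron_bounded[OF \<kappa> finite_P ne(1) _ _ x])
      show "\<kappa> * ?p * L2_set x Q \<le> l1_dot P Q (\<lambda>i. row i \<omega>) x"
        using B1(3) \<omega> by (simp add: \<kappa>_def)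
      let ?L = "L2_set (\<lambda>j. \<Sum>i\<in>P. a i j \<omega>) Q"
      have "?s * ?L\<^sup>2 \<le> 2 * ?q * ?p" using \<omega> by (auto simp: B2_def)
      also have "\<dots> \<le> ?s * (\<kappa> / 2)\<^sup>2 * ?p * ?p" using m by (intro mult_right_mono) auto
      also have "\<dots> = ?s * (\<kappa> / 2 * ?p)\<^sup>2" by (simp add: power2_eq_square)
      finally have "?L\<^sup>2 \<le> (\<kappa> / 2 * ?p)\<^sup>2" using sq_rate_pos[of K] by (simp only: mult_le_cancel_left_pos)
      then show "?L \<le> \<kappa> / 2 * ?p" by (rule power2_le_imp_le) (use \<kappa> in simp)
    qed
  qed
qed

text \<open>\<open>l1_uniform_lower\<close> is applied to the transpose of every block of 2 k rows,
  where the columns play the part of the many independent rows; Cauchy-Schwarz then passes from the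
  l1 to the l2 norm. Of the exponent c1 q, a quarter pays for the net, a quarter for the choice of
  the block, and half survives.\<close>

lemma rip_event:
  assumes ne: "P \<noteq> {}" "Q \<noteq> {}" and k: "k \<ge> 1" "2 * k \<le> card P"
  defines "c1 \<equiv> (sq_rate K)\<^sup>2 / 9216"
  assumes kq: "(2 + 1536 / (sq_rate K)\<^sup>2) * real (2 * k) \<le> c1 / 4 * real (card Q)"
    and ch: "real (card P choose (2 * k)) \<le> exp (c1 / 4 * real (card Q))"
      "real (card P choose k) \<le> exp (c1 / 4 * real (card Q))"
  obtains B where "B \<in> events" "prob B \<le> 3 * exp (- (c1 / 2) * real (card Q))"
    "\<And>\<omega> I y. \<omega> \<in> space M - B \<Longrightarrow> I \<subseteq> P \<Longrightarrow> card I \<le> 2 * k \<Longrightarrow>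
       sq_rate K / 384 * sqrt (real (card Q)) * L2_set y I \<le> L2_set (\<lambda>j. \<Sum>i\<in>I. y i * a i j \<omega>) Q"
    "\<And>\<omega> I. \<omega> \<in> space M - B \<Longrightarrow> I \<subseteq> P \<Longrightarrow> card I = k \<Longrightarrow>
       L2_set (\<lambda>j. \<Sum>i\<in>I. a i j \<omega>) Q \<le> 2 / sq_rate K * sqrt (real (card Q) * real k)"
proof -
  let ?s = "sq_rate K" let ?q = "real (card Q)"
  note s = sq_rate_pos[of K] sq_rate_le[of K]
  have q: "?q > 0" using ne finite_Q by (simp add: card_gt_0_iff)
  have c1: "0 < c1" "c1 \<le> 1" using s power_le_one[of ?s 2] by (auto simp: c1_def)
  define F2 where "F2 = {I. I \<subseteq> P \<and> card I = 2 * k}"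
  define F1 where "F1 = {I. I \<subseteq> P \<and> card I = k}"
  have fin: "finite F1" "finite F2" using finite_P by (auto simp: F1_def F2_def)
  have cF: "card F1 = card P choose k" "card F2 = card P choose (2 * k)"
    unfolding F1_def F2_def by (rule n_subsets[OF finite_P])+
  have "\<exists>B\<in>events. prob B \<le> 2 * exp (- (3 * c1 / 4) * ?q) \<and>
      (\<forall>\<omega> y. \<omega> \<in> space M - B \<longrightarrow> ?s / 384 * ?q * L2_set y I \<le> l1_dot Q I (\<lambda>j i. a i j \<omega>) y)"
    if I: "I \<in> F2" for I
  proof -
    interpret T: subgaussian_matrix M K Q I "\<lambda>j i. a i j"
      using subgaussian_matrix.transposed[OF submatrix[of I Q]] I by (simp add: F2_def)
    have "I \<noteq> {}" using I k by (auto simp: F2_def)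
    from T.l1_uniform_lower[OF ne(2) this] obtain B where B: "B \<in> events"
      "prob B \<le> 2 * exp ((2 + 1536 / ?s\<^sup>2) * real (card I) - c1 * ?q)"
      "\<And>\<omega> v. \<omega> \<in> space M - B \<Longrightarrow> ?s / 384 * ?q * L2_set v I \<le> l1_dot Q I (\<lambda>j. T.row j \<omega>) v"
      unfolding c1_def by blast
    have "prob B \<le> 2 * exp (- (3 * c1 / 4) * ?q)"
      using I kq by (intro order_trans[OF B(2)]) (auto simp: F2_def)
    with B show ?thesis by blast
  qed
  then obtain B2 where B2: "\<And>I. I \<in> F2 \<Longrightarrow> B2 I \<in> events"
      "\<And>I. I \<in> F2 \<Longrightarrow> prob (B2 I) \<le> 2 * exp (- (3 * c1 / 4) * ?q)"
      "\<And>I \<omega> y. I \<in> F2 \<Longrightarrow> \<omega> \<in> space M - B2 I \<Longrightarrow> ?s / 384 * ?q * L2_set y I \<le> l1_dot Q I (\<lambda>j i. a i j \<omega>) y"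
    by metis
  \<comment> \<open>The threshold 3 q leaves exp (- 2 q), which beats the number of blocks. As s
    \<le> 1, the resulting factor 3 / s is at most (2 / s)^2.\<close>
  define B1 where "B1 I = {\<omega> \<in> space M. 3 * ?q * real (card I) < ?s * (L2_set (\<lambda>j. \<Sum>i\<in>I. a i j \<omega>) Q)\<^sup>2}" for I
  have B1: "B1 I \<in> events" "prob (B1 I) \<le> exp (?q - 3 * ?q)" if "I \<in> F1" for I
  proof -
    have "I \<subseteq> P" "I \<noteq> {}" using that k by (auto simp: F1_def)
    then show "B1 I \<in> events" "prob (B1 I) \<le> exp (?q - 3 * ?q)"
      unfolding B1_def by (rule row_sum_tail)+
  qed
  define B where "B = (\<Union>I\<in>F2. B2 I) \<union> (\<Union>I\<in>F1. B1 I)"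
  show ?thesis
  proof (rule that[of B])
    show "B \<in> events" unfolding B_def using B1 B2 fin by (intro sets.Un sets.finite_UN) auto
    have "prob B \<le> (\<Sum>I\<in>F2. prob (B2 I)) + (\<Sum>I\<in>F1. prob (B1 I))"
      unfolding B_def
      by (intro order_trans[OF measure_Un_le] add_mono measure_UNION_le sets.finite_UN fin B1(1) B2(1))
    also have "\<dots> \<le> (\<Sum>I\<in>F2. 2 * exp (- (3 * c1 / 4) * ?q)) + (\<Sum>I\<in>F1. exp (?q - 3 * ?q))"
      using B1 B2 by (intro add_mono sum_mono) auto
    also have "\<dots> = real (card F2) * (2 * exp (- (3 * c1 / 4) * ?q)) + real (card F1) * exp (- 2 * ?q)"
      by simp
    also have "\<dots> \<le> exp (c1 / 4 * ?q) * (2 * exp (- (3 * c1 / 4) * ?q)) + exp (c1 / 4 * ?q) * exp (- 2 * ?q)"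
      using ch unfolding cF by (intro add_mono mult_right_mono) auto
    also have "\<dots> \<le> 2 * exp (- (c1 / 2) * ?q) + exp (- (c1 / 2) * ?q)"
    proof (rule add_mono)
      have "exp (c1 / 4 * ?q) * exp (- 2 * ?q) = exp ((c1 / 4 - 2) * ?q)"
        by (simp add: exp_add[symmetric] algebra_simps)
      also have "\<dots> \<le> exp (- (c1 / 2) * ?q)"
        using c1 q mult_right_mono[of "c1 / 4 - 2" "- (c1 / 2)" ?q] by simp
      finally show "exp (c1 / 4 * ?q) * exp (- 2 * ?q) \<le> exp (- (c1 / 2) * ?q)" .
      show "exp (c1 / 4 * ?q) * (2 * exp (- (3 * c1 / 4) * ?q)) \<le> 2 * exp (- (c1 / 2) * ?q)"
        by (simp add: exp_add[symmetric] field_simps)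
    qed
    finally show "prob B \<le> 3 * exp (- (c1 / 2) * ?q)" by simp
  next
    fix \<omega> I and y :: "nat \<Rightarrow> real"
    assume \<omega>: "\<omega> \<in> space M - B" and I: "I \<subseteq> P" "card I \<le> 2 * k"
    \<comment> \<open>Padding to exactly 2 k rows with zero coefficients spares a union bound over
      the smaller sizes.\<close>
    obtain I' where I': "I \<subseteq> I'" "I' \<subseteq> P" "card I' = 2 * k"
      using exists_subset_between[OF I(2) k(2) I(1) finite_P] by blast
    have finI': "finite I'" using I' finite_P finite_subset by auto
    then have I'F: "I' \<in> F2" using I' by (simp add: F2_def)
    define y' where "y' i = (if i \<in> I then y i else 0)" for i
    have eq: "(\<Sum>i\<in>I'. y' i * f i) = (\<Sum>i\<in>I. y i * f i)" for f :: "nat \<Rightarrow> real"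
      using I'(1) finI' by (intro sum.mono_neutral_cong_right) (auto simp: y'_def)
    have L: "L2_set y' I' = L2_set y I"
      unfolding L2_set_def using I'(1) finI'
      by (intro arg_cong[of _ _ sqrt] sum.mono_neutral_cong_right) (auto simp: y'_def)
    have d: "dot I' y' (\<lambda>i. a i j \<omega>) = (\<Sum>i\<in>I. y i * a i j \<omega>)" for j
      using eq by (simp add: dot_def)
    have "?s / 384 * ?q * L2_set y I \<le> l1_dot Q I' (\<lambda>j i. a i j \<omega>) y'"
      unfolding L[symmetric] using \<omega> I'F by (intro B2(3)) (auto simp: B_def)
    also have "\<dots> \<le> sqrt ?q * L2_set (\<lambda>j. \<Sum>i\<in>I. y i * a i j \<omega>) Q"
      unfolding l1_dot_def d by (rule sum_abs_le_sqrt_card)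
    finally have "sqrt ?q * (?s / 384 * sqrt ?q * L2_set y I) \<le> sqrt ?q * L2_set (\<lambda>j. \<Sum>i\<in>I. y i * a i j \<omega>) Q"
      by (simp add: mult_ac)
    then show "?s / 384 * sqrt ?q * L2_set y I \<le> L2_set (\<lambda>j. \<Sum>i\<in>I. y i * a i j \<omega>) Q"
      using q by (simp only: mult_le_cancel_left_pos real_sqrt_gt_0_iff)
  next
    fix \<omega> I assume \<omega>: "\<omega> \<in> space M - B" and I: "I \<subseteq> P" "card I = k"
    let ?L = "L2_set (\<lambda>j. \<Sum>i\<in>I. a i j \<omega>) Q"
    have "\<omega> \<notin> B1 I" using \<omega> I by (auto simp: B_def F1_def)
    then have "?s * ?L\<^sup>2 \<le> 3 * (?q * real k)" using \<omega> I by (auto simp: B1_def)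
    also have "\<dots> \<le> ?s * (4 / ?s\<^sup>2 * (?q * real k))"
    proof -
      have "3 \<le> ?s * (4 / ?s\<^sup>2)" using s by (simp add: power2_eq_square field_simps)
      then have "3 * (?q * real k) \<le> ?s * (4 / ?s\<^sup>2) * (?q * real k)" by (intro mult_right_mono) auto
      then show ?thesis by (simp add: mult.assoc)
    qed
    finally have "?L\<^sup>2 \<le> 4 / ?s\<^sup>2 * (?q * real k)" using s by (simp only: mult_le_cancel_left_pos)
    also have "\<dots> = (2 / ?s * sqrt (?q * real k))\<^sup>2" using q by (simp add: power_mult_distrib power_divide)
    finally show "?L \<le> 2 / ?s * sqrt (?q * real k)"
      by (rule power2_le_imp_le) (use s in simp)
  qed
qed

end

section \<open>Exponential tilting along a spread direction\<close>

lemma exp_le_quadratic_exp_abs: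
  fixes u :: real
  shows "exp u \<le> 1 + u + u\<^sup>2 * exp \<bar>u\<bar>"
proof -
  obtain t where t: "\<bar>t\<bar> \<le> \<bar>u\<bar>" "exp u = (\<Sum>m<2. u ^ m / fact m) + exp t / fact 2 * u ^ 2"
    using Maclaurin_exp_le[of u 2] by blast
  have "exp t / 2 * u\<^sup>2 \<le> exp \<bar>u\<bar> * u\<^sup>2"
    using t(1) by (intro mult_right_mono order_trans[OF _ exp_le_cancel_iff[THEN iffD2, of t "\<bar>u\<bar>"]]) auto
  then show ?thesis using t(2) by (simp add: eval_nat_numeral mult_ac)
qed

lemma cube_add_le:
  fixes x y :: real
  assumes "x \<ge> 0" "y \<ge> 0"
  shows "(x + y) ^ 3 \<le> 4 * (x ^ 3 + y ^ 3)"
proof -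
  have "4 * (x ^ 3 + y ^ 3) - (x + y) ^ 3 = 3 * ((x + y) * (x - y)\<^sup>2)"
    by (simp add: power2_eq_square power3_eq_cube algebra_simps)
  also have "\<dots> \<ge> 0" using assms by simp
  finally show ?thesis by simp
qed

section \<open>Bernstein's inequality for weighted variables\<close>

context prob_space
begin

text \<open>In exp u \<le> 1 + u + u^2 exp |u| with u = s Y Z, one factor Y of u^2 is bounded by
  \<open>ymax\<close> and the other is kept. So the variance proxy is \<open>ymax\<close> times a
  moment under the weight Y, rather than of order \<open>ymax\<close> squared. This matters because
  in the application \<open>ymax\<close> is a power of m/n with exponent close to 1.\<close>

lemma bounded_weight_mgf:
  assumes [measurable]: "Y \<in> borel_measurable M" "Z \<in> borel_measurable M"
    and Y: "\<And>\<omega>. 0 \<le> Y \<omega>" "\<And>\<omega>. Y \<omega> \<le> ymax"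
    and int: "integrable M (\<lambda>\<omega>. Y \<omega> * Z \<omega>)" "integrable M (\<lambda>\<omega>. Y \<omega> * ((Z \<omega>)\<^sup>2 * exp \<bar>Z \<omega>\<bar>))"
    and b: "expectation (\<lambda>\<omega>. Y \<omega> * Z \<omega>) \<le> b"
    and V: "expectation (\<lambda>\<omega>. Y \<omega> * ((Z \<omega>)\<^sup>2 * exp \<bar>Z \<omega>\<bar>)) \<le> V"
    and s: "0 < s" "s * ymax \<le> 1"
  shows "(\<integral>\<^sup>+\<omega>. ennreal (exp (s * (Y \<omega> * Z \<omega>))) \<partial>M) \<le> ennreal (exp (s * b + s\<^sup>2 * ymax * V))"
proof -
  let ?g = "\<lambda>\<omega>. 1 + s * (Y \<omega> * Z \<omega>) + s\<^sup>2 * ymax * (Y \<omega> * ((Z \<omega>)\<^sup>2 * exp \<bar>Z \<omega>\<bar>))"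
  have y0: "0 \<le> ymax" using Y order_trans by blast
  have ub: "exp (s * (Y \<omega> * Z \<omega>)) \<le> ?g \<omega>" for \<omega>
  proof -
    let ?u = "s * (Y \<omega> * Z \<omega>)"
    have "s * Y \<omega> \<le> s * ymax" using s Y by (intro mult_left_mono) auto
    then have "s * Y \<omega> \<le> 1" using s by linarith
    moreover have "0 \<le> s * Y \<omega>" using s Y(1)[of \<omega>] by simp
    ultimately have sY: "0 \<le> s * Y \<omega>" "s * Y \<omega> \<le> 1" by auto
    have "\<bar>?u\<bar> = (s * Y \<omega>) * \<bar>Z \<omega>\<bar>" using s Y by (simp add: abs_mult)
    also have "\<dots> \<le> 1 * \<bar>Z \<omega>\<bar>" using sY by (intro mult_right_mono) auto
    finally have "\<bar>?u\<bar> \<le> \<bar>Z \<omega>\<bar>" by simp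
    moreover have "?u\<^sup>2 \<le> s\<^sup>2 * ymax * (Y \<omega> * (Z \<omega>)\<^sup>2)"
    proof -
      have "s\<^sup>2 * (Z \<omega>)\<^sup>2 * (Y \<omega> * Y \<omega>) \<le> s\<^sup>2 * (Z \<omega>)\<^sup>2 * (ymax * Y \<omega>)"
        using Y by (intro mult_left_mono mult_right_mono) auto
      then show ?thesis by (simp add: power_mult_distrib power2_eq_square[of "Y \<omega>"] mult_ac)
    qed
    ultimately have "?u\<^sup>2 * exp \<bar>?u\<bar> \<le> s\<^sup>2 * ymax * (Y \<omega> * (Z \<omega>)\<^sup>2) * exp \<bar>Z \<omega>\<bar>"
      using Y y0 by (intro mult_mono) auto
    then show ?thesis using exp_le_quadratic_exp_abs[of ?u] by (simp add: mult_ac)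
  qed
  have "(\<integral>\<^sup>+\<omega>. ennreal (exp (s * (Y \<omega> * Z \<omega>))) \<partial>M) \<le> (\<integral>\<^sup>+\<omega>. ennreal (?g \<omega>) \<partial>M)"
    by (intro nn_integral_mono ennreal_leI ub)
  also have "\<dots> = ennreal (expectation ?g)"
    using int ub by (intro nn_integral_eq_integral AE_I2 order_trans[OF exp_ge_zero ub]) auto
  also have "expectation ?g = 1 + s * expectation (\<lambda>\<omega>. Y \<omega> * Z \<omega>) + s\<^sup>2 * ymax * expectation (\<lambda>\<omega>. Y \<omega> * ((Z \<omega>)\<^sup>2 * exp \<bar>Z \<omega>\<bar>))"
    using int by (simp add: prob_space)
  also have "\<dots> \<le> 1 + s * b + s\<^sup>2 * ymax * V"
    using b V s y0 by (intro add_mono mult_left_mono) auto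
  also have "\<dots> \<le> exp (s * b + s\<^sup>2 * ymax * V)"
    using exp_ge_add_one_self[of "s * b + s\<^sup>2 * ymax * V"] by linarith
  finally show ?thesis by (simp add: ennreal_leI)
qed

lemma bernstein_tail:
  assumes fin: "finite I" and ind: "indep_vars (\<lambda>_. borel) (\<lambda>i \<omega>. Y i \<omega> * Z i \<omega>) I"
    and meas: "\<And>i. i \<in> I \<Longrightarrow> Y i \<in> borel_measurable M" "\<And>i. i \<in> I \<Longrightarrow> Z i \<in> borel_measurable M"
    and Y: "\<And>i \<omega>. i \<in> I \<Longrightarrow> 0 \<le> Y i \<omega>" "\<And>i \<omega>. i \<in> I \<Longrightarrow> Y i \<omega> \<le> ymax"
    and int: "\<And>i. i \<in> I \<Longrightarrow> integrable M (\<lambda>\<omega>. Y i \<omega> * Z i \<omega>)"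
      "\<And>i. i \<in> I \<Longrightarrow> integrable M (\<lambda>\<omega>. Y i \<omega> * ((Z i \<omega>)\<^sup>2 * exp \<bar>Z i \<omega>\<bar>))"
    and b: "\<And>i. i \<in> I \<Longrightarrow> expectation (\<lambda>\<omega>. Y i \<omega> * Z i \<omega>) \<le> b"
    and V: "\<And>i. i \<in> I \<Longrightarrow> expectation (\<lambda>\<omega>. Y i \<omega> * ((Z i \<omega>)\<^sup>2 * exp \<bar>Z i \<omega>\<bar>)) \<le> V"
    and \<kappa>: "0 < \<kappa>" "\<kappa> \<le> 2 * V" and ymax: "ymax > 0"
  shows "prob {\<omega> \<in> space M. (b + \<kappa>) * real (card I) \<le> (\<Sum>i\<in>I. Y i \<omega> * Z i \<omega>)}
     \<le> exp (- (\<kappa>\<^sup>2 / (4 * ymax * V)) * real (card I))"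
proof -
  have V0: "V > 0" using \<kappa> by linarith
  \<comment> \<open>Minimises s^2 \<open>ymax\<close> V - s \<kappa>; the hypothesis \<kappa> \<le>
    2 V gives s \<open>ymax\<close> \<le> 1.\<close>
  define s where "s = \<kappa> / (2 * ymax * V)"
  have s: "0 < s" "s * ymax \<le> 1" using \<kappa> V0 ymax by (auto simp: s_def field_simps)
  have ind': "indep_vars (\<lambda>_. borel) (\<lambda>i \<omega>. s * (Y i \<omega> * Z i \<omega>)) I"
    by (rule indep_vars_compose2[OF ind]) measurable
  have "prob {\<omega> \<in> space M. s * ((b + \<kappa>) * real (card I)) \<le> (\<Sum>i\<in>I. s * (Y i \<omega> * Z i \<omega>))}
      \<le> exp (real (card I) * (s * b + s\<^sup>2 * ymax * V) - s * ((b + \<kappa>) * real (card I)))"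
    by (rule chernoff_sum[OF fin ind']) (intro bounded_weight_mgf meas Y int b V s)
  also have "real (card I) * (s * b + s\<^sup>2 * ymax * V) - s * ((b + \<kappa>) * real (card I))
      = real (card I) * (s * (s * ymax * V - \<kappa>))"
    by (simp add: power2_eq_square algebra_simps)
  also have "s * (s * ymax * V - \<kappa>) = - (\<kappa>\<^sup>2 / (4 * ymax * V))"
    using V0 ymax by (simp add: s_def power2_eq_square field_simps)
  finally have "prob {\<omega> \<in> space M. s * ((b + \<kappa>) * real (card I)) \<le> (\<Sum>i\<in>I. s * (Y i \<omega> * Z i \<omega>))}
      \<le> exp (real (card I) * (- (\<kappa>\<^sup>2 / (4 * ymax * V))))" .
  moreover have "(s * ((b + \<kappa>) * real (card I)) \<le> (\<Sum>i\<in>I. s * (Y i \<omega> * Z i \<omega>)))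
      = ((b + \<kappa>) * real (card I) \<le> (\<Sum>i\<in>I. Y i \<omega> * Z i \<omega>))" for \<omega>
    using s by (simp add: sum_distrib_left[symmetric])
  ultimately show ?thesis by (simp add: mult.commute)
qed

end

text \<open>
  Under the tilt by \<open>\<nu>\<close> the inner product with \<open>c\<close> concentrates around \<open>\<nu>\<close>. The truncation
  costs little there, bounds the weights so that Bernstein's inequality applies, and forces every
  row of positive weight to have inner product at least \<open>(1 - \<epsilon>) \<nu>\<close> with \<open>c\<close>.
\<close>

definition tilt_weight :: "real \<Rightarrow> real \<Rightarrow> real \<Rightarrow> real" where
  "tilt_weight \<nu> \<epsilon> x = (if \<bar>x - \<nu>\<bar> \<le> \<epsilon> * \<nu> then exp (\<nu> * x - \<nu>\<^sup>2 / 2) else 0)"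

lemma measurable_tilt_weight [measurable]: "tilt_weight \<nu> \<epsilon> \<in> borel_measurable borel"
  unfolding tilt_weight_def by measurable

lemma tilt_weight_nonneg: "tilt_weight \<nu> \<epsilon> x \<ge> 0"
  by (simp add: tilt_weight_def)

lemma tilt_weight_le_exp: "tilt_weight \<nu> \<epsilon> x \<le> exp (\<nu> * x - \<nu>\<^sup>2 / 2)"
  by (simp add: tilt_weight_def)

lemma tilt_weight_le:
  assumes "\<nu> > 0"
  shows "tilt_weight \<nu> \<epsilon> x \<le> exp ((1 / 2 + \<epsilon>) * \<nu>\<^sup>2)"
proof (cases "\<bar>x - \<nu>\<bar> \<le> \<epsilon> * \<nu>")
  case True
  then have "\<nu> * x \<le> \<nu> * (\<nu> + \<epsilon> * \<nu>)" using assms by (intro mult_left_mono) auto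
  then show ?thesis using True by (simp add: tilt_weight_def power2_eq_square algebra_simps)
qed (simp add: tilt_weight_def)

text \<open>What a vector of norm at most h orthogonal to c adds to the exponent in
  \<open>tilted_mgf_upper\<close>; the 4 comes from \<open>cube_add_le\<close>.\<close>

definition mgf_err :: "real \<Rightarrow> real \<Rightarrow> real" where
  "mgf_err K h = h\<^sup>2 / 2 + 4 * mgf_const K * h ^ 3"

text \<open>The prefactor 4 counts the two sides of the truncation window and the two signs of the
  orthogonal inner product. The exponent \<epsilon>^2 \<nu>^2 / 2 is that of a standard Gaussian
  tail at distance \<epsilon> \<nu> from the mean.\<close>

definition trunc_err :: "real \<Rightarrow> real \<Rightarrow> real \<Rightarrow> real \<Rightarrow> real \<Rightarrow> real" where
  "trunc_err K \<nu> \<epsilon> \<delta> h = 4 * exp (- (\<epsilon>\<^sup>2 * \<nu>\<^sup>2 / 2) + mgf_err K h + \<delta>)"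

locale spread_direction = subgaussian_matrix +
  fixes c :: "nat \<Rightarrow> real" and \<tau> :: real
  assumes c_unit: "L2_set c Q = 1" and c_spread: "\<And>j. j \<in> Q \<Longrightarrow> \<bar>c j\<bar> \<le> \<tau>" and \<tau>_nonneg: "\<tau> \<ge> 0"
begin

abbreviation \<xi> where "\<xi> i \<omega> \<equiv> dot Q c (row i \<omega>)"

text \<open>Through this quantity the third-order terms depend on the direction: they are at most a
  constant times |\<mu>|^3 \<tau>.\<close>

lemma sum_cube_c: "(\<Sum>j\<in>Q. \<bar>c j\<bar> ^ 3) \<le> \<tau>"
proof -
  have "(\<Sum>j\<in>Q. \<bar>c j\<bar> ^ 3) \<le> (\<Sum>j\<in>Q. \<tau> * (c j)\<^sup>2)"
  proof (rule sum_mono)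
    fix j assume "j \<in> Q"
    then have "\<bar>c j\<bar> * \<bar>c j\<bar>\<^sup>2 \<le> \<tau> * \<bar>c j\<bar>\<^sup>2" by (intro mult_right_mono c_spread) auto
    then show "\<bar>c j\<bar> ^ 3 \<le> \<tau> * (c j)\<^sup>2" by (simp add: power3_eq_cube power2_eq_square)
  qed
  also have "\<dots> = \<tau> * (L2_set c Q)\<^sup>2" by (simp add: sum_distrib_left L2_set_sq)
  finally show ?thesis by (simp add: c_unit)
qed

text \<open>As c is a unit vector orthogonal to v, the squared norm of \<mu> c + v splits without a
  cross term. The cubic terms split up to a factor 4, and \<delta> takes up the part coming from
  \<mu> c.\<close>

lemma tilted_mgf_upper:
  assumes i: "i \<in> P" and v: "dot Q c v = 0" "L2_set v Q \<le> h" and h: "h \<le> 1 / 2"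
    and \<mu>: "\<bar>\<mu>\<bar> * \<tau> \<le> 1 / 2" and \<delta>: "4 * mgf_const K * (\<bar>\<mu>\<bar> ^ 3 * \<tau>) \<le> \<delta>"
  shows "expectation (\<lambda>\<omega>. exp (\<mu> * \<xi> i \<omega> + dot Q v (row i \<omega>))) \<le> exp (\<mu>\<^sup>2 / 2 + mgf_err K h + \<delta>)"
    and "integrable M (\<lambda>\<omega>. exp (\<mu> * \<xi> i \<omega> + dot Q v (row i \<omega>)))"
proof -
  let ?u = "\<lambda>j. \<mu> * c j + v j"
  have eq: "dot Q ?u (row i \<omega>) = \<mu> * \<xi> i \<omega> + dot Q v (row i \<omega>)" for \<omega>
    by (simp add: dot_add_left dot_scale_left)
  show "integrable M (\<lambda>\<omega>. exp (\<mu> * \<xi> i \<omega> + dot Q v (row i \<omega>)))"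
    using row_exp(1)[OF i, of ?u] by (simp add: eq)
  have h0: "0 \<le> h" using v(2) L2_set_nonneg[of v Q] by linarith
  have vj: "\<bar>v j\<bar> \<le> h" if "j \<in> Q" for j
  proof -
    have "\<bar>v j\<bar> \<le> L2_set (\<lambda>j. \<bar>v j\<bar>) Q" using that by (intro member_le_L2_set finite_Q)
    then show ?thesis using v(2) by (simp add: L2_set_def)
  qed
  have uj: "\<bar>?u j\<bar> \<le> \<bar>\<mu>\<bar> * \<bar>c j\<bar> + \<bar>v j\<bar>" for j
    using abs_triangle_ineq[of "\<mu> * c j" "v j"] by (simp add: abs_mult)
  have u1: "\<bar>?u j\<bar> \<le> 1" if j: "j \<in> Q" for j
  proof -
    have "\<bar>\<mu>\<bar> * \<bar>c j\<bar> \<le> \<bar>\<mu>\<bar> * \<tau>" using c_spread[OF j] by (intro mult_left_mono) auto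
    then show ?thesis using uj[of j] vj[OF j] h \<mu> by linarith
  qed
  have "expectation (\<lambda>\<omega>. exp (\<mu> * \<xi> i \<omega> + dot Q v (row i \<omega>)))
      \<le> exp ((L2_set ?u Q)\<^sup>2 / 2 + mgf_const K * (\<Sum>j\<in>Q. \<bar>?u j\<bar> ^ 3))"
    using row_mgf_upper[OF i, of ?u] u1 by (simp add: eq)
  also have "\<dots> \<le> exp (\<mu>\<^sup>2 / 2 + mgf_err K h + \<delta>)"
  proof -
    have v2: "(L2_set v Q)\<^sup>2 \<le> h\<^sup>2" using v(2) by (intro power_mono) auto
    have "(L2_set ?u Q)\<^sup>2 = dot Q ?u ?u" by (simp add: dot_self)
    also have "\<dots> = \<mu> * (\<mu> * dot Q c c) + 2 * \<mu> * dot Q c v + dot Q v v"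
      unfolding dot_add_left dot_add_right dot_scale_left dot_scale_right by (simp add: dot_commute algebra_simps)
    also have "\<dots> \<le> \<mu>\<^sup>2 + h\<^sup>2" using v2 by (simp add: dot_self c_unit v(1) power2_eq_square)
    finally have 1: "(L2_set ?u Q)\<^sup>2 \<le> \<mu>\<^sup>2 + h\<^sup>2" .
    have "(\<Sum>j\<in>Q. \<bar>?u j\<bar> ^ 3) \<le> (\<Sum>j\<in>Q. 4 * (\<bar>\<mu>\<bar> ^ 3 * \<bar>c j\<bar> ^ 3 + h * (v j)\<^sup>2))"
    proof (rule sum_mono)
      fix j assume j: "j \<in> Q"
      have "\<bar>?u j\<bar> ^ 3 \<le> (\<bar>\<mu>\<bar> * \<bar>c j\<bar> + \<bar>v j\<bar>) ^ 3" using uj by (intro power_mono) auto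
      also have "\<dots> \<le> 4 * ((\<bar>\<mu>\<bar> * \<bar>c j\<bar>) ^ 3 + \<bar>v j\<bar> ^ 3)" by (intro cube_add_le) auto
      also have "\<bar>v j\<bar> ^ 3 \<le> h * (v j)\<^sup>2"
        using mult_right_mono[OF vj[OF j], of "\<bar>v j\<bar>\<^sup>2"] by (simp add: power3_eq_cube power2_eq_square)
      finally show "\<bar>?u j\<bar> ^ 3 \<le> 4 * (\<bar>\<mu>\<bar> ^ 3 * \<bar>c j\<bar> ^ 3 + h * (v j)\<^sup>2)"
        by (simp add: power_mult_distrib)
    qed
    also have "\<dots> = 4 * (\<bar>\<mu>\<bar> ^ 3 * (\<Sum>j\<in>Q. \<bar>c j\<bar> ^ 3) + h * (L2_set v Q)\<^sup>2)"
      by (simp add: sum_distrib_left sum.distrib L2_set_sq)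
    also have "\<dots> \<le> 4 * (\<bar>\<mu>\<bar> ^ 3 * \<tau> + h * h\<^sup>2)"
      using sum_cube_c v2 h0 by (intro mult_left_mono add_mono) auto
    finally have "mgf_const K * (\<Sum>j\<in>Q. \<bar>?u j\<bar> ^ 3) \<le> mgf_const K * (4 * (\<bar>\<mu>\<bar> ^ 3 * \<tau> + h * h\<^sup>2))"
      using mgf_const_ge2[of K] by (intro mult_left_mono) auto
    also have "\<dots> = 4 * mgf_const K * (\<bar>\<mu>\<bar> ^ 3 * \<tau>) + 4 * mgf_const K * h ^ 3"
      by (simp add: power3_eq_cube power2_eq_square algebra_simps)
    finally show ?thesis using 1 \<delta> by (simp add: mgf_err_def add_divide_distrib)
  qed
  finally show "expectation (\<lambda>\<omega>. exp (\<mu> * \<xi> i \<omega> + dot Q v (row i \<omega>))) \<le> exp (\<mu>\<^sup>2 / 2 + mgf_err K h + \<delta>)" .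
qed

lemma tilted_mgf_lower:
  assumes i: "i \<in> P" and \<mu>: "\<bar>\<mu>\<bar> * \<tau> * mgf_const K \<le> 1 / 2" and \<delta>: "mgf_lower_const K * (\<bar>\<mu>\<bar> ^ 3 * \<tau>) \<le> \<delta>"
  shows "expectation (\<lambda>\<omega>. exp (\<mu> * \<xi> i \<omega>)) \<ge> exp (\<mu>\<^sup>2 / 2 - \<delta>)"
proof -
  have u1: "\<bar>\<mu> * c j\<bar> * mgf_const K \<le> 1 / 2" if j: "j \<in> Q" for j
  proof -
    have "\<bar>\<mu> * c j\<bar> * mgf_const K \<le> \<bar>\<mu>\<bar> * \<tau> * mgf_const K"
      using c_spread[OF j] mgf_const_ge2[of K] by (intro mult_right_mono) (auto simp: abs_mult intro!: mult_left_mono)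
    then show ?thesis using \<mu> by linarith
  qed
  have "exp ((L2_set (\<lambda>j. \<mu> * c j) Q)\<^sup>2 / 2 - mgf_lower_const K * (\<Sum>j\<in>Q. \<bar>\<mu> * c j\<bar> ^ 3))
      \<le> expectation (\<lambda>\<omega>. exp (\<mu> * \<xi> i \<omega>))"
    using row_mgf_lower[OF i, of "\<lambda>j. \<mu> * c j"] u1 by (simp add: dot_scale_left)
  moreover have "mgf_lower_const K * (\<Sum>j\<in>Q. \<bar>\<mu> * c j\<bar> ^ 3) \<le> \<delta>"
  proof -
    have "(\<Sum>j\<in>Q. \<bar>\<mu> * c j\<bar> ^ 3) = \<bar>\<mu>\<bar> ^ 3 * (\<Sum>j\<in>Q. \<bar>c j\<bar> ^ 3)"
      by (simp add: abs_mult power_mult_distrib sum_distrib_left)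
    also have "\<dots> \<le> \<bar>\<mu>\<bar> ^ 3 * \<tau>" using sum_cube_c by (intro mult_left_mono) auto
    finally have "mgf_lower_const K * (\<Sum>j\<in>Q. \<bar>\<mu> * c j\<bar> ^ 3) \<le> mgf_lower_const K * (\<bar>\<mu>\<bar> ^ 3 * \<tau>)"
      using mgf_const_ge2[of K] by (intro mult_left_mono) (auto simp: mgf_lower_const_def)
    then show ?thesis using \<delta> by linarith
  qed
  moreover have "(L2_set (\<lambda>j. \<mu> * c j) Q)\<^sup>2 = \<mu>\<^sup>2" by (simp add: L2_set_scale c_unit)
  ultimately show ?thesis by (smt (verit, best) exp_le_cancel_iff)
qed

end

text \<open>The tilts that occur are \<nu> and (1 \<plusminus> \<epsilon>) \<nu>, all at most 2
  \<nu>. Hence the factor 2 in \<open>\<nu>\<tau>\<close>, and the 32 in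
  \<open>\<delta>_upper\<close>, which is 4 times 2^3.\<close>

locale tilted_rows = spread_direction +
  fixes \<nu> \<epsilon> \<delta> :: real
  assumes \<nu>: "\<nu> > 0" and \<epsilon>: "0 < \<epsilon>" "\<epsilon> \<le> 1 / 2"
    and \<nu>\<tau>: "2 * \<nu> * \<tau> * mgf_const K \<le> 1 / 2"
    and \<delta>_upper: "32 * mgf_const K * (\<nu> ^ 3 * \<tau>) \<le> \<delta>" and \<delta>_lower: "mgf_lower_const K * (\<nu> ^ 3 * \<tau>) \<le> \<delta>"
begin

abbreviation y where "y i \<omega> \<equiv> tilt_weight \<nu> \<epsilon> (\<xi> i \<omega>)"
text \<open>The untruncated weight is the likelihood ratio of shifting a standard Gaussian by \<nu>;
  its mean lies between exp (-\<delta>) and exp \<delta>.\<close>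

abbreviation w where "w i \<omega> \<equiv> exp (\<nu> * \<xi> i \<omega> - \<nu>\<^sup>2 / 2)"

lemma tilted_exp:
  assumes i: "i \<in> P" and v: "dot Q c v = 0" "L2_set v Q \<le> h" and h: "h \<le> 1 / 2"
    and \<mu>: "\<bar>\<mu>\<bar> \<le> 2 * \<nu>"
  shows "expectation (\<lambda>\<omega>. exp (\<mu> * \<xi> i \<omega> + dot Q v (row i \<omega>))) \<le> exp (\<mu>\<^sup>2 / 2 + mgf_err K h + \<delta>)"
    and "integrable M (\<lambda>\<omega>. exp (\<mu> * \<xi> i \<omega> + dot Q v (row i \<omega>)))"
proof -
  have H: "mgf_const K \<ge> 2" by (rule mgf_const_ge2)
  have "\<bar>\<mu>\<bar> * \<tau> \<le> 2 * \<nu> * \<tau>" using \<mu> \<tau>_nonneg by (intro mult_right_mono) auto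
  also have "\<dots> \<le> 2 * \<nu> * \<tau> * mgf_const K"
    using mult_left_mono[of 1 "mgf_const K" "2 * \<nu> * \<tau>"] H \<nu> \<tau>_nonneg by simp
  finally have 1: "\<bar>\<mu>\<bar> * \<tau> \<le> 1 / 2" using \<nu>\<tau> by linarith
  have "\<bar>\<mu>\<bar> ^ 3 \<le> (2 * \<nu>) ^ 3" using \<mu> by (intro power_mono) auto
  then have "\<bar>\<mu>\<bar> ^ 3 * \<tau> \<le> 8 * (\<nu> ^ 3 * \<tau>)"
    using mult_right_mono[OF _ \<tau>_nonneg] by (fastforce simp: power_mult_distrib)
  then have "4 * mgf_const K * (\<bar>\<mu>\<bar> ^ 3 * \<tau>) \<le> 4 * mgf_const K * (8 * (\<nu> ^ 3 * \<tau>))"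
    using H by (intro mult_left_mono) auto
  also have "\<dots> = 32 * mgf_const K * (\<nu> ^ 3 * \<tau>)" by simp
  finally have 2: "4 * mgf_const K * (\<bar>\<mu>\<bar> ^ 3 * \<tau>) \<le> \<delta>" using \<delta>_upper by linarith
  show "expectation (\<lambda>\<omega>. exp (\<mu> * \<xi> i \<omega> + dot Q v (row i \<omega>))) \<le> exp (\<mu>\<^sup>2 / 2 + mgf_err K h + \<delta>)"
    and "integrable M (\<lambda>\<omega>. exp (\<mu> * \<xi> i \<omega> + dot Q v (row i \<omega>)))"
    using tilted_mgf_upper[OF i v h 1 2] by auto
qed

lemma w_exp:
  assumes i: "i \<in> P" and v: "dot Q c v = 0" "L2_set v Q \<le> h" and h: "h \<le> 1 / 2"
  shows "expectation (\<lambda>\<omega>. w i \<omega> * exp (dot Q v (row i \<omega>))) \<le> exp (mgf_err K h + \<delta>)"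
    and "integrable M (\<lambda>\<omega>. w i \<omega> * exp (dot Q v (row i \<omega>)))"
proof -
  have eq: "w i \<omega> * exp (dot Q v (row i \<omega>)) = exp (- (\<nu>\<^sup>2 / 2)) * exp (\<nu> * \<xi> i \<omega> + dot Q v (row i \<omega>))" for \<omega>
    by (simp add: exp_add[symmetric] algebra_simps)
  note t = tilted_exp[OF i v h, of \<nu>]
  show "integrable M (\<lambda>\<omega>. w i \<omega> * exp (dot Q v (row i \<omega>)))"
    unfolding eq using t(2) \<nu> by (intro integrable_mult_right) auto
  have "expectation (\<lambda>\<omega>. w i \<omega> * exp (dot Q v (row i \<omega>))) \<le> exp (- (\<nu>\<^sup>2 / 2)) * exp (\<nu>\<^sup>2 / 2 + mgf_err K h + \<delta>)"
    unfolding eq using t(1) \<nu> by (simp add: mult_left_mono)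
  then show "expectation (\<lambda>\<omega>. w i \<omega> * exp (dot Q v (row i \<omega>))) \<le> exp (mgf_err K h + \<delta>)"
    by (simp add: exp_add[symmetric])
qed

text \<open>Outside the window, w is dominated by w exp (\<epsilon> \<nu> d), where d \<ge> 0 is the
  distance of the inner product with c from the window. On either side this is again an exponential
  tilt, by (1 + \<epsilon>) \<nu> or by (1 - \<epsilon>) \<nu>, so \<open>tilted_exp\<close>
  applies.\<close>

lemma w_trunc:
  assumes i: "i \<in> P" and v: "dot Q c v = 0" "L2_set v Q \<le> h" and h: "h \<le> 1 / 2"
  shows "expectation (\<lambda>\<omega>. (w i \<omega> - y i \<omega>) * exp (dot Q v (row i \<omega>))) \<le> 2 * exp (- (\<epsilon>\<^sup>2 * \<nu>\<^sup>2 / 2) + mgf_err K h + \<delta>)"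
    and "integrable M (\<lambda>\<omega>. (w i \<omega> - y i \<omega>) * exp (dot Q v (row i \<omega>)))"
proof -
  let ?z = "\<lambda>\<omega>. dot Q v (row i \<omega>)"
  have [measurable]: "?z \<in> borel_measurable M" "\<xi> i \<in> borel_measurable M" using i by measurable
  have wy: "0 \<le> w i \<omega> - y i \<omega>" "w i \<omega> - y i \<omega> \<le> w i \<omega>" for \<omega>
    using tilt_weight_le_exp[of \<nu> \<epsilon> "\<xi> i \<omega>"] tilt_weight_nonneg[of \<nu> \<epsilon> "\<xi> i \<omega>"] by auto
  have aw: "\<bar>w i \<omega> - y i \<omega>\<bar> \<le> w i \<omega>" for \<omega> using wy[of \<omega>] by linarith
  show int: "integrable M (\<lambda>\<omega>. (w i \<omega> - y i \<omega>) * exp (?z \<omega>))"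
    by (rule Bochner_Integration.integrable_bound[OF w_exp(2)[OF i v h]])
       (auto simp: abs_mult aw intro!: mult_right_mono)
  let ?p = "\<lambda>\<omega>. exp (- (\<nu>\<^sup>2 / 2) - \<epsilon> * (1 + \<epsilon>) * \<nu>\<^sup>2) * exp ((1 + \<epsilon>) * \<nu> * \<xi> i \<omega> + ?z \<omega>)"
  let ?n = "\<lambda>\<omega>. exp (- (\<nu>\<^sup>2 / 2) + \<epsilon> * (1 - \<epsilon>) * \<nu>\<^sup>2) * exp ((1 - \<epsilon>) * \<nu> * \<xi> i \<omega> + ?z \<omega>)"
  have pw: "(w i \<omega> - y i \<omega>) * exp (?z \<omega>) \<le> ?p \<omega> + ?n \<omega>" for \<omega>
  proof (cases "\<bar>\<xi> i \<omega> - \<nu>\<bar> \<le> \<epsilon> * \<nu>")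
    case True
    then show ?thesis by (simp add: tilt_weight_def add_nonneg_nonneg)
  next
    case False
    then have eq: "(w i \<omega> - y i \<omega>) * exp (?z \<omega>) = exp (\<nu> * \<xi> i \<omega> - \<nu>\<^sup>2 / 2 + ?z \<omega>)"
      by (simp add: tilt_weight_def exp_add[symmetric])
    have p: "?p \<omega> = exp (\<nu> * \<xi> i \<omega> - \<nu>\<^sup>2 / 2 + ?z \<omega> + \<epsilon> * \<nu> * (\<xi> i \<omega> - (1 + \<epsilon>) * \<nu>))"
      by (simp add: exp_add[symmetric] power2_eq_square algebra_simps)
    have n: "?n \<omega> = exp (\<nu> * \<xi> i \<omega> - \<nu>\<^sup>2 / 2 + ?z \<omega> + \<epsilon> * \<nu> * ((1 - \<epsilon>) * \<nu> - \<xi> i \<omega>))"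
      by (simp add: exp_add[symmetric] power2_eq_square algebra_simps)
    have "\<xi> i \<omega> - (1 + \<epsilon>) * \<nu> \<ge> 0 \<or> (1 - \<epsilon>) * \<nu> - \<xi> i \<omega> \<ge> 0"
      using False by (auto simp: algebra_simps abs_if split: if_splits)
    then show ?thesis
    proof
      assume "\<xi> i \<omega> - (1 + \<epsilon>) * \<nu> \<ge> 0"
      then have "exp (\<nu> * \<xi> i \<omega> - \<nu>\<^sup>2 / 2 + ?z \<omega>) \<le> ?p \<omega>" unfolding p using \<nu> \<epsilon> by simp
      then show ?thesis unfolding eq by (simp add: add_increasing2)
    next
      assume "(1 - \<epsilon>) * \<nu> - \<xi> i \<omega> \<ge> 0"
      then have "exp (\<nu> * \<xi> i \<omega> - \<nu>\<^sup>2 / 2 + ?z \<omega>) \<le> ?n \<omega>" unfolding n using \<nu> \<epsilon> by simp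
      then show ?thesis unfolding eq by (simp add: add_increasing)
    qed
  qed
  have \<mu>: "\<bar>(1 + \<epsilon>) * \<nu>\<bar> \<le> 2 * \<nu>" "\<bar>(1 - \<epsilon>) * \<nu>\<bar> \<le> 2 * \<nu>" using \<nu> \<epsilon> by (auto simp: abs_mult)
  note tp = tilted_exp[OF i v h \<mu>(1)] and tn = tilted_exp[OF i v h \<mu>(2)]
  have "expectation (\<lambda>\<omega>. (w i \<omega> - y i \<omega>) * exp (?z \<omega>)) \<le> expectation (\<lambda>\<omega>. ?p \<omega> + ?n \<omega>)"
    using tp(2) tn(2) by (intro integral_mono[OF int _ pw] Bochner_Integration.integrable_add integrable_mult_right) auto
  also have "\<dots> = exp (- (\<nu>\<^sup>2 / 2) - \<epsilon> * (1 + \<epsilon>) * \<nu>\<^sup>2) * expectation (\<lambda>\<omega>. exp ((1 + \<epsilon>) * \<nu> * \<xi> i \<omega> + ?z \<omega>))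
     + exp (- (\<nu>\<^sup>2 / 2) + \<epsilon> * (1 - \<epsilon>) * \<nu>\<^sup>2) * expectation (\<lambda>\<omega>. exp ((1 - \<epsilon>) * \<nu> * \<xi> i \<omega> + ?z \<omega>))"
    using tp(2) tn(2) by (subst Bochner_Integration.integral_add) auto
  also have "\<dots> \<le> exp (- (\<nu>\<^sup>2 / 2) - \<epsilon> * (1 + \<epsilon>) * \<nu>\<^sup>2) * exp (((1 + \<epsilon>) * \<nu>)\<^sup>2 / 2 + mgf_err K h + \<delta>)
     + exp (- (\<nu>\<^sup>2 / 2) + \<epsilon> * (1 - \<epsilon>) * \<nu>\<^sup>2) * exp (((1 - \<epsilon>) * \<nu>)\<^sup>2 / 2 + mgf_err K h + \<delta>)"
    using tp(1) tn(1) by (intro add_mono mult_left_mono) auto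
  also have "\<dots> = 2 * exp (- (\<epsilon>\<^sup>2 * \<nu>\<^sup>2 / 2) + mgf_err K h + \<delta>)"
  proof -
    have "- (\<nu>\<^sup>2 / 2) - \<epsilon> * (1 + \<epsilon>) * \<nu>\<^sup>2 + (((1 + \<epsilon>) * \<nu>)\<^sup>2 / 2 + mgf_err K h + \<delta>) = - (\<epsilon>\<^sup>2 * \<nu>\<^sup>2 / 2) + mgf_err K h + \<delta>"
      "- (\<nu>\<^sup>2 / 2) + \<epsilon> * (1 - \<epsilon>) * \<nu>\<^sup>2 + (((1 - \<epsilon>) * \<nu>)\<^sup>2 / 2 + mgf_err K h + \<delta>) = - (\<epsilon>\<^sup>2 * \<nu>\<^sup>2 / 2) + mgf_err K h + \<delta>"
      by (simp_all add: power2_eq_square field_simps)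
    note e = this
    show ?thesis unfolding exp_add[symmetric] e by (rule mult_2[symmetric])
  qed
  finally show "expectation (\<lambda>\<omega>. (w i \<omega> - y i \<omega>) * exp (?z \<omega>)) \<le> 2 * exp (- (\<epsilon>\<^sup>2 * \<nu>\<^sup>2 / 2) + mgf_err K h + \<delta>)" .
qed

lemma w_lower: "i \<in> P \<Longrightarrow> expectation (w i) \<ge> exp (- \<delta>)"
proof -
  assume i: "i \<in> P"
  have "\<nu> * \<tau> * mgf_const K \<ge> 0" using \<nu> \<tau>_nonneg mgf_const_ge2[of K] by simp
  then have 1: "\<bar>\<nu>\<bar> * \<tau> * mgf_const K \<le> 1 / 2" using \<nu>\<tau> \<nu> by simp
  have "exp (\<nu>\<^sup>2 / 2 - \<delta>) \<le> expectation (\<lambda>\<omega>. exp (\<nu> * \<xi> i \<omega>))"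
    using \<delta>_lower \<nu> by (intro tilted_mgf_lower[OF i 1]) simp
  then have "exp (- (\<nu>\<^sup>2 / 2)) * exp (\<nu>\<^sup>2 / 2 - \<delta>) \<le> exp (- (\<nu>\<^sup>2 / 2)) * expectation (\<lambda>\<omega>. exp (\<nu> * \<xi> i \<omega>))"
    by (rule mult_left_mono) simp
  also have "\<dots> = expectation (\<lambda>\<omega>. exp (- (\<nu>\<^sup>2 / 2)) * exp (\<nu> * \<xi> i \<omega>))" by simp
  also have "(\<lambda>\<omega>. exp (- (\<nu>\<^sup>2 / 2)) * exp (\<nu> * \<xi> i \<omega>)) = w i"
    by (simp add: exp_add[symmetric] fun_eq_iff)
  finally show ?thesis by (simp add: exp_add[symmetric])
qed

lemma zero_perp: "dot Q c (\<lambda>_. 0) = 0" "L2_set (\<lambda>_. 0) Q \<le> 0"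
  by (simp_all add: dot_def L2_set_def)

lemma mgf_err_0 [simp]: "mgf_err K 0 = 0"
  by (simp add: mgf_err_def)

lemma w_integrable: "i \<in> P \<Longrightarrow> integrable M (w i)"
  using w_exp(2)[OF _ zero_perp] by (simp add: dot_def)

text \<open>One domination argument serves both the truncated weight y and the defect w - y. It is
  used with f the orthogonal inner product z in \<open>y_perp_mean\<close> and with f = z^2 exp |z|
  in \<open>y_perp_second\<close>.\<close>

lemma y_integrable_bound:
  assumes i: "i \<in> P" and v: "dot Q c v = 0" "L2_set v Q \<le> h" and h: "h \<le> 1 / 2"
    and [measurable]: "f \<in> borel_measurable M"
    and f: "\<And>\<omega>. \<bar>f \<omega>\<bar> \<le> C * (exp (dot Q v (row i \<omega>)) + exp (- dot Q v (row i \<omega>)))"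
  shows "integrable M (\<lambda>\<omega>. y i \<omega> * f \<omega>)"
    and "expectation (\<lambda>\<omega>. \<bar>y i \<omega> * f \<omega>\<bar>) \<le> 2 * C * exp (mgf_err K h + \<delta>)"
    and "integrable M (\<lambda>\<omega>. (w i \<omega> - y i \<omega>) * f \<omega>)"
    and "expectation (\<lambda>\<omega>. \<bar>(w i \<omega> - y i \<omega>) * f \<omega>\<bar>) \<le> 4 * C * exp (- (\<epsilon>\<^sup>2 * \<nu>\<^sup>2 / 2) + mgf_err K h + \<delta>)"
proof -
  let ?z = "\<lambda>\<omega>. dot Q v (row i \<omega>)" let ?v' = "\<lambda>j. - 1 * v j"
  have [measurable]: "?z \<in> borel_measurable M" "\<xi> i \<in> borel_measurable M" using i by measurable
  have v': "dot Q c ?v' = 0" "L2_set ?v' Q \<le> h" using v unfolding dot_scale_right L2_set_scale by auto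
  have neg: "dot Q ?v' (row i \<omega>) = - ?z \<omega>" for \<omega> by (subst dot_scale_left) simp
  have wy: "0 \<le> w i \<omega> - y i \<omega>" "0 \<le> y i \<omega>" "y i \<omega> \<le> w i \<omega>" for \<omega>
    using tilt_weight_le_exp[of \<nu> \<epsilon> "\<xi> i \<omega>"] tilt_weight_nonneg[of \<nu> \<epsilon> "\<xi> i \<omega>"] by auto
  have C: "C \<ge> 0"
  proof -
    obtain \<omega> where "\<omega> \<in> space M" using not_empty by blast
    have "0 \<le> C * (exp (?z \<omega>) + exp (- ?z \<omega>))" using f[of \<omega>] by linarith
    moreover have "0 < exp (?z \<omega>) + exp (- ?z \<omega>)" by (intro add_pos_pos) auto
    ultimately show ?thesis by (auto simp: zero_le_mult_iff)
  qed
  have *: "integrable M (\<lambda>\<omega>. g \<omega> * f \<omega>)" "expectation (\<lambda>\<omega>. \<bar>g \<omega> * f \<omega>\<bar>) \<le> C * (b1 + b2)"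
    if g: "g \<in> borel_measurable M" "\<And>\<omega>. 0 \<le> g \<omega>" "\<And>\<omega>. g \<omega> \<le> G \<omega>"
    and G: "integrable M (\<lambda>\<omega>. G \<omega> * exp (?z \<omega>))" "integrable M (\<lambda>\<omega>. G \<omega> * exp (- ?z \<omega>))"
      "expectation (\<lambda>\<omega>. G \<omega> * exp (?z \<omega>)) \<le> b1" "expectation (\<lambda>\<omega>. G \<omega> * exp (- ?z \<omega>)) \<le> b2"
    for g G b1 b2
  proof -
    have ib: "integrable M (\<lambda>\<omega>. C * (G \<omega> * exp (?z \<omega>) + G \<omega> * exp (- ?z \<omega>)))"
      using G(1,2) by (intro integrable_mult_right Bochner_Integration.integrable_add)
    have le: "\<bar>g \<omega> * f \<omega>\<bar> \<le> C * (G \<omega> * exp (?z \<omega>) + G \<omega> * exp (- ?z \<omega>))" for \<omega>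
    proof -
      have "\<bar>g \<omega> * f \<omega>\<bar> = g \<omega> * \<bar>f \<omega>\<bar>" using g by (simp add: abs_mult)
      also have "\<dots> \<le> G \<omega> * (C * (exp (?z \<omega>) + exp (- ?z \<omega>)))"
        using g f order_trans[OF g(2) g(3)] by (intro mult_mono) auto
      finally show ?thesis by (simp add: algebra_simps)
    qed
    note [measurable] = g(1)
    show i1: "integrable M (\<lambda>\<omega>. g \<omega> * f \<omega>)"
      by (rule Bochner_Integration.integrable_bound[OF ib]) (auto intro!: order_trans[OF le])
    have "expectation (\<lambda>\<omega>. \<bar>g \<omega> * f \<omega>\<bar>) \<le> expectation (\<lambda>\<omega>. C * (G \<omega> * exp (?z \<omega>) + G \<omega> * exp (- ?z \<omega>)))"
      using i1 by (intro integral_mono[OF _ ib le]) auto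
    also have "\<dots> = C * (expectation (\<lambda>\<omega>. G \<omega> * exp (?z \<omega>)) + expectation (\<lambda>\<omega>. G \<omega> * exp (- ?z \<omega>)))"
      using G(1,2) by simp
    also have "\<dots> \<le> C * (b1 + b2)" using G C by (intro mult_left_mono add_mono) auto
    finally show "expectation (\<lambda>\<omega>. \<bar>g \<omega> * f \<omega>\<bar>) \<le> C * (b1 + b2)" .
  qed
  note w1 = w_exp[OF i v h] and w2 = w_exp[OF i v' h, unfolded neg]
  have A: "integrable M (\<lambda>\<omega>. y i \<omega> * f \<omega>)" "expectation (\<lambda>\<omega>. \<bar>y i \<omega> * f \<omega>\<bar>) \<le> C * (exp (mgf_err K h + \<delta>) + exp (mgf_err K h + \<delta>))"
    using *[OF _ wy(2) wy(3) w1(2) w2(2) w1(1) w2(1)] by auto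
  then show "integrable M (\<lambda>\<omega>. y i \<omega> * f \<omega>)" "expectation (\<lambda>\<omega>. \<bar>y i \<omega> * f \<omega>\<bar>) \<le> 2 * C * exp (mgf_err K h + \<delta>)"
    by auto
  note t1 = w_trunc[OF i v h] and t2 = w_trunc[OF i v' h, unfolded neg]
  have B: "integrable M (\<lambda>\<omega>. (w i \<omega> - y i \<omega>) * f \<omega>)"
    "expectation (\<lambda>\<omega>. \<bar>(w i \<omega> - y i \<omega>) * f \<omega>\<bar>) \<le> C * (2 * exp (- (\<epsilon>\<^sup>2 * \<nu>\<^sup>2 / 2) + mgf_err K h + \<delta>) + 2 * exp (- (\<epsilon>\<^sup>2 * \<nu>\<^sup>2 / 2) + mgf_err K h + \<delta>))"
    using *[OF _ wy(1) order_refl t1(2) t2(2) t1(1) t2(1)] by auto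
  then show "integrable M (\<lambda>\<omega>. (w i \<omega> - y i \<omega>) * f \<omega>)"
    "expectation (\<lambda>\<omega>. \<bar>(w i \<omega> - y i \<omega>) * f \<omega>\<bar>) \<le> 4 * C * exp (- (\<epsilon>\<^sup>2 * \<nu>\<^sup>2 / 2) + mgf_err K h + \<delta>)"
    by auto
qed

text \<open>As z \<le> exp z - 1, the mean of z under w is at most a difference of two exponential
  moments, so nothing has to be differentiated. For norm h the bound is O(h^2) up to vanishing
  terms, and dividing by h makes it small for unit vectors.\<close>

lemma y_perp_mean:
  assumes i: "i \<in> P" and v: "dot Q c v = 0" "L2_set v Q \<le> h" and h: "h \<le> 1 / 2"
  shows "integrable M (\<lambda>\<omega>. y i \<omega> * dot Q v (row i \<omega>))"
    and "expectation (\<lambda>\<omega>. y i \<omega> * dot Q v (row i \<omega>)) \<le> exp (mgf_err K h + \<delta>) - exp (- \<delta>) + trunc_err K \<nu> \<epsilon> \<delta> h"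
proof -
  let ?z = "\<lambda>\<omega>. dot Q v (row i \<omega>)"
  have [measurable]: "?z \<in> borel_measurable M" "\<xi> i \<in> borel_measurable M" using i by measurable
  have f: "\<bar>?z \<omega>\<bar> \<le> 1 * (exp (?z \<omega>) + exp (- ?z \<omega>))" for \<omega>
  proof -
    have "\<bar>?z \<omega>\<bar> \<le> exp \<bar>?z \<omega>\<bar>" using exp_ge_add_one_self[of "\<bar>?z \<omega>\<bar>"] by linarith
    also have "\<dots> \<le> exp (?z \<omega>) + exp (- ?z \<omega>)" by (cases "?z \<omega> \<ge> 0") auto
    finally show ?thesis by simp
  qed
  note b = y_integrable_bound[OF i v h _ f]
  have i1: "integrable M (\<lambda>\<omega>. y i \<omega> * ?z \<omega>)" and i2: "integrable M (\<lambda>\<omega>. (w i \<omega> - y i \<omega>) * ?z \<omega>)"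
    using b by auto
  show "integrable M (\<lambda>\<omega>. y i \<omega> * ?z \<omega>)" by (rule i1)
  have iw: "integrable M (\<lambda>\<omega>. w i \<omega> * ?z \<omega>)"
    using Bochner_Integration.integrable_add[OF i1 i2] by (simp add: algebra_simps)
  have "expectation (\<lambda>\<omega>. w i \<omega> * ?z \<omega>) \<le> expectation (\<lambda>\<omega>. w i \<omega> * exp (?z \<omega>) - w i \<omega>)"
  proof (rule integral_mono[OF iw])
    show "integrable M (\<lambda>\<omega>. w i \<omega> * exp (?z \<omega>) - w i \<omega>)"
      using w_exp(2)[OF i v h] w_integrable[OF i] by auto
    show "w i \<omega> * ?z \<omega> \<le> w i \<omega> * exp (?z \<omega>) - w i \<omega>" for \<omega>
    proof -
      have "w i \<omega> * ?z \<omega> \<le> w i \<omega> * (exp (?z \<omega>) - 1)"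
        using exp_ge_add_one_self[of "?z \<omega>"] by (intro mult_left_mono) (linarith, simp)
      then show ?thesis by (simp add: right_diff_distrib)
    qed
  qed
  also have "\<dots> = expectation (\<lambda>\<omega>. w i \<omega> * exp (?z \<omega>)) - expectation (w i)"
    using w_exp(2)[OF i v h] w_integrable[OF i] by auto
  also have "\<dots> \<le> exp (mgf_err K h + \<delta>) - exp (- \<delta>)"
    using w_exp(1)[OF i v h] w_lower[OF i] by linarith
  finally have 1: "expectation (\<lambda>\<omega>. w i \<omega> * ?z \<omega>) \<le> exp (mgf_err K h + \<delta>) - exp (- \<delta>)" .
  have "\<bar>expectation (\<lambda>\<omega>. (w i \<omega> - y i \<omega>) * ?z \<omega>)\<bar> \<le> expectation (\<lambda>\<omega>. \<bar>(w i \<omega> - y i \<omega>) * ?z \<omega>\<bar>)"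
    by (rule integral_abs_bound)
  also have "\<dots> \<le> trunc_err K \<nu> \<epsilon> \<delta> h" using b(4) by (simp add: trunc_err_def)
  finally have 2: "\<bar>expectation (\<lambda>\<omega>. (w i \<omega> - y i \<omega>) * ?z \<omega>)\<bar> \<le> trunc_err K \<nu> \<epsilon> \<delta> h" .
  have "expectation (\<lambda>\<omega>. y i \<omega> * ?z \<omega>) = expectation (\<lambda>\<omega>. w i \<omega> * ?z \<omega>) - expectation (\<lambda>\<omega>. (w i \<omega> - y i \<omega>) * ?z \<omega>)"
    using iw i2 by (subst Bochner_Integration.integral_diff[symmetric]) (auto simp: algebra_simps)
  then show "expectation (\<lambda>\<omega>. y i \<omega> * ?z \<omega>) \<le> exp (mgf_err K h + \<delta>) - exp (- \<delta>) + trunc_err K \<nu> \<epsilon> \<delta> h"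
    using 1 2 by linarith
qed

text \<open>Since z^2 \<le> 2 exp |z|, the factor beside the weight is at most 2 exp (2 |z|), an
  exponential moment for the doubled vector 2 v; hence h \<le> 1/4.\<close>

lemma y_perp_second:
  assumes i: "i \<in> P" and v: "dot Q c v = 0" "L2_set v Q \<le> h" and h: "h \<le> 1 / 4"
  defines "Z \<equiv> \<lambda>\<omega>. dot Q v (row i \<omega>)"
  shows "integrable M (\<lambda>\<omega>. y i \<omega> * ((Z \<omega>)\<^sup>2 * exp \<bar>Z \<omega>\<bar>))"
    and "expectation (\<lambda>\<omega>. y i \<omega> * ((Z \<omega>)\<^sup>2 * exp \<bar>Z \<omega>\<bar>)) \<le> 4 * exp (mgf_err K (2 * h) + \<delta>)"
proof -
  have [measurable]: "Z \<in> borel_measurable M" "\<xi> i \<in> borel_measurable M" using i unfolding Z_def by measurable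
  have v': "dot Q c (\<lambda>j. 2 * v j) = 0" "L2_set (\<lambda>j. 2 * v j) Q \<le> 2 * h"
    using v unfolding dot_scale_right L2_set_scale by auto
  have eq: "dot Q (\<lambda>j. 2 * v j) (row i \<omega>) = 2 * Z \<omega>" for \<omega> by (simp add: dot_scale_left Z_def)
  have f: "\<bar>(Z \<omega>)\<^sup>2 * exp \<bar>Z \<omega>\<bar>\<bar> \<le> 2 * (exp (dot Q (\<lambda>j. 2 * v j) (row i \<omega>)) + exp (- dot Q (\<lambda>j. 2 * v j) (row i \<omega>)))" for \<omega>
  proof -
    have "(Z \<omega>)\<^sup>2 * exp \<bar>Z \<omega>\<bar> \<le> 2 * exp \<bar>Z \<omega>\<bar> * exp \<bar>Z \<omega>\<bar>"
      using power_le_fact_exp[of "\<bar>Z \<omega>\<bar>" 2] by (intro mult_right_mono) (auto simp: fact_2)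
    also have "\<dots> = 2 * exp (2 * \<bar>Z \<omega>\<bar>)" by (simp add: exp_add[symmetric])
    also have "\<dots> \<le> 2 * (exp (2 * Z \<omega>) + exp (- (2 * Z \<omega>)))"
      by (cases "Z \<omega> \<ge> 0") auto
    finally show ?thesis by (simp add: eq)
  qed
  have h2: "2 * h \<le> 1 / 2" using h by simp
  note b = y_integrable_bound[OF i v' h2 _ f]
  show i1: "integrable M (\<lambda>\<omega>. y i \<omega> * ((Z \<omega>)\<^sup>2 * exp \<bar>Z \<omega>\<bar>))" using b(1) by simp
  have "expectation (\<lambda>\<omega>. y i \<omega> * ((Z \<omega>)\<^sup>2 * exp \<bar>Z \<omega>\<bar>)) \<le> expectation (\<lambda>\<omega>. \<bar>y i \<omega> * ((Z \<omega>)\<^sup>2 * exp \<bar>Z \<omega>\<bar>)\<bar>)"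
    using i1 by (intro integral_mono) auto
  also have "\<dots> \<le> 2 * 2 * exp (mgf_err K (2 * h) + \<delta>)" by (rule b(2)) simp
  finally show "expectation (\<lambda>\<omega>. y i \<omega> * ((Z \<omega>)\<^sup>2 * exp \<bar>Z \<omega>\<bar>)) \<le> 4 * exp (mgf_err K (2 * h) + \<delta>)" by simp
qed

lemma y_mean:
  assumes i: "i \<in> P"
  shows "integrable M (y i)"
    and "expectation (y i) \<ge> exp (- \<delta>) - trunc_err K \<nu> \<epsilon> \<delta> 0" and "expectation (y i) \<le> exp \<delta>"
proof -
  have [measurable]: "\<xi> i \<in> borel_measurable M" using i by measurable
  have h: "(0::real) \<le> 1 / 2" by simp
  note t = w_trunc[OF i zero_perp h] and we = w_exp[OF i zero_perp h]
  have iw: "integrable M (\<lambda>\<omega>. w i \<omega> - y i \<omega>)" using t(2) by (simp add: dot_def)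
  show iy: "integrable M (y i)"
    using Bochner_Integration.integrable_diff[OF w_integrable[OF i] iw] by simp
  have "expectation (\<lambda>\<omega>. w i \<omega> - y i \<omega>) = expectation (w i) - expectation (y i)"
    using iy w_integrable[OF i] by simp
  moreover have "expectation (\<lambda>\<omega>. w i \<omega> - y i \<omega>) \<le> trunc_err K \<nu> \<epsilon> \<delta> 0"
  proof -
    have "dot Q (\<lambda>_. 0) u = 0" for u by (simp add: dot_def)
    then have "expectation (\<lambda>\<omega>. w i \<omega> - y i \<omega>) \<le> 2 * exp (- (\<epsilon>\<^sup>2 * \<nu>\<^sup>2 / 2) + mgf_err K 0 + \<delta>)"
      using t(1) by simp
    also have "\<dots> \<le> trunc_err K \<nu> \<epsilon> \<delta> 0" unfolding trunc_err_def by (intro mult_right_mono) auto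
    finally show ?thesis .
  qed
  ultimately show "expectation (y i) \<ge> exp (- \<delta>) - trunc_err K \<nu> \<epsilon> \<delta> 0" using w_lower[OF i] by linarith
  have "expectation (y i) \<le> expectation (w i)"
    by (rule integral_mono[OF iy w_integrable[OF i]]) (rule tilt_weight_le_exp)
  also have "\<dots> \<le> exp \<delta>" using we(1) by (simp add: dot_def)
  finally show "expectation (y i) \<le> exp \<delta>" .
qed

lemma weighted_sum_tail:
  assumes v: "dot Q c v = 0" "L2_set v Q \<le> h" and h: "0 < h" "h \<le> 1 / 4"
    and b: "exp (mgf_err K h + \<delta>) - exp (- \<delta>) + trunc_err K \<nu> \<epsilon> \<delta> h \<le> b" and \<kappa>: "0 < \<kappa>" "\<kappa> \<le> 1" and \<delta>0: "\<delta> \<ge> 0"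
  shows "prob {\<omega> \<in> space M. (b + \<kappa>) * real (card P) \<le> (\<Sum>i\<in>P. y i \<omega> * dot Q v (row i \<omega>))}
     \<le> exp (- (\<kappa>\<^sup>2 / (4 * exp ((1 / 2 + \<epsilon>) * \<nu>\<^sup>2) * (4 * exp (mgf_err K (2 * h) + \<delta>)))) * real (card P))"
proof (rule bernstein_tail[OF finite_P, where Z = "\<lambda>i \<omega>. dot Q v (row i \<omega>)" and Y = y])
  have "indep_vars (\<lambda>_. borel) (\<lambda>i \<omega>. tilt_weight \<nu> \<epsilon> (dot Q c (\<lambda>j\<in>Q. a i j \<omega>)) * dot Q v (\<lambda>j\<in>Q. a i j \<omega>)) P"
    by (rule row_indep) measurable
  moreover have "dot Q u (\<lambda>j\<in>Q. a i j \<omega>) = dot Q u (row i \<omega>)" for u i \<omega> by (simp add: dot_def)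
  ultimately show "indep_vars (\<lambda>_. borel) (\<lambda>i \<omega>. y i \<omega> * dot Q v (row i \<omega>)) P" by simp
  have "1 \<le> exp (mgf_err K (2 * h) + \<delta>)"
    using h \<delta>0 mgf_const_ge2[of K] by (simp add: mgf_err_def)
  then show "\<kappa> \<le> 2 * (4 * exp (mgf_err K (2 * h) + \<delta>))" using \<kappa> by linarith
qed (use h \<kappa> in \<open>auto intro!: tilt_weight_nonneg tilt_weight_le \<nu> y_perp_mean y_perp_second v order_trans[OF y_perp_mean(2) b]
      measurable_compose[OF _ measurable_tilt_weight]\<close>)

lemma weight_total_tail:
  assumes \<delta>0: "\<delta> \<ge> 0" and b: "exp (- \<delta>) - trunc_err K \<nu> \<epsilon> \<delta> 0 \<ge> 3 / 4"
  shows "prob {\<omega> \<in> space M. (\<Sum>i\<in>P. y i \<omega>) \<le> 1 / 2 * real (card P)}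
     \<le> exp (- (1 / (64 * exp ((1 / 2 + \<epsilon>) * \<nu>\<^sup>2) * exp (1 + \<delta>))) * real (card P))"
proof -
  have "indep_vars (\<lambda>_. borel) (\<lambda>i \<omega>. tilt_weight \<nu> \<epsilon> (dot Q c (\<lambda>j\<in>Q. a i j \<omega>)) * (- 1)) P"
    by (rule row_indep) measurable
  moreover have "dot Q u (\<lambda>j\<in>Q. a i j \<omega>) = dot Q u (row i \<omega>)" for u i \<omega> by (simp add: dot_def)
  ultimately have ind: "indep_vars (\<lambda>_. borel) (\<lambda>i \<omega>. y i \<omega> * (- 1)) P" by simp
  have "1 \<le> exp (1 + \<delta>)" using \<delta>0 by simp
  then have e1: "1 / 4 \<le> 2 * exp (1 + \<delta>)" by linarith
  \<comment> \<open>Bernstein's inequality with Z = -1 turns the lower deviation into an upper one: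
    the mean of -y is at most -3/4, and \<kappa> = 1/4. The factor exp |Z| accounts for V = exp (1 +
    \<delta>).\<close>
  have "prob {\<omega> \<in> space M. (- 3 / 4 + 1 / 4) * real (card P) \<le> (\<Sum>i\<in>P. y i \<omega> * (- 1))}
     \<le> exp (- ((1 / 4)\<^sup>2 / (4 * exp ((1 / 2 + \<epsilon>) * \<nu>\<^sup>2) * exp (1 + \<delta>))) * real (card P))"
  proof (rule bernstein_tail[OF finite_P ind])
    fix i assume i: "i \<in> P"
    show "y i \<in> borel_measurable M" using i by measurable
    show "integrable M (\<lambda>\<omega>. y i \<omega> * - 1)" "integrable M (\<lambda>\<omega>. y i \<omega> * ((- 1)\<^sup>2 * exp \<bar>- 1\<bar>))"
      using y_mean(1)[OF i] by auto
    show "expectation (\<lambda>\<omega>. y i \<omega> * - 1) \<le> - 3 / 4" using y_mean(2)[OF i] b by simp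
    show "expectation (\<lambda>\<omega>. y i \<omega> * ((- 1)\<^sup>2 * exp \<bar>- 1\<bar>)) \<le> exp (1 + \<delta>)"
      using y_mean(3)[OF i] by (simp add: exp_add mult.commute)
  qed (use e1 in \<open>auto intro!: tilt_weight_nonneg tilt_weight_le \<nu>\<close>)
  moreover have "((- 3 / 4 + 1 / 4) * real (card P) \<le> (\<Sum>i\<in>P. y i \<omega> * (- 1)))
      = ((\<Sum>i\<in>P. y i \<omega>) \<le> 1 / 2 * real (card P))" for \<omega>
    by (auto simp: sum_negf)
  moreover have "(1 / 4 :: real)\<^sup>2 / (4 * exp ((1 / 2 + \<epsilon>) * \<nu>\<^sup>2) * exp (1 + \<delta>))
      = 1 / (64 * exp ((1 / 2 + \<epsilon>) * \<nu>\<^sup>2) * exp (1 + \<delta>))"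
    by (simp add: power_divide)
  ultimately show ?thesis by (simp only:)
qed

end

section \<open>Good directions\<close>

text \<open>
  Unlike the support function of the polyhedron, these conditions are visibly measurable jointly in
  the matrix and the direction, so Fubini's theorem applies to them.
\<close>

definition upper_good :: "nat set \<Rightarrow> nat set \<Rightarrow> real \<Rightarrow> real \<Rightarrow> real \<Rightarrow> (nat \<Rightarrow> nat \<Rightarrow> real) \<Rightarrow> (nat \<Rightarrow> real) \<Rightarrow> bool" where
  "upper_good P Q \<nu> \<epsilon> \<beta> X c \<longleftrightarrow>
     (\<forall>\<theta>\<in>lattice_net (1 / 2) Q.
        (\<Sum>i\<in>P. tilt_weight \<nu> \<epsilon> (dot Q c (X i)) * dot Q (\<lambda>j. \<theta> j - dot Q c \<theta> * c j) (X i)) \<le> \<beta> / 4 * real (card P)) \<and>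
     1 / 2 * real (card P) \<le> (\<Sum>i\<in>P. tilt_weight \<nu> \<epsilon> (dot Q c (X i)))"

definition lower_good :: "nat set \<Rightarrow> nat set \<Rightarrow> real \<Rightarrow> real \<Rightarrow> (nat \<Rightarrow> nat \<Rightarrow> real) \<Rightarrow> (nat \<Rightarrow> real) \<Rightarrow> bool" where
  "lower_good P Q T b X c \<longleftrightarrow>
     (\<Sum>i\<in>P. if T < dot Q c (X i) then (dot Q c (X i))\<^sup>2 else 0) \<le> b"

lemma pred_upper_good [measurable]:
  assumes fin: "finite Q" and ne: "Q \<noteq> {}"
    and X: "\<And>i j. i \<in> P \<Longrightarrow> j \<in> Q \<Longrightarrow> (\<lambda>x. X x i j) \<in> borel_measurable N"
    and c: "\<And>j. j \<in> Q \<Longrightarrow> (\<lambda>x. c x j) \<in> borel_measurable N"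
  shows "Measurable.pred N (\<lambda>x. upper_good P Q \<nu> \<epsilon> \<beta> (X x) (c x))"
proof -
  note [measurable] = X c
  have "Measurable.pred N (\<lambda>x. \<forall>\<theta>\<in>lattice_net (1 / 2) Q.
        (\<Sum>i\<in>P. tilt_weight \<nu> \<epsilon> (dot Q (c x) (X x i)) * dot Q (\<lambda>j. \<theta> j - dot Q (c x) \<theta> * c x j) (X x i)) \<le> \<beta> / 4 * real (card P))"
    by (rule pred_intros_finite) (use card_lattice_net(1)[OF fin ne] in \<open>simp, measurable\<close>)
  then show ?thesis unfolding upper_good_def by measurable
qed

lemma pred_lower_good [measurable]:
  assumes X: "\<And>i j. i \<in> P \<Longrightarrow> j \<in> Q \<Longrightarrow> (\<lambda>x. X x i j) \<in> borel_measurable N"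
    and c: "\<And>j. j \<in> Q \<Longrightarrow> (\<lambda>x. c x j) \<in> borel_measurable N"
  shows "Measurable.pred N (\<lambda>x. lower_good P Q T b (X x) (c x))"
proof -
  note [measurable] = X c
  show ?thesis unfolding lower_good_def by measurable
qed

lemma upper_good_imp:
  assumes fin: "finite P" "finite Q" and ne: "P \<noteq> {}" "Q \<noteq> {}"
    and good: "upper_good P Q \<nu> \<epsilon> \<beta> X c" and \<nu>: "\<nu> > 0" and \<epsilon>: "\<epsilon> < 1" and \<beta>: "\<beta> \<ge> 0" and R: "R \<ge> 0"
    and x: "\<And>i. i \<in> P \<Longrightarrow> dot Q x (X i) \<le> 1" "L2_set x Q \<le> R"
  shows "dot Q c x \<le> (1 + \<beta> * R) / ((1 - \<epsilon>) * \<nu>)"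
proof (rule dot_le_of_weights)
  let ?y = "\<lambda>i. tilt_weight \<nu> \<epsilon> (dot Q c (X i))"
  have p: "real (card P) > 0" using fin ne by (simp add: card_gt_0_iff)
  have Y: "1 / 2 * real (card P) \<le> (\<Sum>i\<in>P. ?y i)" using good by (simp add: upper_good_def)
  show "(\<Sum>i\<in>P. ?y i) > 0" using Y p by linarith
  show "(1 - \<epsilon>) * \<nu> \<le> dot Q c (X i)" if "?y i \<noteq> 0" for i
    using that by (auto simp: tilt_weight_def abs_le_iff algebra_simps split: if_splits)
  show "(1 - \<epsilon>) * \<nu> > 0" using \<nu> \<epsilon> by simp
  let ?d = "\<Sum>i\<in>P. ?y i * dot Q c (X i)"
  let ?D = "\<lambda>j. (\<Sum>i\<in>P. ?y i * X i j) - ?d * c j"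
  have "L2_set ?D Q \<le> 2 * (\<beta> / 4 * real (card P))"
  proof (rule L2_set_le_of_net[OF fin(2) ne(2)])
    fix \<theta> assume "\<theta> \<in> lattice_net (1 / 2) Q"
    then have le: "(\<Sum>i\<in>P. ?y i * dot Q (\<lambda>j. \<theta> j - dot Q c \<theta> * c j) (X i)) \<le> \<beta> / 4 * real (card P)"
      using good by (simp add: upper_good_def)
    have "dot Q \<theta> ?D = dot Q \<theta> (\<lambda>j. \<Sum>i\<in>P. ?y i * X i j) - ?d * dot Q c \<theta>"
      unfolding dot_diff_right dot_scale_right by (simp add: dot_commute)
    also have "\<dots> = (\<Sum>i\<in>P. ?y i * dot Q \<theta> (X i)) - dot Q c \<theta> * ?d"
      by (simp add: sum_weighted_dot)
    also have "\<dots> = (\<Sum>i\<in>P. ?y i * dot Q (\<lambda>j. \<theta> j - dot Q c \<theta> * c j) (X i))"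
      unfolding dot_diff_left dot_scale_left
      by (simp add: right_diff_distrib sum_subtractf sum_distrib_left mult_ac)
    finally show "dot Q \<theta> ?D \<le> \<beta> / 4 * real (card P)" using le by simp
  qed
  \<comment> \<open>The factor 1/4 in \<open>upper_good\<close> is spent here: one half compensates
    the factor 2 lost to the net, the other is the lower bound on the average weight.\<close>
  also have "\<dots> = \<beta> * (1 / 2 * real (card P))" by simp
  also have "\<dots> \<le> \<beta> * (\<Sum>i\<in>P. ?y i)" using Y \<beta> by (rule mult_left_mono)
  finally show "L2_set ?D Q \<le> \<beta> * (\<Sum>i\<in>P. ?y i)" .
qed (use x R \<beta> in \<open>auto simp: tilt_weight_nonneg\<close>)

lemma lower_good_imp:
  assumes fin: "finite P" and T: "T > 0" and good: "lower_good P Q T b X c" and b: "b \<le> real k * T\<^sup>2"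
  shows "card {i \<in> P. T < dot Q c (X i)} \<le> k"
    and "(\<Sum>i\<in>{i \<in> P. T < dot Q c (X i)}. (dot Q c (X i))\<^sup>2) \<le> b"
proof -
  let ?B = "{i \<in> P. T < dot Q c (X i)}"
  have "(\<Sum>i\<in>?B. (dot Q c (X i))\<^sup>2) = (\<Sum>i\<in>P. if T < dot Q c (X i) then (dot Q c (X i))\<^sup>2 else 0)"
    using fin by (simp add: sum.inter_filter)
  then show le: "(\<Sum>i\<in>?B. (dot Q c (X i))\<^sup>2) \<le> b" using good by (simp add: lower_good_def)
  have "(\<Sum>i\<in>?B. T\<^sup>2) \<le> (\<Sum>i\<in>?B. (dot Q c (X i))\<^sup>2)"
    using T by (intro sum_mono power_mono) auto
  then have "real (card ?B) * T\<^sup>2 \<le> real k * T\<^sup>2" using le b by simp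
  then show "card ?B \<le> k" using T by simp
qed

lemma (in tilted_rows) upper_good_tail:
  assumes ne: "P \<noteq> {}" "Q \<noteq> {}" and h: "0 < h" "h \<le> 1 / 4" and \<delta>0: "\<delta> \<ge> 0" and \<kappa>: "0 < \<kappa>" "\<kappa> \<le> 1"
    and b: "exp (mgf_err K h + \<delta>) - exp (- \<delta>) + trunc_err K \<nu> \<epsilon> \<delta> h + \<kappa> \<le> h * \<beta> / 4"
    and total: "exp (- \<delta>) - trunc_err K \<nu> \<epsilon> \<delta> 0 \<ge> 3 / 4"
  shows "prob {\<omega> \<in> space M. \<not> upper_good P Q \<nu> \<epsilon> \<beta> (\<lambda>i. row i \<omega>) c}
    \<le> exp (4 * real (card Q) - \<kappa>\<^sup>2 / (4 * exp ((1 / 2 + \<epsilon>) * \<nu>\<^sup>2) * (4 * exp (mgf_err K (2 * h) + \<delta>))) * real (card P))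
      + exp (- (1 / (64 * exp ((1 / 2 + \<epsilon>) * \<nu>\<^sup>2) * exp (1 + \<delta>))) * real (card P))"
proof -
  let ?p = "real (card P)" let ?N = "lattice_net (1 / 2) Q"
  note net = card_lattice_net[OF finite_Q ne(2), of "1 / 2"]
  define e where "e = \<kappa>\<^sup>2 / (4 * exp ((1 / 2 + \<epsilon>) * \<nu>\<^sup>2) * (4 * exp (mgf_err K (2 * h) + \<delta>)))"
  \<comment> \<open>Net points are projected orthogonally to c, where the tilted mean nearly
    vanishes, and scaled by h, since exponential moments are controlled for small vectors
    only.\<close>
  define v where "v \<theta> j = h * (\<theta> j - dot Q c \<theta> * c j)" for \<theta> j
  define B1 where "B1 \<theta> = {\<omega> \<in> space M. h * \<beta> / 4 * ?p \<le> (\<Sum>i\<in>P. y i \<omega> * dot Q (v \<theta>) (row i \<omega>))}" for \<theta>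
  define B2 where "B2 = {\<omega> \<in> space M. (\<Sum>i\<in>P. y i \<omega>) \<le> 1 / 2 * ?p}"
  have m1: "B1 \<theta> \<in> events" for \<theta> unfolding B1_def by measurable
  have m2: "B2 \<in> events" unfolding B2_def by measurable
  have P1: "prob (B1 \<theta>) \<le> exp (- e * ?p)" if \<theta>: "\<theta> \<in> ?N" for \<theta>
  proof -
    have cc: "dot Q c c = 1" by (simp add: dot_self c_unit)
    have perp: "dot Q c (v \<theta>) = 0"
      unfolding v_def dot_scale_right dot_diff_right by (simp add: cc)
    have "(L2_set (\<lambda>j. \<theta> j - dot Q c \<theta> * c j) Q)\<^sup>2 = dot Q \<theta> \<theta> - (dot Q c \<theta>)\<^sup>2"
      unfolding dot_self[symmetric] dot_diff_left dot_diff_right dot_scale_left dot_scale_right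
      by (simp add: cc dot_commute[of Q \<theta> c] power2_eq_square)
    also have "\<dots> \<le> 1\<^sup>2"
    proof -
      have "(L2_set \<theta> Q)\<^sup>2 \<le> 1" using \<theta> by (simp add: lattice_net_def power_le_one)
      then show ?thesis using zero_le_power2[of "dot Q c \<theta>"] unfolding dot_self one_power2 by linarith
    qed
    finally have "L2_set (\<lambda>j. \<theta> j - dot Q c \<theta> * c j) Q \<le> 1" by (rule power2_le_imp_le) simp
    then have vh: "L2_set (v \<theta>) Q \<le> h" unfolding v_def L2_set_scale using h by (simp add: mult_left_le)
    have "prob {\<omega> \<in> space M. (h * \<beta> / 4 - \<kappa> + \<kappa>) * ?p \<le> (\<Sum>i\<in>P. y i \<omega> * dot Q (v \<theta>) (row i \<omega>))} \<le> exp (- e * ?p)"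
      unfolding e_def using b by (intro weighted_sum_tail[OF perp vh h _ \<kappa> \<delta>0]) linarith
    then show ?thesis by (simp add: B1_def)
  qed
  have sub: "{\<omega> \<in> space M. \<not> upper_good P Q \<nu> \<epsilon> \<beta> (\<lambda>i. row i \<omega>) c} \<subseteq> (\<Union>\<theta>\<in>?N. B1 \<theta>) \<union> B2"
  proof
    fix \<omega> assume "\<omega> \<in> {\<omega> \<in> space M. \<not> upper_good P Q \<nu> \<epsilon> \<beta> (\<lambda>i. row i \<omega>) c}"
    then have \<omega>: "\<omega> \<in> space M" and bad: "\<not> upper_good P Q \<nu> \<epsilon> \<beta> (\<lambda>i. row i \<omega>) c" by auto
    show "\<omega> \<in> (\<Union>\<theta>\<in>?N. B1 \<theta>) \<union> B2"
    proof (cases "\<omega> \<in> B2")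
      case False
      then have "1 / 2 * ?p \<le> (\<Sum>i\<in>P. y i \<omega>)" using \<omega> by (simp add: B2_def)
      then obtain \<theta> where \<theta>: "\<theta> \<in> ?N"
        "\<beta> / 4 * ?p < (\<Sum>i\<in>P. y i \<omega> * dot Q (\<lambda>j. \<theta> j - dot Q c \<theta> * c j) (row i \<omega>))"
        using bad by (auto simp: upper_good_def not_le)
      have "(\<Sum>i\<in>P. y i \<omega> * dot Q (v \<theta>) (row i \<omega>)) = h * (\<Sum>i\<in>P. y i \<omega> * dot Q (\<lambda>j. \<theta> j - dot Q c \<theta> * c j) (row i \<omega>))"
        unfolding v_def dot_scale_left by (simp add: sum_distrib_left mult_ac)
      moreover have "h * (\<beta> / 4 * ?p) \<le> \<dots>" using \<theta>(2) h by (intro mult_left_mono) auto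
      ultimately have "\<omega> \<in> B1 \<theta>" using \<omega> by (simp add: B1_def)
      then show ?thesis using \<theta>(1) by blast
    qed simp
  qed
  have "prob {\<omega> \<in> space M. \<not> upper_good P Q \<nu> \<epsilon> \<beta> (\<lambda>i. row i \<omega>) c} \<le> prob ((\<Union>\<theta>\<in>?N. B1 \<theta>) \<union> B2)"
    using net(1) m1 m2 by (intro finite_measure_mono[OF sub] sets.Un sets.finite_UN) auto
  also have "\<dots> \<le> (\<Sum>\<theta>\<in>?N. prob (B1 \<theta>)) + prob B2"
    using net(1) by (intro order_trans[OF measure_Un_le] add_right_mono measure_UNION_le sets.finite_UN m1 m2) auto
  also have "\<dots> \<le> (\<Sum>\<theta>\<in>?N. exp (- e * ?p)) + exp (- (1 / (64 * exp ((1 / 2 + \<epsilon>) * \<nu>\<^sup>2) * exp (1 + \<delta>))) * ?p)"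
    unfolding B2_def by (intro add_mono sum_mono P1 weight_total_tail \<delta>0 total)
  also have "(\<Sum>\<theta>\<in>?N. exp (- e * ?p)) = real (card ?N) * exp (- e * ?p)" by simp
  also have "\<dots> \<le> exp (4 * real (card Q)) * exp (- e * ?p)"
    using net(2) by (intro mult_right_mono) auto
  also have "\<dots> = exp (4 * real (card Q) - e * ?p)" by (simp add: exp_add[symmetric])
  finally show ?thesis by (simp add: e_def)
qed

text \<open>Let s = \<open>sq_rate K\<close> and x > T. As long as s x^2 \<le> 2 T^2, the factor exp
  (T x) is used, whose mean carries the sharp Gaussian constant; beyond that the crude exponential
  square moment already yields exp (- T^2). Both contributions are within constant factors of E,
  almost the Gaussian tail at T, and add up to 5 E.\<close>

lemma (in spread_direction) lower_good_tail:
  assumes T: "T > 0" "T * \<tau> \<le> 1 / 2" "4 * mgf_const K * (T ^ 3 * \<tau>) \<le> 1" and \<epsilon>: "0 < \<epsilon>" "\<epsilon> \<le> 1 / 2"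
  shows "prob {\<omega> \<in> space M. \<not> lower_good P Q T b (\<lambda>i. row i \<omega>) c}
    \<le> exp (5 * real (card P) * exp (- ((1 / 2 - \<epsilon>) * T\<^sup>2)) - sq_rate K * \<epsilon> / 2 * b)"
proof -
  let ?s = "sq_rate K"
  \<comment> \<open>Chosen so that s' x^2 \<le> \<epsilon> T^2 in the moderate regime: having the
    square in the exponent then costs only \<epsilon> T^2.\<close>
  define s' where "s' = ?s * \<epsilon> / 2"
  note s = sq_rate_pos[of K]
  have s': "0 < s'" using s \<epsilon> by (simp add: s'_def)
  define Z where "Z x = (if T < x then x\<^sup>2 else 0)" for x :: real
  have Zm [measurable]: "Z \<in> borel_measurable borel" unfolding Z_def by measurable
  define E where "E = exp (- ((1 / 2 - \<epsilon>) * T\<^sup>2))"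
  have mgf: "(\<integral>\<^sup>+\<omega>. ennreal (exp (s' * Z (\<xi> i \<omega>))) \<partial>M) \<le> ennreal (exp (5 * E))" if i: "i \<in> P" for i
  proof -
    have [measurable]: "\<xi> i \<in> borel_measurable M" using i by measurable
    have pw: "exp (s' * Z x) \<le> 1 + exp (\<epsilon> * T\<^sup>2 - T\<^sup>2) * exp (T * x) + exp (- T\<^sup>2) * exp (?s * x\<^sup>2)" for x
    proof (cases "T < x")
      case False
      then show ?thesis by (simp add: Z_def add_nonneg_nonneg)
    next
      case True
      show ?thesis
      proof (cases "?s * x\<^sup>2 \<le> 2 * T\<^sup>2")
        case small: True
        have "\<epsilon> / 2 * (?s * x\<^sup>2) \<le> \<epsilon> / 2 * (2 * T\<^sup>2)" using small \<epsilon> by (intro mult_left_mono) auto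
        moreover have "T * T \<le> T * x" using True T by (intro mult_left_mono) auto
        ultimately have "s' * x\<^sup>2 \<le> \<epsilon> * T\<^sup>2 - T\<^sup>2 + T * x" by (simp add: s'_def power2_eq_square mult_ac)
        then have "exp (s' * Z x) \<le> exp (\<epsilon> * T\<^sup>2 - T\<^sup>2) * exp (T * x)"
          using True by (simp add: Z_def exp_add[symmetric])
        then show ?thesis by (simp add: add_increasing add_increasing2)
      next
        case False
        have "T\<^sup>2 \<le> (1 - \<epsilon> / 2) * (2 * T\<^sup>2)" using \<epsilon> mult_right_mono[of 1 "(1 - \<epsilon> / 2) * 2" "T\<^sup>2"] by (simp add: algebra_simps)
        also have "\<dots> \<le> (1 - \<epsilon> / 2) * (?s * x\<^sup>2)" using False \<epsilon> by (intro mult_left_mono) auto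
        finally have "s' * x\<^sup>2 \<le> - T\<^sup>2 + ?s * x\<^sup>2" by (simp add: s'_def algebra_simps)
        then have "exp (s' * Z x) \<le> exp (- T\<^sup>2) * exp (?s * x\<^sup>2)"
          using True by (simp add: Z_def exp_add[symmetric])
        then show ?thesis by (simp add: add_increasing add_increasing2)
      qed
    qed
    have "(\<integral>\<^sup>+\<omega>. ennreal (exp (s' * Z (\<xi> i \<omega>))) \<partial>M)
      \<le> (\<integral>\<^sup>+\<omega>. 1 + ennreal (exp (\<epsilon> * T\<^sup>2 - T\<^sup>2)) * ennreal (exp (T * \<xi> i \<omega>)) + ennreal (exp (- T\<^sup>2)) * ennreal (exp (?s * (\<xi> i \<omega>)\<^sup>2)) \<partial>M)"
      using pw by (intro nn_integral_mono) (simp flip: ennreal_mult ennreal_plus ennreal_1)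
    also have "\<dots> = 1 + ennreal (exp (\<epsilon> * T\<^sup>2 - T\<^sup>2)) * (\<integral>\<^sup>+\<omega>. ennreal (exp (T * \<xi> i \<omega>)) \<partial>M)
        + ennreal (exp (- T\<^sup>2)) * (\<integral>\<^sup>+\<omega>. ennreal (exp (?s * (\<xi> i \<omega>)\<^sup>2)) \<partial>M)"
      by (simp add: nn_integral_add nn_integral_cmult emeasure_space_1)
    also have "\<dots> \<le> 1 + ennreal (exp (\<epsilon> * T\<^sup>2 - T\<^sup>2)) * ennreal (exp (T\<^sup>2 / 2 + 1)) + ennreal (exp (- T\<^sup>2)) * 2"
    proof (intro add_mono mult_left_mono order_refl)
      have z: "dot Q c (\<lambda>_. 0) = 0" "L2_set (\<lambda>_. 0) Q \<le> 0" "(0::real) \<le> 1 / 2" by (simp_all add: dot_def L2_set_def)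
      have d0: "dot Q (\<lambda>_. 0) u = 0" for u by (simp add: dot_def)
      have Ta: "\<bar>T\<bar> * \<tau> \<le> 1 / 2" "4 * mgf_const K * (\<bar>T\<bar> ^ 3 * \<tau>) \<le> 1" using T by auto
      note t = tilted_mgf_upper[OF i z(1,2,3) Ta]
      have "(\<integral>\<^sup>+\<omega>. ennreal (exp (T * \<xi> i \<omega>)) \<partial>M) = ennreal (expectation (\<lambda>\<omega>. exp (T * \<xi> i \<omega>)))"
        using t(2) by (intro nn_integral_eq_integral) (simp_all add: d0)
      also have "\<dots> \<le> ennreal (exp (T\<^sup>2 / 2 + 1))"
        using t(1) by (intro ennreal_leI) (simp add: d0 mgf_err_def)
      finally show "(\<integral>\<^sup>+\<omega>. ennreal (exp (T * \<xi> i \<omega>)) \<partial>M) \<le> ennreal (exp (T\<^sup>2 / 2 + 1))" .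
      show "(\<integral>\<^sup>+\<omega>. ennreal (exp (?s * (\<xi> i \<omega>)\<^sup>2)) \<partial>M) \<le> 2"
        by (rule row_exp_square[OF i]) (simp add: c_unit)
    qed auto
    also have "\<dots> = ennreal (1 + exp (\<epsilon> * T\<^sup>2 - T\<^sup>2) * exp (T\<^sup>2 / 2 + 1) + exp (- T\<^sup>2) * 2)"
      by (simp add: ennreal_mult ennreal_plus)
    also have "\<dots> \<le> ennreal (exp (5 * E))"
    proof (intro ennreal_leI)
      have "exp (\<epsilon> * T\<^sup>2 - T\<^sup>2) * exp (T\<^sup>2 / 2 + 1) = exp 1 * E"
        unfolding E_def exp_add[symmetric] by (simp add: algebra_simps)
      also have "\<dots> \<le> 3 * E" using exp_le by (intro mult_right_mono) (auto simp: E_def)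
      finally have 1: "exp (\<epsilon> * T\<^sup>2 - T\<^sup>2) * exp (T\<^sup>2 / 2 + 1) \<le> 3 * E" .
      have "(1 / 2 - \<epsilon>) * T\<^sup>2 \<le> 1 * T\<^sup>2" using \<epsilon> by (intro mult_right_mono) auto
      then have 2: "exp (- T\<^sup>2) \<le> E" by (simp add: E_def)
      show "1 + exp (\<epsilon> * T\<^sup>2 - T\<^sup>2) * exp (T\<^sup>2 / 2 + 1) + exp (- T\<^sup>2) * 2 \<le> exp (5 * E)"
        using 1 2 exp_ge_add_one_self[of "5 * E"] by linarith
    qed
    finally show ?thesis .
  qed
  have "indep_vars (\<lambda>_. borel) (\<lambda>i \<omega>. s' * Z (dot Q c (\<lambda>j\<in>Q. a i j \<omega>))) P"
    by (rule row_indep) measurable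
  moreover have "dot Q u (\<lambda>j\<in>Q. a i j \<omega>) = dot Q u (row i \<omega>)" for u i \<omega> by (simp add: dot_def)
  ultimately have ind: "indep_vars (\<lambda>_. borel) (\<lambda>i \<omega>. s' * Z (\<xi> i \<omega>)) P" by simp
  have "prob {\<omega> \<in> space M. s' * b \<le> (\<Sum>i\<in>P. s' * Z (\<xi> i \<omega>))} \<le> exp (real (card P) * (5 * E) - s' * b)"
    by (rule chernoff_sum[OF finite_P ind mgf])
  moreover have "prob {\<omega> \<in> space M. \<not> lower_good P Q T b (\<lambda>i. row i \<omega>) c} \<le> prob {\<omega> \<in> space M. s' * b \<le> (\<Sum>i\<in>P. s' * Z (\<xi> i \<omega>))}"
  proof (rule finite_measure_mono)
    show "{\<omega> \<in> space M. s' * b \<le> (\<Sum>i\<in>P. s' * Z (\<xi> i \<omega>))} \<in> events" by measurable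
    show "{\<omega> \<in> space M. \<not> lower_good P Q T b (\<lambda>i. row i \<omega>) c} \<subseteq> {\<omega> \<in> space M. s' * b \<le> (\<Sum>i\<in>P. s' * Z (\<xi> i \<omega>))}"
      using s' by (auto simp: lower_good_def Z_def sum_distrib_left[symmetric] not_le)
  qed
  ultimately show ?thesis by (simp add: E_def s'_def mult_ac)
qed

section \<open>The uniform distribution on the sphere\<close>

lemma emeasure_lborel_affine_vimage:
  fixes t r :: real
  assumes r: "r > 0" and A: "A \<in> sets borel"
  shows "emeasure lborel A = ennreal r * emeasure lborel ((\<lambda>x. t + r * x) -` A)"
proof -
  have "emeasure lborel A = emeasure (density (distr lborel borel (\<lambda>x. t + r * x)) (\<lambda>_. ennreal \<bar>r\<bar>)) A"
    using lborel_real_affine[of r t] r by simp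
  also have "\<dots> = ennreal r * emeasure (distr lborel borel (\<lambda>x. t + r * x)) A"
    using r A by (subst emeasure_density) (simp_all add: nn_integral_cmult)
  also have "emeasure (distr lborel borel (\<lambda>x. t + r * x)) A = emeasure lborel ((\<lambda>x. t + r * x) -` A)"
    using A by (subst emeasure_distr) auto
  finally show ?thesis .
qed

text \<open>Uniqueness of the product measure reduces the claim to boxes, where it is the
  one-dimensional substitution in each coordinate.\<close>

lemma emeasure_PiM_lborel_affine:
  fixes a :: "nat \<Rightarrow> real" and n :: nat
  assumes r: "r > 0"
  defines "L \<equiv> \<Pi>\<^sub>M i\<in>{..<n}. (lborel :: real measure)"
  assumes S: "S \<in> sets L"
  shows "emeasure L S = ennreal (r ^ n) * emeasure L ((\<lambda>x. \<lambda>i\<in>{..<n}. a i + r * x i) -` S \<inter> space L)"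
proof -
  interpret product_sigma_finite "\<lambda>_. lborel :: real measure" by standard
  define g where "g = (\<lambda>x. \<lambda>i\<in>{..<n}. a i + r * x i)"
  have g [measurable]: "g \<in> L \<rightarrow>\<^sub>M L" unfolding g_def L_def by measurable
  define P where "P = scale_measure (ennreal (r ^ n)) (distr L L g)"
  have "P = PiM {..<n} (\<lambda>_. lborel)"
  proof (rule PiM_eqI)
    show "sets P = sets (PiM {..<n} (\<lambda>_. lborel))" by (simp add: P_def L_def)
    fix A :: "nat \<Rightarrow> real set" assume "\<And>i. i \<in> {..<n} \<Longrightarrow> A i \<in> sets lborel"
    then have A: "A i \<in> sets borel" if "i < n" for i using that by simp
    have AL: "PiE {..<n} A \<in> sets L" unfolding L_def using A by (intro sets_PiM_I_finite) auto
    have pre: "(\<lambda>x. a i + r * x) -` A i \<in> sets borel" if "i < n" for i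
      using measurable_sets[of "\<lambda>x. a i + r * x" borel borel "A i"] A[OF that] by simp
    have vim: "g -` PiE {..<n} A \<inter> space L = PiE {..<n} (\<lambda>i. (\<lambda>x. a i + r * x) -` A i)"
      unfolding g_def L_def space_PiM by (auto simp: PiE_def Pi_def)
    have "emeasure P (PiE {..<n} A) = ennreal (r ^ n) * emeasure L (PiE {..<n} (\<lambda>i. (\<lambda>x. a i + r * x) -` A i))"
      unfolding P_def using AL by (simp add: emeasure_distr vim)
    also have "\<dots> = ennreal (r ^ n) * (\<Prod>i<n. emeasure lborel ((\<lambda>x. a i + r * x) -` A i))"
      unfolding L_def using pre by (subst emeasure_PiM) auto
    also have "ennreal (r ^ n) = (\<Prod>i<n. ennreal r)" using r by (simp add: ennreal_power)
    also have "(\<Prod>i<n. ennreal r) * (\<Prod>i<n. emeasure lborel ((\<lambda>x. a i + r * x) -` A i))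
        = (\<Prod>i<n. emeasure lborel (A i))"
      unfolding prod.distrib[symmetric] using A
      by (intro prod.cong refl emeasure_lborel_affine_vimage[OF r, symmetric]) auto
    finally show "emeasure P (PiE {..<n} A) = (\<Prod>i\<in>{..<n}. emeasure lborel (A i))" .
  qed simp
  then have "emeasure L S = emeasure P S" by (simp add: L_def)
  also have "\<dots> = ennreal (r ^ n) * emeasure L (g -` S \<inter> space L)"
    unfolding P_def using S by (simp add: emeasure_distr)
  finally show ?thesis by (simp add: g_def)
qed

text \<open>
  The cone over a cap of height \<open>t\<close> lies in the ball of radius \<open>\<surd>(1 - t\<^sup>2)\<close> around the point of height
  \<open>t\<close> on the axis of the cap.
\<close>

lemma sphere_uniform_cap:
  assumes n: "n \<ge> 1" and j: "j < n" and t: "0 < t" "t\<^sup>2 \<le> 1 / 2"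
  shows "emeasure (sphere_uniform n) {c \<in> space (sphere_uniform n). t < \<bar>c j\<bar>} \<le> ennreal (2 * exp (- (real n * t\<^sup>2 / 2)))"
proof -
  let ?L = "\<Pi>\<^sub>M i\<in>{..<n}. (lborel :: real measure)" and ?B = "\<Pi>\<^sub>M i\<in>{..<n}. (borel :: real measure)"
  let ?f = "\<lambda>x. \<lambda>i\<in>{..<n}. x i / L2_set x {..<n}"
  let ?U = "uniform_measure ?L (unit_ball n)"
  let ?vol = "emeasure ?L (unit_ball n)"
  define r where "r = sqrt (1 - t\<^sup>2)"
  have r: "r > 0" "r\<^sup>2 = 1 - t\<^sup>2" using t by (auto simp: r_def)
  define e where "e s i = (if i = j then s else 0 :: real)" for s i
  define S where "S s = {x \<in> space ?L. L2_set (\<lambda>i. x i - e s i) {..<n} \<le> r}" for s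
  have Sm: "S s \<in> sets ?L" for s unfolding S_def L2_set_def by measurable
  have vol: "emeasure ?L (S s) = ennreal (r ^ n) * ?vol" for s
  proof -
    have "(\<lambda>x. \<lambda>i\<in>{..<n}. e s i + r * x i) -` S s \<inter> space ?L = unit_ball n"
    proof -
      have "(\<lambda>x. \<lambda>i\<in>{..<n}. e s i + r * x i) -` S s \<inter> space ?L
          = {x \<in> space ?L. L2_set (\<lambda>i. (\<lambda>i\<in>{..<n}. e s i + r * x i) i - e s i) {..<n} \<le> r}"
        by (auto simp: S_def space_PiM)
      also have "(\<lambda>x. L2_set (\<lambda>i. (\<lambda>i\<in>{..<n}. e s i + r * x i) i - e s i) {..<n}) = (\<lambda>x. r * L2_set x {..<n})"
      proof
        fix x :: "nat \<Rightarrow> real"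
        have "L2_set (\<lambda>i. (\<lambda>i\<in>{..<n}. e s i + r * x i) i - e s i) {..<n} = L2_set (\<lambda>i. r * x i) {..<n}"
          by (rule L2_set_cong[OF refl]) simp
        then show "L2_set (\<lambda>i. (\<lambda>i\<in>{..<n}. e s i + r * x i) i - e s i) {..<n} = r * L2_set x {..<n}"
          using r by (simp add: L2_set_scale)
      qed
      also have "{x \<in> space ?L. r * L2_set x {..<n} \<le> r} = unit_ball n"
        using r by (auto simp: unit_ball_def space_PiM)
      finally show ?thesis .
    qed
    then show ?thesis using emeasure_PiM_lborel_affine[OF r(1) Sm[of s], where a = "e s"] by simp
  qed
  have meas: "{c \<in> space ?B. t < \<bar>c j\<bar>} \<in> sets ?B"
  proof -
    have [measurable]: "(\<lambda>c. c j) \<in> borel_measurable ?B"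
      using j by (intro measurable_component_singleton) simp
    show ?thesis by measurable
  qed
  have sub: "unit_ball n \<inter> (?f -` {c \<in> space ?B. t < \<bar>c j\<bar>} \<inter> space ?L) \<subseteq> S t \<union> S (- t)"
  proof
    fix x assume x: "x \<in> unit_ball n \<inter> (?f -` {c \<in> space ?B. t < \<bar>c j\<bar>} \<inter> space ?L)"
    define s where "s = L2_set x {..<n}"
    have s1: "s \<le> 1" and s0: "0 \<le> s" using x by (auto simp: unit_ball_def s_def)
    have tx: "t < \<bar>x j\<bar> / s" using x j by (auto simp: s_def)
    then have "s \<noteq> 0" using t by auto
    then have spos: "s > 0" using s0 by simp
    then have txs: "t * s < \<bar>x j\<bar>" using tx by (simp add: field_simps)
    define \<sigma> where "\<sigma> = (if x j \<ge> 0 then t else - t)"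
    have "(L2_set (\<lambda>i. x i - e \<sigma> i) {..<n})\<^sup>2 = (\<Sum>i<n. (x i)\<^sup>2 - 2 * x i * e \<sigma> i + (e \<sigma> i)\<^sup>2)"
      by (simp add: L2_set_sq power2_diff algebra_simps)
    also have "\<dots> = s\<^sup>2 - 2 * (\<Sum>i<n. x i * e \<sigma> i) + (\<Sum>i<n. (e \<sigma> i)\<^sup>2)"
      by (simp add: sum.distrib sum_subtractf sum_distrib_left L2_set_sq s_def mult.assoc)
    also have "(\<Sum>i<n. x i * e \<sigma> i) = x j * \<sigma>"
      using j by (simp add: e_def if_distrib[of "\<lambda>y. _ * y"] cong: if_cong)
    also have "(\<Sum>i<n. (e \<sigma> i)\<^sup>2) = \<sigma>\<^sup>2"
      using j by (simp add: e_def if_distrib[of "\<lambda>y. y\<^sup>2"] cong: if_cong)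
    also have "x j * \<sigma> = t * \<bar>x j\<bar>" by (simp add: \<sigma>_def)
    also have "\<sigma>\<^sup>2 = t\<^sup>2" by (simp add: \<sigma>_def)
    \<comment> \<open>Uses s^2 \<le> s on [0, 1] and then the monotonicity of s (1 - 2 t^2), which
      is where t^2 \<le> 1/2 enters.\<close>
    also have "s\<^sup>2 - 2 * (t * \<bar>x j\<bar>) + t\<^sup>2 \<le> r\<^sup>2"
    proof -
      have "t * (t * s) \<le> t * \<bar>x j\<bar>" using txs t by (intro mult_left_mono) auto
      moreover have "s\<^sup>2 \<le> s" using s0 s1 by (simp add: power2_eq_square mult_left_le)
      moreover have "s * (1 - 2 * t\<^sup>2) \<le> 1 * (1 - 2 * t\<^sup>2)" using t s1 by (intro mult_right_mono) auto
      ultimately show ?thesis unfolding r(2) by (simp add: power2_eq_square algebra_simps)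
    qed
    finally have "L2_set (\<lambda>i. x i - e \<sigma> i) {..<n} \<le> r" by (rule power2_le_imp_le) (use r in simp)
    then show "x \<in> S t \<union> S (- t)" using x by (auto simp: S_def \<sigma>_def split: if_splits)
  qed
  have "emeasure (sphere_uniform n) {c \<in> space (sphere_uniform n). t < \<bar>c j\<bar>}
      = emeasure ?U (?f -` {c \<in> space ?B. t < \<bar>c j\<bar>} \<inter> space ?U)"
  proof -
    have "?f \<in> ?U \<rightarrow>\<^sub>M ?B"
      using normalise_measurable by (simp cong: measurable_cong_sets)
    then show ?thesis
      unfolding sphere_uniform_def space_distr by (rule emeasure_distr[OF _ meas])
  qed
  also have "\<dots> = emeasure ?L (unit_ball n \<inter> (?f -` {c \<in> space ?B. t < \<bar>c j\<bar>} \<inter> space ?L)) / ?vol"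
    unfolding space_uniform_measure
    by (rule emeasure_uniform_measure[OF unit_ball_sets measurable_sets[OF normalise_measurable meas]])
  also have "\<dots> \<le> (emeasure ?L (S t) + emeasure ?L (S (- t))) / ?vol"
  proof (rule divide_right_mono_ennreal)
    have "emeasure ?L (unit_ball n \<inter> (?f -` {c \<in> space ?B. t < \<bar>c j\<bar>} \<inter> space ?L)) \<le> emeasure ?L (S t \<union> S (- t))"
      using Sm by (intro emeasure_mono[OF sub]) auto
    also have "\<dots> \<le> emeasure ?L (S t) + emeasure ?L (S (- t))"
      using Sm by (intro emeasure_subadditive) auto
    finally show "emeasure ?L (unit_ball n \<inter> (?f -` {c \<in> space ?B. t < \<bar>c j\<bar>} \<inter> space ?L)) \<le> emeasure ?L (S t) + emeasure ?L (S (- t))" .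
  qed
  also have "\<dots> = ennreal (2 * r ^ n)"
  proof -
    have "emeasure ?L (S t) + emeasure ?L (S (- t)) = ennreal (2 * r ^ n) * ?vol"
      unfolding vol distrib_right[symmetric] using r by (simp flip: ennreal_plus)
    then show ?thesis using emeasure_unit_ball[OF n] by (simp add: ennreal_mult_divide_eq)
  qed
  also have "\<dots> \<le> ennreal (2 * exp (- (real n * t\<^sup>2 / 2)))"
  proof (intro ennreal_leI mult_left_mono)
    have "r\<^sup>2 \<le> (exp (- (t\<^sup>2 / 2)))\<^sup>2"
      using r(2) exp_ge_add_one_self[of "- t\<^sup>2"] by (simp add: exp_double[symmetric] power2_eq_square[of "exp _"] exp_add[symmetric])
    then have "r \<le> exp (- (t\<^sup>2 / 2))" by (rule power2_le_imp_le) simp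
    then have "r ^ n \<le> exp (- (t\<^sup>2 / 2)) ^ n" using r by (intro power_mono) auto
    then show "r ^ n \<le> exp (- (real n * t\<^sup>2 / 2))" by (simp add: exp_of_nat_mult[symmetric])
  qed simp
  finally show ?thesis .
qed

lemma sets_sphere_uniform [measurable_cong]:
  "sets (sphere_uniform n) = sets (\<Pi>\<^sub>M i\<in>{..<n}. (borel :: real measure))"
  by (simp add: sphere_uniform_def)

lemma sphere_uniform_not_spread:
  assumes n: "n \<ge> 1" and t: "0 < t" "t\<^sup>2 \<le> 1 / 2"
  shows "measure (sphere_uniform n) {c \<in> space (sphere_uniform n). \<exists>j<n. t < \<bar>c j\<bar>} \<le> 2 * real n * exp (- (real n * t\<^sup>2 / 2))"
proof -
  let ?S = "sphere_uniform n"
  interpret S: prob_space ?S by (rule prob_space_sphere_uniform[OF n])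
  have m: "{c \<in> space ?S. t < \<bar>c j\<bar>} \<in> sets ?S" if "j < n" for j
  proof -
    have [measurable]: "(\<lambda>c. c j) \<in> borel_measurable ?S"
      unfolding measurable_cong_sets[OF sets_sphere_uniform refl]
      using that by (intro measurable_component_singleton) simp
    show ?thesis by measurable
  qed
  have "measure ?S {c \<in> space ?S. \<exists>j<n. t < \<bar>c j\<bar>} = measure ?S (\<Union>j<n. {c \<in> space ?S. t < \<bar>c j\<bar>})"
    by (rule arg_cong[where f = "measure ?S"]) auto
  also have "\<dots> \<le> (\<Sum>j<n. measure ?S {c \<in> space ?S. t < \<bar>c j\<bar>})"
    using m by (intro measure_UNION_le) auto
  also have "\<dots> \<le> (\<Sum>j<n. 2 * exp (- (real n * t\<^sup>2 / 2)))"
  proof (rule sum_mono)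
    fix j assume "j \<in> {..<n}"
    then have "emeasure ?S {c \<in> space ?S. t < \<bar>c j\<bar>} \<le> ennreal (2 * exp (- (real n * t\<^sup>2 / 2)))"
      using sphere_uniform_cap[OF n _ t] by simp
    then show "measure ?S {c \<in> space ?S. t < \<bar>c j\<bar>} \<le> 2 * exp (- (real n * t\<^sup>2 / 2))"
      by (simp add: S.emeasure_eq_measure)
  qed
  finally show ?thesis by simp
qed

section \<open>Fubini's theorem, and the mean width from good directions\<close>

lemma section_measure_tail:
  assumes "prob_space M" "prob_space S" and G: "G \<in> sets (M \<Otimes>\<^sub>M S)"
    and p: "\<And>c. c \<in> space S \<Longrightarrow> measure M {\<omega> \<in> space M. (\<omega>, c) \<in> G} \<le> p" and p0: "p \<ge> 0" and t: "t > 0"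
  shows "{\<omega> \<in> space M. t < measure S (Pair \<omega> -` G)} \<in> sets M"
    and "measure M {\<omega> \<in> space M. t < measure S (Pair \<omega> -` G)} \<le> p / t"
proof -
  interpret M: prob_space M by fact
  interpret S: prob_space S by fact
  interpret pair_sigma_finite M S ..
  have m [measurable]: "(\<lambda>\<omega>. emeasure S (Pair \<omega> -` G)) \<in> borel_measurable M"
    using G by (rule S.measurable_emeasure_Pair)
  have eq: "(t < measure S (Pair \<omega> -` G)) = (ennreal t < emeasure S (Pair \<omega> -` G))" for \<omega>
    using t by (simp add: S.emeasure_eq_measure ennreal_less_iff)
  show B: "{\<omega> \<in> space M. t < measure S (Pair \<omega> -` G)} \<in> sets M" (is "?B \<in> _")
    unfolding eq by measurable
  have "ennreal t * emeasure M ?B = (\<integral>\<^sup>+\<omega>. ennreal t * indicator ?B \<omega> \<partial>M)"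
    using B by (simp add: nn_integral_cmult_indicator)
  also have "\<dots> \<le> (\<integral>\<^sup>+\<omega>. emeasure S (Pair \<omega> -` G) \<partial>M)"
    by (intro nn_integral_mono) (auto simp: eq split: split_indicator)
  also have "\<dots> = emeasure (M \<Otimes>\<^sub>M S) G" using G by (simp add: S.emeasure_pair_measure_alt)
  also have "\<dots> = (\<integral>\<^sup>+c. emeasure M ((\<lambda>\<omega>. (\<omega>, c)) -` G) \<partial>S)" using G by (rule emeasure_pair_measure_alt2)
  also have "\<dots> \<le> (\<integral>\<^sup>+c. ennreal p \<partial>S)"
  proof (rule nn_integral_mono)
    fix c assume c: "c \<in> space S"
    have "(\<lambda>\<omega>. (\<omega>, c)) -` G = {\<omega> \<in> space M. (\<omega>, c) \<in> G}"
      using sets.sets_into_space[OF G] by (auto simp: space_pair_measure)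
    then show "emeasure M ((\<lambda>\<omega>. (\<omega>, c)) -` G) \<le> ennreal p"
      using p[OF c] by (simp add: M.emeasure_eq_measure ennreal_leI)
  qed
  also have "\<dots> = ennreal p" by (simp add: S.emeasure_space_1)
  finally have "ennreal (t * measure M ?B) \<le> ennreal p"
    using t by (simp add: M.emeasure_eq_measure ennreal_mult)
  then have "t * measure M ?B \<le> p" using p0 by simp
  then show "measure M ?B \<le> p / t" using t by (simp add: field_simps)
qed

lemma unit_sphereD: "c \<in> unit_sphere n \<Longrightarrow> L2_set c {..<n} = 1"
  by (simp add: unit_sphere_def)

text \<open>In a bad unit direction the support function is still at most R by Cauchy-Schwarz, so
  bad directions cost R times their measure.\<close>

lemma mean_width_upper:
  assumes n: "n \<ge> 1" and Bad: "Bad \<in> sets (sphere_uniform n)" and U: "U \<ge> 0" and R: "R \<ge> 0"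
    and up: "\<And>c x. c \<in> unit_sphere n \<Longrightarrow> c \<notin> Bad \<Longrightarrow> x \<in> S \<Longrightarrow> dot {..<n} c x \<le> U"
    and bd: "\<And>x. x \<in> S \<Longrightarrow> L2_set x {..<n} \<le> R"
  shows "mean_width n S \<le> ennreal (2 * (U + R * measure (sphere_uniform n) Bad))"
proof -
  let ?S = "sphere_uniform n"
  interpret S: prob_space ?S by (rule prob_space_sphere_uniform[OF n])
  have "(\<integral>\<^sup>+c. (SUP x\<in>S. ennreal (\<Sum>j<n. c j * x j)) \<partial>?S) \<le> (\<integral>\<^sup>+c. ennreal U + ennreal R * indicator Bad c \<partial>?S)"
  proof (rule nn_integral_mono_AE)
    show "AE c in ?S. (SUP x\<in>S. ennreal (\<Sum>j<n. c j * x j)) \<le> ennreal U + ennreal R * indicator Bad c"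
      using AE_sphere_uniform[OF n]
    proof eventually_elim
      fix c assume c: "c \<in> unit_sphere n"
      show "(SUP x\<in>S. ennreal (\<Sum>j<n. c j * x j)) \<le> ennreal U + ennreal R * indicator Bad c"
      proof (rule SUP_least)
        fix x assume x: "x \<in> S"
        show "ennreal (\<Sum>j<n. c j * x j) \<le> ennreal U + ennreal R * indicator Bad c"
        proof (cases "c \<in> Bad")
          case True
          have "dot {..<n} c x \<le> R"
            using dot_le[of "{..<n}" c x] bd[OF x] unit_sphereD[OF c] by simp
          then show ?thesis using True by (simp add: dot_def ennreal_leI add_increasing)
        next
          case False
          then show ?thesis using up[OF c False x] by (simp add: dot_def ennreal_leI)
        qed
      qed
    qed
  qed
  also have "\<dots> = ennreal (U + R * measure ?S Bad)"
    using Bad U R by (simp add: nn_integral_add nn_integral_cmult_indicator S.emeasure_eq_measure S.prob_space ennreal_mult ennreal_plus)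
  finally have "mean_width n S \<le> 2 * ennreal (U + R * measure ?S Bad)"
    unfolding mean_width_def by (rule mult_left_mono) simp
  also have "\<dots> = ennreal (2 * (U + R * measure ?S Bad))"
    using U R by (simp add: ennreal_mult)
  finally show ?thesis .
qed

text \<open>On \<open>Bad\<close> the integrand is bounded below by 0, as its values lie in
  \<open>ennreal\<close>.\<close>

lemma mean_width_lower:
  assumes n: "n \<ge> 1" and Bad: "Bad \<in> sets (sphere_uniform n)" and l: "l \<ge> 0"
    and low: "\<And>c. c \<in> unit_sphere n \<Longrightarrow> c \<notin> Bad \<Longrightarrow> \<exists>x\<in>S. l \<le> dot {..<n} c x"
  shows "ennreal (2 * (l * (1 - measure (sphere_uniform n) Bad))) \<le> mean_width n S"
proof -
  let ?S = "sphere_uniform n"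
  interpret S: prob_space ?S by (rule prob_space_sphere_uniform[OF n])
  have "ennreal (l * (1 - measure ?S Bad)) = (\<integral>\<^sup>+c. ennreal l * indicator (space ?S - Bad) c \<partial>?S)"
    using Bad l by (simp add: nn_integral_cmult_indicator S.emeasure_eq_measure S.prob_compl ennreal_mult)
  also have "\<dots> \<le> (\<integral>\<^sup>+c. (SUP x\<in>S. ennreal (\<Sum>j<n. c j * x j)) \<partial>?S)"
  proof (rule nn_integral_mono_AE)
    show "AE c in ?S. ennreal l * indicator (space ?S - Bad) c \<le> (SUP x\<in>S. ennreal (\<Sum>j<n. c j * x j))"
      using AE_sphere_uniform[OF n]
    proof eventually_elim
      fix c assume c: "c \<in> unit_sphere n"
      show "ennreal l * indicator (space ?S - Bad) c \<le> (SUP x\<in>S. ennreal (\<Sum>j<n. c j * x j))"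
      proof (cases "c \<in> space ?S - Bad")
        case True
        then obtain x where "x \<in> S" "l \<le> dot {..<n} c x" using low[OF c] by auto
        then have "ennreal l \<le> (SUP x\<in>S. ennreal (\<Sum>j<n. c j * x j))"
          by (intro SUP_upper2[of x]) (auto simp: dot_def ennreal_leI)
        then show ?thesis using True by simp
      qed simp
    qed
  qed
  finally have "2 * ennreal (l * (1 - measure ?S Bad)) \<le> mean_width n S"
    unfolding mean_width_def by (rule mult_left_mono) simp
  moreover have "2 * ennreal (l * (1 - measure ?S Bad)) = ennreal (2 * (l * (1 - measure ?S Bad)))"
    using l by (simp add: ennreal_mult)
  ultimately show ?thesis by simp
qed

section \<open>Asymptotics of the tail bounds\<close>

text \<open>A single term of the binomial expansion of (1 + x)^m \<le> exp (x m), taken at x = j /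
  m.\<close>

lemma binomial_le_exp:
  assumes "1 \<le> j" "j \<le> m"
  shows "real (m choose j) \<le> exp (real j * (1 + ln (real m / real j)))"
proof -
  define x where "x = real j / real m"
  have x: "x > 0" using assms by (simp add: x_def)
  have "real (m choose j) * x ^ j \<le> (\<Sum>i\<le>m. real (m choose i) * x ^ i)"
    using assms x by (intro member_le_sum) auto
  also have "\<dots> = (x + 1) ^ m" by (simp add: binomial_ring)
  also have "\<dots> \<le> exp x ^ m" using x exp_ge_add_one_self[of x] by (intro power_mono) (auto simp: add.commute)
  also have "\<dots> = exp (real j)" using assms by (simp add: exp_of_nat_mult[symmetric] x_def)
  finally have "real (m choose j) \<le> exp (real j) / x ^ j" using x by (simp add: pos_le_divide_eq)
  also have "x ^ j = exp (- (real j * ln (real m / real j)))"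
  proof -
    have "ln x = - ln (real m / real j)" using assms by (simp add: x_def ln_div)
    then have "x = exp (- ln (real m / real j))" using x by (metis exp_ln)
    then have "x ^ j = exp (- ln (real m / real j)) ^ j" by simp
    then show ?thesis by (simp add: exp_of_nat_mult[symmetric])
  qed
  also have "exp (real j) / \<dots> = exp (real j * (1 + ln (real m / real j)))"
    by (simp add: exp_diff[symmetric] algebra_simps)
  finally show ?thesis .
qed

text \<open>The cube leaves room for Markov's inequality at level 1/n: 1/n^3 divided by 1/n is still
  summable.\<close>

lemma eventually_exp_le_inverse_cube:
  assumes "c > 0" "d > 0"
  shows "\<forall>\<^sub>F n in sequentially. C * exp (- c * real n) \<le> d / real n ^ 3"
proof -
  have "(\<lambda>n. C * (real n ^ 3 * exp (- c * real n))) \<longlonglongrightarrow> 0" using assms(1) by real_asymp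
  then have "\<forall>\<^sub>F n in sequentially. C * (real n ^ 3 * exp (- c * real n)) < d"
    using assms(2) by (rule order_tendstoD)
  then show ?thesis using eventually_gt_at_top[of 0]
    by eventually_elim (simp add: field_simps)
qed

text \<open>\<open>exp (mgf_err K h) - 1\<close> is of order h^2, while the right side is linear in
  h. The summand h^2 is reserved for the deviation \<kappa> of
  \<open>upper_good_tail\<close>.\<close>

lemma exists_small_step:
  assumes \<beta>: "\<beta> > 0"
  obtains h where "0 < h" "h \<le> 1 / 4" "exp (mgf_err K h) - 1 + h\<^sup>2 < h * \<beta> / 4"
proof -
  define G where "G = 1 / 2 + mgf_const K"
  have G: "G > 0" using mgf_const_ge2[of K] by (simp add: G_def)
  define h where "h = min (1 / 4) (min (1 / (1 + G)) (\<beta> / (8 * (2 * G + 1))))"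
  have h: "0 < h" "h \<le> 1 / 4" "h \<le> 1 / (1 + G)" "h \<le> \<beta> / (8 * (2 * G + 1))"
    using G \<beta> unfolding h_def by (simp, linarith+)
  have "h ^ 3 * 4 \<le> h\<^sup>2" using h mult_right_mono[of "4 * h" 1 "h\<^sup>2"] by (simp add: power2_eq_square power3_eq_cube)
  then have "mgf_const K * (h ^ 3 * 4) \<le> mgf_const K * h\<^sup>2" using mgf_const_ge2[of K] by (intro mult_left_mono) auto
  then have e: "mgf_err K h \<le> G * h\<^sup>2" by (simp add: mgf_err_def G_def algebra_simps)
  have e0: "0 \<le> mgf_err K h" using h mgf_const_ge2[of K] by (simp add: mgf_err_def)
  have "G * h \<le> 1"
  proof -
    have "G * h \<le> G * (1 / (1 + G))" using h G by (intro mult_left_mono) auto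
    also have "\<dots> \<le> 1" using G by simp
    finally show ?thesis .
  qed
  then have "G * h * h \<le> 1 * 1" using h G by (intro mult_mono) auto
  then have Gh: "G * h\<^sup>2 \<le> 1" by (simp add: power2_eq_square mult.assoc)
  have "exp (mgf_err K h) \<le> 1 + mgf_err K h + (mgf_err K h)\<^sup>2"
    using e0 e Gh by (intro exp_bound) auto
  also have "(mgf_err K h)\<^sup>2 \<le> mgf_err K h" using e0 e Gh by (simp add: power2_eq_square mult_left_le)
  finally have "exp (mgf_err K h) - 1 + h\<^sup>2 \<le> (2 * G + 1) * h\<^sup>2" using e by (simp add: algebra_simps)
  also have "\<dots> = (2 * G + 1) * h * h" by (simp add: power2_eq_square)
  also have "\<dots> \<le> (2 * G + 1) * (\<beta> / (8 * (2 * G + 1))) * h"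
    using h G by (intro mult_right_mono mult_left_mono) auto
  also have "\<dots> = \<beta> / 8 * h" using G by (simp add: field_simps)
  also have "\<dots> < h * \<beta> / 4" using h \<beta> by simp
  finally show ?thesis using h that by blast
qed

lemma polyhedron_dot:
  "x \<in> polyhedron_le_one m n X \<longleftrightarrow> x \<in> {..<n} \<rightarrow>\<^sub>E UNIV \<and> (\<forall>i<m. dot {..<n} x (X i) \<le> 1)"
  by (simp add: polyhedron_le_one_def dot_def mult.commute)

locale random_polyhedra = prob_space M for M :: "'w measure" +
  fixes K :: real and m :: "nat \<Rightarrow> nat" and A :: "nat \<Rightarrow> nat \<Rightarrow> nat \<Rightarrow> 'w \<Rightarrow> real"
  assumes m_pos: "\<And>n. n \<ge> 1 \<Longrightarrow> m n > 0"
    and ratio: "filterlim (\<lambda>n. real (m n) / real n) at_top sequentially"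
    and growth: "(\<lambda>n. ln (real (m n)) powr (3 / 2)) \<in> o(\<lambda>n. sqrt (real n / ln (real n)))"
    and matrix: "\<And>n. n \<ge> 1 \<Longrightarrow> subgaussian_matrix M K {..<m n} {..<n} (A n)"
begin

definition L :: "nat \<Rightarrow> real" where "L n = sqrt (2 * ln (real (m n) / real n))"
text \<open>The factor 6 makes the cap bound exp (- n \<tau>^2 / 2) equal to 1/n^3, so a union over
  n coordinates leaves a measure of order 1/n^2.\<close>

definition \<tau> :: "nat \<Rightarrow> real" where "\<tau> n = sqrt (6 * ln (real n) / real n)"

lemma L_at_top: "filterlim L at_top sequentially"
  unfolding L_def
  by (intro filterlim_compose[OF sqrt_at_top] filterlim_tendsto_pos_mult_at_top[OF tendsto_const]
      filterlim_compose[OF ln_at_top] ratio) auto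

lemma eventually_L_ge: "\<forall>\<^sub>F n in sequentially. C \<le> L n"
  using L_at_top by (simp add: filterlim_at_top)

lemma eventually_ratio_ge: "\<forall>\<^sub>F n in sequentially. C \<le> real (m n) / real n"
  using ratio by (simp add: filterlim_at_top)

lemma eventually_m_eq: "\<forall>\<^sub>F n in sequentially. real (m n) = real n * exp ((L n)\<^sup>2 / 2)"
  using eventually_ratio_ge[of 1] eventually_gt_at_top[of 0]
proof eventually_elim
  case (elim n)
  have "(L n)\<^sup>2 / 2 = ln (real (m n) / real n)" using elim(1) by (simp add: L_def)
  moreover have "exp (ln (real (m n) / real n)) = real (m n) / real n" using elim by (intro exp_ln) linarith
  ultimately show ?case using elim by simp
qed

text \<open>The growth hypothesis enters here: L^3 is at most a constant times ln^(3/2) m, and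
  \<tau> is a constant over sqrt (n / ln n). The product governs all third-order errors.\<close>

lemma L3_\<tau>: "(\<lambda>n. L n ^ 3 * \<tau> n) \<longlonglongrightarrow> 0"
proof -
  let ?f = "\<lambda>n. ln (real (m n)) powr (3 / 2) / sqrt (real n / ln (real n))"
  have f: "?f \<longlonglongrightarrow> 0" using smalloD_tendsto[OF growth] .
  have up: "\<forall>\<^sub>F n in sequentially. L n ^ 3 * \<tau> n \<le> 2 powr (3 / 2) * sqrt 6 * ?f n"
    using eventually_ratio_ge[of 1] eventually_gt_at_top[of 3]
  proof eventually_elim
    case (elim n)
    have N: "1 \<le> real (m n) / real n" "real (m n) / real n \<le> real (m n)"
      using elim by (auto simp: field_simps)
    have l0: "0 \<le> ln (real (m n) / real n)" using N by simp
    have lm: "ln (real (m n) / real n) \<le> ln (real (m n))" using N by (subst ln_le_cancel_iff) auto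
    have ln3: "ln (real n) > 0" using elim by simp
    have "L n ^ 3 = (2 * ln (real (m n) / real n)) powr (3 / 2)"
    proof -
      have "L n ^ 3 = ((2 * ln (real (m n) / real n)) powr (1 / 2)) ^ 3"
        using l0 by (simp add: L_def powr_half_sqrt)
      then show ?thesis
        using powr_power[where z = "2 * ln (real (m n) / real n)" and n = 3 and u = "1 / 2"]
        by (cases "ln (real (m n) / real n) = 0") simp_all
    qed
    also have "\<dots> \<le> (2 * ln (real (m n))) powr (3 / 2)" using l0 lm by (intro powr_mono2) auto
    also have "\<dots> = 2 powr (3 / 2) * ln (real (m n)) powr (3 / 2)" by (rule powr_mult)
    finally have L3: "L n ^ 3 \<le> 2 powr (3 / 2) * ln (real (m n)) powr (3 / 2)" .
    have "\<tau> n = sqrt 6 * (1 / sqrt (real n / ln (real n)))"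
      unfolding \<tau>_def by (simp add: real_sqrt_mult real_sqrt_divide)
    then have "L n ^ 3 * \<tau> n = L n ^ 3 * (sqrt 6 * (1 / sqrt (real n / ln (real n))))" by simp
    also have "\<dots> \<le> 2 powr (3 / 2) * ln (real (m n)) powr (3 / 2) * (sqrt 6 * (1 / sqrt (real n / ln (real n))))"
      using L3 ln3 by (intro mult_right_mono) auto
    also have "\<dots> = 2 powr (3 / 2) * sqrt 6 * ?f n" by simp
    finally show ?case .
  qed
  have low: "\<forall>\<^sub>F n in sequentially. 0 \<le> L n ^ 3 * \<tau> n"
    using eventually_L_ge[of 0] eventually_gt_at_top[of 1]
    by eventually_elim (auto simp: \<tau>_def)
  have "(\<lambda>n. 2 powr (3 / 2) * sqrt 6 * ?f n) \<longlonglongrightarrow> 2 powr (3 / 2) * sqrt 6 * 0"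
    by (intro tendsto_mult tendsto_const f)
  then show ?thesis by (intro tendsto_sandwich[OF low up tendsto_const]) simp
qed

lemma \<tau>_nonneg: "n \<ge> 1 \<Longrightarrow> \<tau> n \<ge> 0"
  by (simp add: \<tau>_def)

lemma L_\<tau>: "(\<lambda>n. L n * \<tau> n) \<longlonglongrightarrow> 0"
proof (rule tendsto_sandwich[OF _ _ tendsto_const L3_\<tau>])
  show "\<forall>\<^sub>F n in sequentially. 0 \<le> L n * \<tau> n"
    using eventually_L_ge[of 0] eventually_ge_at_top[of 1] by eventually_elim (intro mult_nonneg_nonneg \<tau>_nonneg)
  show "\<forall>\<^sub>F n in sequentially. L n * \<tau> n \<le> L n ^ 3 * \<tau> n"
    using eventually_L_ge[of 1] eventually_ge_at_top[of 1]
  proof eventually_elim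
    case (elim n)
    have "L n ^ 1 \<le> L n ^ 3" using elim by (intro power_increasing) auto
    then show ?case using \<tau>_nonneg[of n] elim by (intro mult_right_mono) auto
  qed
qed

text \<open>(L^3 \<tau>)^2 = 6 L^6 ln n / n dominates L^2 / n. The limit makes failing directions
  negligible and lets \<open>sparsity\<close> tend to infinity.\<close>

lemma L2_over_n: "(\<lambda>n. (L n)\<^sup>2 / real n) \<longlonglongrightarrow> 0"
proof (rule tendsto_sandwich[OF _ _ tendsto_const])
  show "(\<lambda>n. (L n ^ 3 * \<tau> n)\<^sup>2) \<longlonglongrightarrow> 0" using tendsto_power[OF L3_\<tau>, of 2] by simp
  show "\<forall>\<^sub>F n in sequentially. (L n)\<^sup>2 / real n \<le> (L n ^ 3 * \<tau> n)\<^sup>2"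
    using eventually_L_ge[of 1] eventually_gt_at_top[of 3]
  proof eventually_elim
    case (elim n)
    have "ln 2 < ln (real n)" using elim by (subst ln_less_cancel_iff) auto
    then have ln1: "1 / 2 \<le> ln (real n)" using ln2_ge_two_thirds by linarith
    have "(L n)\<^sup>2 * (1 / real n) \<le> (L n) ^ 6 * (6 * ln (real n) / real n)"
      using elim ln1 by (intro mult_mono power_increasing divide_right_mono) auto
    also have "\<dots> = (L n ^ 3 * \<tau> n)\<^sup>2"
      using elim ln1 by (simp add: \<tau>_def power_mult_distrib flip: power_mult)
    finally show ?case by simp
  qed
qed simp

definition spread :: "nat \<Rightarrow> (nat \<Rightarrow> real) \<Rightarrow> bool" where
  "spread n c \<longleftrightarrow> L2_set c {..<n} = 1 \<and> (\<forall>j<n. \<bar>c j\<bar> \<le> \<tau> n)"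

abbreviation X :: "nat \<Rightarrow> 'w \<Rightarrow> nat \<Rightarrow> nat \<Rightarrow> real" where
  "X n \<omega> \<equiv> (\<lambda>i j. A n i j \<omega>)"

lemma upper_tail_eventually:
  assumes \<epsilon>: "0 < \<epsilon>" "\<epsilon> \<le> 1 / 4" and \<beta>: "\<beta> > 0"
  shows "\<forall>\<^sub>F n in sequentially. \<forall>c. spread n c \<longrightarrow>
    prob {\<omega> \<in> space M. \<not> upper_good {..<m n} {..<n} ((1 - \<epsilon>) * L n) \<epsilon> \<beta> (X n \<omega>) c} \<le> 1 / 2 / real n ^ 3"
proof -
  define H where "H = mgf_const K"
  define G where "G = mgf_lower_const K"
  have HG: "H \<ge> 2" "G \<ge> 0" using mgf_const_ge2[of K] by (auto simp: H_def G_def mgf_lower_const_def)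
  obtain h where h: "0 < h" "h \<le> 1 / 4" "exp (mgf_err K h) - 1 + h\<^sup>2 < h * \<beta> / 4"
    using exists_small_step[OF \<beta>] by blast
  define \<nu> where "\<nu> n = (1 - \<epsilon>) * L n" for n
  define \<delta> where "\<delta> n = (32 * H + G) * (\<nu> n ^ 3 * \<tau> n)" for n
  have \<delta>0: "\<delta> \<longlonglongrightarrow> 0"
  proof -
    have "(\<lambda>n. (32 * H + G) * (1 - \<epsilon>) ^ 3 * (L n ^ 3 * \<tau> n)) \<longlonglongrightarrow> (32 * H + G) * (1 - \<epsilon>) ^ 3 * 0"
      by (intro tendsto_mult tendsto_const L3_\<tau>)
    then show ?thesis by (simp add: \<delta>_def[abs_def] \<nu>_def power_mult_distrib mult_ac)
  qed
  have \<nu>_top: "filterlim \<nu> at_top sequentially"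
    unfolding \<nu>_def using \<epsilon> by (intro filterlim_tendsto_pos_mult_at_top[OF tendsto_const _ L_at_top]) auto
  have trunc: "(\<lambda>n. trunc_err K (\<nu> n) \<epsilon> (\<delta> n) h') \<longlonglongrightarrow> 0" for h'
  proof -
    have "filterlim (\<lambda>n. \<epsilon>\<^sup>2 / 2 * (\<nu> n)\<^sup>2) at_top sequentially"
      using \<epsilon> by (intro filterlim_tendsto_pos_mult_at_top[OF tendsto_const] filterlim_pow_at_top \<nu>_top) auto
    then have "filterlim (\<lambda>n. - (\<epsilon>\<^sup>2 / 2 * (\<nu> n)\<^sup>2)) at_bot sequentially"
      by (simp add: filterlim_uminus_at_top)
    then have "(\<lambda>n. exp (- (\<epsilon>\<^sup>2 / 2 * (\<nu> n)\<^sup>2))) \<longlonglongrightarrow> 0"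
      by (rule filterlim_compose[OF exp_at_bot])
    then have "(\<lambda>n. 4 * (exp (- (\<epsilon>\<^sup>2 / 2 * (\<nu> n)\<^sup>2)) * exp (mgf_err K h' + \<delta> n))) \<longlonglongrightarrow> 4 * (0 * exp (mgf_err K h' + 0))"
      by (intro tendsto_mult tendsto_const tendsto_exp tendsto_add \<delta>0)
    then show ?thesis by (simp add: trunc_err_def exp_add[symmetric] algebra_simps)
  qed
  have "(\<lambda>n. exp (mgf_err K h + \<delta> n) - exp (- \<delta> n) + trunc_err K (\<nu> n) \<epsilon> (\<delta> n) h + h\<^sup>2)
      \<longlonglongrightarrow> exp (mgf_err K h + 0) - exp (- 0) + 0 + h\<^sup>2"
    by (intro tendsto_add tendsto_diff tendsto_exp tendsto_minus tendsto_const \<delta>0 trunc)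
  then have ev1: "\<forall>\<^sub>F n in sequentially. exp (mgf_err K h + \<delta> n) - exp (- \<delta> n) + trunc_err K (\<nu> n) \<epsilon> (\<delta> n) h + h\<^sup>2 < h * \<beta> / 4"
    using h(3) by (intro order_tendstoD) auto
  have "(\<lambda>n. exp (- \<delta> n) - trunc_err K (\<nu> n) \<epsilon> (\<delta> n) 0) \<longlonglongrightarrow> exp (- 0) - 0"
    by (intro tendsto_diff tendsto_exp tendsto_minus \<delta>0 trunc)
  then have ev2: "\<forall>\<^sub>F n in sequentially. 3 / 4 < exp (- \<delta> n) - trunc_err K (\<nu> n) \<epsilon> (\<delta> n) 0"
    by (rule order_tendstoD) simp
  have "(\<lambda>n. L n * \<tau> n * (2 * H)) \<longlonglongrightarrow> 0 * (2 * H)" by (intro tendsto_mult tendsto_const L_\<tau>)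
  then have ev3: "\<forall>\<^sub>F n in sequentially. L n * \<tau> n * (2 * H) < 1 / 2" by (rule order_tendstoD) simp
  have ev4: "\<forall>\<^sub>F n in sequentially. \<delta> n < 1" using \<delta>0 by (rule order_tendstoD) simp
  \<comment> \<open>For \<nu> = (1 - \<epsilon>) L one has (1/2 + \<epsilon>) \<nu>^2 = L^2 / 2 -
    (e0 / 2) L^2, so the largest weight is below m/n by the factor exp ((e0 / 2) L^2).\<close>
  define e0 where "e0 = 3 * \<epsilon>\<^sup>2 - 2 * \<epsilon> ^ 3"
  have e0: "e0 > 0"
  proof -
    have "2 * \<epsilon> * \<epsilon>\<^sup>2 \<le> 1 * \<epsilon>\<^sup>2" using \<epsilon> by (intro mult_right_mono) auto
    then show ?thesis using \<epsilon> zero_less_power[of \<epsilon> 2] unfolding e0_def power3_eq_cube power2_eq_square by linarith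
  qed
  have "filterlim (\<lambda>n. exp (e0 / 2 * (L n)\<^sup>2)) at_top sequentially"
    using e0 by (intro filterlim_compose[OF exp_at_top] filterlim_tendsto_pos_mult_at_top[OF tendsto_const] filterlim_pow_at_top L_at_top) auto
  then have big: "\<forall>\<^sub>F n in sequentially. C \<le> exp (e0 / 2 * (L n)\<^sup>2)" for C by (simp add: filterlim_at_top)
  \<comment> \<open>Once exp ((e0 / 2) L^2) exceeds \<open>C1\<close>, Bernstein's exponent is at
    least 5 n: the net takes 4 n, and n remains.\<close>
  define C1 where "C1 = 4 * (4 * exp (mgf_err K (2 * h) + 1)) * 5 / (h\<^sup>2)\<^sup>2"
  define C2 where "C2 = 64 * exp (1 + 1 :: real)"
  have exp_small: "\<forall>\<^sub>F n in sequentially. 2 * exp (- 1 * real n) \<le> 1 / 2 / real n ^ 3"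
    by (rule eventually_exp_le_inverse_cube) auto
  show ?thesis
    using ev1 ev2 ev3 ev4 big[of C1] big[of C2] exp_small eventually_L_ge[of 1] eventually_ge_at_top[of 1] eventually_m_eq
  proof eventually_elim
    case (elim n)
    have n: "n \<ge> 1" using elim by simp
    interpret subgaussian_matrix M K "{..<m n}" "{..<n}" "A n" by (rule matrix[OF n])
    have \<nu>: "\<nu> n > 0" "\<nu> n \<le> L n" using elim \<epsilon> by (auto simp: \<nu>_def mult_left_le_one_le)
    have \<nu>3: "0 \<le> \<nu> n ^ 3 * \<tau> n" using \<nu> \<tau>_nonneg[OF n] by simp
    have \<delta>n: "\<delta> n \<ge> 0" using \<nu>3 HG by (simp add: \<delta>_def)
    show ?case
    proof (intro allI impI)
      fix c assume c: "spread n c"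
      interpret T: tilted_rows M K "{..<m n}" "{..<n}" "A n" c "\<tau> n" "\<nu> n" \<epsilon> "\<delta> n"
      proof unfold_locales
        show "L2_set c {..<n} = 1" "\<And>j. j \<in> {..<n} \<Longrightarrow> \<bar>c j\<bar> \<le> \<tau> n" using c by (auto simp: spread_def)
        show "\<tau> n \<ge> 0" by (rule \<tau>_nonneg[OF n])
        have "\<nu> n * \<tau> n * (2 * H) \<le> L n * \<tau> n * (2 * H)"
          using \<nu> \<tau>_nonneg[OF n] HG by (intro mult_right_mono) auto
        then show "2 * \<nu> n * \<tau> n * mgf_const K \<le> 1 / 2" using elim(3) by (simp add: H_def mult_ac)
        show "32 * mgf_const K * (\<nu> n ^ 3 * \<tau> n) \<le> \<delta> n" "mgf_lower_const K * (\<nu> n ^ 3 * \<tau> n) \<le> \<delta> n"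
          unfolding \<delta>_def H_def[symmetric] G_def[symmetric] using \<nu>3 HG by (intro mult_right_mono; simp)+
      qed (use \<nu> \<epsilon> in auto)
      have ne: "{..<m n} \<noteq> {}" "{..<n} \<noteq> {}" using n m_pos[OF n] by (auto simp: lessThan_empty_iff)
      define E where "E = exp ((1 / 2 + \<epsilon>) * (\<nu> n)\<^sup>2)"
      have E0: "E > 0" by (simp add: E_def)
      have mE: "real (m n) / E = real n * exp (e0 / 2 * (L n)\<^sup>2)"
      proof -
        have "real (m n) / E = real n * exp ((L n)\<^sup>2 / 2 - (1 / 2 + \<epsilon>) * (\<nu> n)\<^sup>2)"
          unfolding E_def elim(10) by (simp add: exp_diff)
        also have "(L n)\<^sup>2 / 2 - (1 / 2 + \<epsilon>) * (\<nu> n)\<^sup>2 = e0 / 2 * (L n)\<^sup>2"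
          by (simp add: \<nu>_def e0_def power2_eq_square power3_eq_cube field_simps)
        finally show ?thesis .
      qed
      have "prob {\<omega> \<in> space M. \<not> upper_good {..<m n} {..<n} (\<nu> n) \<epsilon> \<beta> (X n \<omega>) c}
        \<le> exp (4 * real (card {..<n}) - (h\<^sup>2)\<^sup>2 / (4 * E * (4 * exp (mgf_err K (2 * h) + \<delta> n))) * real (card {..<m n}))
          + exp (- (1 / (64 * E * exp (1 + \<delta> n))) * real (card {..<m n}))"
        unfolding E_def using h elim(1,2)
        by (intro T.upper_good_tail ne h(1,2) \<delta>n) (auto simp: power_le_one)
      also have "\<dots> \<le> exp (- 1 * real n) + exp (- 1 * real n)"
      proof (intro add_mono)
        let ?D = "4 * (4 * exp (mgf_err K (2 * h) + \<delta> n))"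
        have "5 * ?D \<le> (h\<^sup>2)\<^sup>2 * C1"
        proof -
          have "?D \<le> 4 * (4 * exp (mgf_err K (2 * h) + 1))" using elim(4) by simp
          then show ?thesis using h by (simp add: C1_def)
        qed
        also have "\<dots> \<le> (h\<^sup>2)\<^sup>2 * exp (e0 / 2 * (L n)\<^sup>2)" using elim(5) by (intro mult_left_mono) auto
        finally have "5 \<le> (h\<^sup>2)\<^sup>2 * exp (e0 / 2 * (L n)\<^sup>2) / ?D" by (simp add: pos_le_divide_eq)
        then have "5 * real n \<le> (h\<^sup>2)\<^sup>2 * exp (e0 / 2 * (L n)\<^sup>2) / ?D * real n" by (rule mult_right_mono) simp
        also have "\<dots> = (h\<^sup>2)\<^sup>2 / ?D * (real (m n) / E)" unfolding mE by simp
        also have "\<dots> = (h\<^sup>2)\<^sup>2 / (4 * E * (4 * exp (mgf_err K (2 * h) + \<delta> n))) * real (card {..<m n})"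
          using E0 by (simp add: mult_ac)
        finally show "exp (4 * real (card {..<n}) - (h\<^sup>2)\<^sup>2 / (4 * E * (4 * exp (mgf_err K (2 * h) + \<delta> n))) * real (card {..<m n})) \<le> exp (- 1 * real n)"
          by simp
        have "64 * exp (1 + \<delta> n) \<le> C2" using elim(4) by (simp add: C2_def)
        also have "\<dots> \<le> exp (e0 / 2 * (L n)\<^sup>2)" by (rule elim(6))
        finally have "1 \<le> exp (e0 / 2 * (L n)\<^sup>2) / (64 * exp (1 + \<delta> n))" by simp
        then have "1 * real n \<le> exp (e0 / 2 * (L n)\<^sup>2) / (64 * exp (1 + \<delta> n)) * real n" by (rule mult_right_mono) simp
        also have "\<dots> = 1 / (64 * exp (1 + \<delta> n)) * (real (m n) / E)" unfolding mE by simp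
        also have "\<dots> = 1 / (64 * E * exp (1 + \<delta> n)) * real (card {..<m n})" by (simp add: mult_ac)
        finally show "exp (- (1 / (64 * E * exp (1 + \<delta> n))) * real (card {..<m n})) \<le> exp (- 1 * real n)" by simp
      qed
      also have "\<dots> \<le> 1 / 2 / real n ^ 3" using elim(7) by simp
      finally show "prob {\<omega> \<in> space M. \<not> upper_good {..<m n} {..<n} ((1 - \<epsilon>) * L n) \<epsilon> \<beta> (X n \<omega>) c} \<le> 1 / 2 / real n ^ 3"
        by (simp add: \<nu>_def)
    qed
  qed
qed

lemma lower_tail_eventually:
  assumes \<epsilon>: "0 < \<epsilon>" "\<epsilon> \<le> 1 / 4" and d: "d > 0"
  shows "\<forall>\<^sub>F n in sequentially. \<forall>c. spread n c \<longrightarrow>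
    prob {\<omega> \<in> space M. \<not> lower_good {..<m n} {..<n} ((1 + \<epsilon>) * L n) (d * real n) (X n \<omega>) c} \<le> 1 / 2 / real n ^ 3"
proof -
  define r where "r = sq_rate K * (\<epsilon> / 4) / 2 * d"
  have r: "r > 0" using sq_rate_pos[of K] \<epsilon> d by (simp add: r_def)
  define T where "T n = (1 + \<epsilon>) * L n" for n
  have "(\<lambda>n. L n * \<tau> n * (1 + \<epsilon>)) \<longlonglongrightarrow> 0 * (1 + \<epsilon>)" by (intro tendsto_mult tendsto_const L_\<tau>)
  then have ev1: "\<forall>\<^sub>F n in sequentially. L n * \<tau> n * (1 + \<epsilon>) < 1 / 2" by (rule order_tendstoD) simp
  have "(\<lambda>n. 4 * mgf_const K * (1 + \<epsilon>) ^ 3 * (L n ^ 3 * \<tau> n)) \<longlonglongrightarrow> 4 * mgf_const K * (1 + \<epsilon>) ^ 3 * 0"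
    by (intro tendsto_mult tendsto_const L3_\<tau>)
  then have ev2: "\<forall>\<^sub>F n in sequentially. 4 * mgf_const K * (1 + \<epsilon>) ^ 3 * (L n ^ 3 * \<tau> n) < 1" by (rule order_tendstoD) simp
  have "filterlim (\<lambda>n. \<epsilon> / 2 * (L n)\<^sup>2) at_top sequentially"
    using \<epsilon> by (intro filterlim_tendsto_pos_mult_at_top[OF tendsto_const] filterlim_pow_at_top L_at_top) auto
  then have "filterlim (\<lambda>n. - (\<epsilon> / 2 * (L n)\<^sup>2)) at_bot sequentially" by (simp add: filterlim_uminus_at_top)
  then have "(\<lambda>n. exp (- (\<epsilon> / 2 * (L n)\<^sup>2))) \<longlonglongrightarrow> 0" by (rule filterlim_compose[OF exp_at_bot])
  then have ev3: "\<forall>\<^sub>F n in sequentially. exp (- (\<epsilon> / 2 * (L n)\<^sup>2)) < r / 10" using r by (intro order_tendstoD) auto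
  have exp_small: "\<forall>\<^sub>F n in sequentially. 1 * exp (- (r / 2) * real n) \<le> 1 / 2 / real n ^ 3"
    using r by (intro eventually_exp_le_inverse_cube) auto
  show ?thesis
    using ev1 ev2 ev3 exp_small eventually_L_ge[of 1] eventually_ge_at_top[of 1] eventually_m_eq
  proof eventually_elim
    case (elim n)
    have n: "n \<ge> 1" using elim by simp
    interpret subgaussian_matrix M K "{..<m n}" "{..<n}" "A n" by (rule matrix[OF n])
    show ?case
    proof (intro allI impI)
      fix c assume c: "spread n c"
      interpret S: spread_direction M K "{..<m n}" "{..<n}" "A n" c "\<tau> n"
        by unfold_locales (use c \<tau>_nonneg[OF n] in \<open>auto simp: spread_def\<close>)
      have "prob {\<omega> \<in> space M. \<not> lower_good {..<m n} {..<n} (T n) (d * real n) (X n \<omega>) c}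
        \<le> exp (5 * real (card {..<m n}) * exp (- ((1 / 2 - \<epsilon> / 4) * (T n)\<^sup>2)) - sq_rate K * (\<epsilon> / 4) / 2 * (d * real n))"
      proof (rule S.lower_good_tail)
        show "T n > 0" using elim \<epsilon> by (simp add: T_def)
        show "T n * \<tau> n \<le> 1 / 2" using elim(1) by (simp add: T_def mult_ac)
        show "4 * mgf_const K * (T n ^ 3 * \<tau> n) \<le> 1" using elim(2) by (simp add: T_def power_mult_distrib mult_ac)
      qed (use \<epsilon> in auto)
      also have "\<dots> \<le> exp (- (r / 2) * real n)"
      proof -
        \<comment> \<open>Raising the threshold to (1 + \<epsilon>) L gains more in the exponent
          than the loss \<epsilon> / 4 in \<open>lower_good_tail\<close>, which is why that lemma is
          applied with \<epsilon> / 4. So m times the tail is at most n exp (- \<epsilon> L^2 / 2),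
          a vanishing multiple of n.\<close>
        have q: "(1 / 2 + \<epsilon> / 2) \<le> (1 / 2 - \<epsilon> / 4) * (1 + \<epsilon>)\<^sup>2"
        proof -
          have "(1 / 2 - \<epsilon> / 4) * (1 + \<epsilon>)\<^sup>2 - (1 / 2 + \<epsilon> / 2) = \<epsilon> * (1 - \<epsilon>\<^sup>2) / 4"
            by (simp add: power2_eq_square field_simps)
          moreover have "0 \<le> \<epsilon> * (1 - \<epsilon>\<^sup>2) / 4" using \<epsilon> by (simp add: power_le_one)
          ultimately show ?thesis by linarith
        qed
        have "(L n)\<^sup>2 / 2 + - ((1 / 2 - \<epsilon> / 4) * (T n)\<^sup>2) \<le> - (\<epsilon> / 2 * (L n)\<^sup>2)"
        proof -
          have "(1 / 2 - \<epsilon> / 4) * (T n)\<^sup>2 = (1 / 2 - \<epsilon> / 4) * (1 + \<epsilon>)\<^sup>2 * (L n)\<^sup>2"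
            by (simp add: T_def power_mult_distrib)
          moreover have "(1 / 2 + \<epsilon> / 2) * (L n)\<^sup>2 = (L n)\<^sup>2 / 2 + \<epsilon> / 2 * (L n)\<^sup>2"
            by (simp add: distrib_right)
          moreover have "(1 / 2 + \<epsilon> / 2) * (L n)\<^sup>2 \<le> (1 / 2 - \<epsilon> / 4) * (1 + \<epsilon>)\<^sup>2 * (L n)\<^sup>2"
            using q by (rule mult_right_mono) simp
          ultimately show ?thesis by linarith
        qed
        then have "exp ((L n)\<^sup>2 / 2) * exp (- ((1 / 2 - \<epsilon> / 4) * (T n)\<^sup>2)) \<le> exp (- (\<epsilon> / 2 * (L n)\<^sup>2))"
          by (simp add: exp_add[symmetric])
        also have "\<dots> \<le> r / 10" using elim(3) by simp
        finally have "5 * real n * (exp ((L n)\<^sup>2 / 2) * exp (- ((1 / 2 - \<epsilon> / 4) * (T n)\<^sup>2))) \<le> 5 * real n * (r / 10)"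
          by (rule mult_left_mono) simp
        then have "5 * real (card {..<m n}) * exp (- ((1 / 2 - \<epsilon> / 4) * (T n)\<^sup>2)) \<le> r / 2 * real n"
          using elim(7) by (simp add: mult_ac)
        moreover have "sq_rate K * (\<epsilon> / 4) / 2 * (d * real n) = r * real n" by (simp add: r_def)
        ultimately show ?thesis unfolding exp_le_cancel_iff by linarith
      qed
      also have "\<dots> \<le> 1 / 2 / real n ^ 3" using elim(4) by simp
      finally show "prob {\<omega> \<in> space M. \<not> lower_good {..<m n} {..<n} ((1 + \<epsilon>) * L n) (d * real n) (X n \<omega>) c} \<le> 1 / 2 / real n ^ 3"
        by (simp add: T_def)
    qed
  qed
qed

end

section \<open>Points of the polyhedron in good directions\<close>

context random_polyhedra
begin

lemma bounded_event_eventually: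
  "\<forall>\<^sub>F n in sequentially. \<exists>B\<in>events. prob B \<le> 1 / real n ^ 3 \<and>
     (\<forall>\<omega> x. \<omega> \<in> space M - B \<longrightarrow> x \<in> polyhedron_le_one (m n) n (X n \<omega>) \<longrightarrow>
        L2_set x {..<n} \<le> 1536 / sq_rate K)"
proof -
  let ?s = "sq_rate K"
  note s = sq_rate_pos[of K]
  define c1 where "c1 = ?s\<^sup>2 / 9216"
  define C where "C = 2 + 1536 / ?s\<^sup>2"
  define \<kappa> where "\<kappa> = ?s / 384"
  have c1: "c1 > 0" and \<kappa>: "\<kappa> > 0" using s by (auto simp: c1_def \<kappa>_def)
  have e: "\<forall>\<^sub>F n in sequentially. 3 * exp (- 1 * real n) \<le> 1 / real n ^ 3"
    by (rule eventually_exp_le_inverse_cube) auto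
  show ?thesis
    using e eventually_ratio_ge[of "(C + 1) / c1"] eventually_ratio_ge[of "2 / (?s * (\<kappa> / 2)\<^sup>2)"] eventually_ge_at_top[of 1]
  proof eventually_elim
    case (elim n)
    have n: "n \<ge> 1" using elim by simp
    interpret subgaussian_matrix M K "{..<m n}" "{..<n}" "A n" by (rule matrix[OF n])
    have ne: "{..<m n} \<noteq> {}" "{..<n} \<noteq> {}" using n m_pos[OF n] by (auto simp: lessThan_empty_iff)
    have m1: "(C + 1) * real n \<le> c1 * real (m n)" using elim(2) c1 n by (simp add: field_simps)
    have pos: "?s * (\<kappa> / 2)\<^sup>2 > 0" using s \<kappa> by simp
    have m2: "2 * real (card {..<n}) \<le> ?s * (?s / 384 / 2)\<^sup>2 * real (card {..<m n})"
      using elim(3) pos n unfolding \<kappa>_def[symmetric] by (simp add: field_simps)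
    obtain B where B: "B \<in> events"
      "prob B \<le> 2 * exp (C * real (card {..<n}) - c1 * real (card {..<m n})) + exp (- real (card {..<n}))"
      "\<And>\<omega> x. \<omega> \<in> space M - B \<Longrightarrow> (\<And>i. i \<in> {..<m n} \<Longrightarrow> dot {..<n} x (row i \<omega>) \<le> 1) \<Longrightarrow> L2_set x {..<n} \<le> 4 / (?s / 384)"
      using bounded_polyhedron_event[OF ne m2] unfolding C_def c1_def by blast
    have "prob B \<le> 2 * exp (- 1 * real n) + exp (- 1 * real n)"
      using m1 by (intro order_trans[OF B(2)] add_mono) (auto simp: algebra_simps)
    then have "prob B \<le> 1 / real n ^ 3" using elim(1) by linarith
    moreover have "L2_set x {..<n} \<le> 1536 / ?s" if "\<omega> \<in> space M - B" "x \<in> polyhedron_le_one (m n) n (X n \<omega>)" for \<omega> x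
      using B(3)[of \<omega> x] that by (simp add: polyhedron_dot)
    ultimately show ?case using B(1) by blast
  qed
qed

text \<open>
  The constant is \<open>1/8\<close> of the exponential rate \<open>(sq_rate K)\<^sup>2 / 9216\<close> of \<open>l1_uniform_lower\<close>, which leaves
  room for the union bound over all supports of this size.
\<close>

definition sparsity :: "nat \<Rightarrow> nat" where
  "sparsity n = nat \<lfloor>(sq_rate K)\<^sup>2 / 73728 * (real n / (L n)\<^sup>2)\<rfloor>"

text \<open>The number of supports of size 2 k is at most about exp (2 k ln (m / k)), and ln (m / k)
  is L^2 / 2 up to a term logarithmic in L. For k about \<gamma> n / L^2 this is at most exp (2
  \<gamma> n), a quarter of the exponent of \<open>l1_uniform_lower\<close>.\<close>

lemma rip_eventually:
  defines "\<gamma> \<equiv> (sq_rate K)\<^sup>2 / 73728"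
  shows "\<forall>\<^sub>F n in sequentially. \<gamma> / 2 * (real n / (L n)\<^sup>2) \<le> real (sparsity n) \<and>
    (\<exists>B\<in>events. prob B \<le> 1 / real n ^ 3 \<and>
      (\<forall>\<omega> I y. \<omega> \<in> space M - B \<longrightarrow> I \<subseteq> {..<m n} \<longrightarrow> card I \<le> 2 * sparsity n \<longrightarrow>
        sq_rate K / 384 * sqrt (real n) * L2_set y I \<le> L2_set (\<lambda>j. \<Sum>i\<in>I. y i * A n i j \<omega>) {..<n}) \<and>
      (\<forall>\<omega> I. \<omega> \<in> space M - B \<longrightarrow> I \<subseteq> {..<m n} \<longrightarrow> card I = sparsity n \<longrightarrow>
        L2_set (\<lambda>j. \<Sum>i\<in>I. A n i j \<omega>) {..<n} \<le> 2 / sq_rate K * sqrt (real n * real (sparsity n))))"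
proof -
  let ?s = "sq_rate K"
  note s = sq_rate_pos[of K]
  define c1 where "c1 = ?s\<^sup>2 / 9216"
  define C where "C = 2 + 1536 / ?s\<^sup>2"
  have c1: "c1 > 0" using s by (simp add: c1_def)
  have \<gamma>: "\<gamma> > 0" "c1 / 4 = 2 * \<gamma>" using s by (auto simp: \<gamma>_def c1_def)
  have C: "C > 0" using s by (simp add: C_def add_pos_nonneg)
  have "\<forall>\<^sub>F n in sequentially. (L n)\<^sup>2 / real n < \<gamma> / 2" using L2_over_n \<gamma> by (intro order_tendstoD) auto
  moreover have "\<forall>\<^sub>F x in at_top. 1 + ln (2 * x\<^sup>2 / \<gamma>) \<le> x\<^sup>2 / 2" using \<gamma>(1) by real_asymp
  then have "\<forall>\<^sub>F n in sequentially. 1 + ln (2 * (L n)\<^sup>2 / \<gamma>) \<le> (L n)\<^sup>2 / 2"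
    by (rule eventually_compose_filterlim[OF _ L_at_top])
  moreover have "\<forall>\<^sub>F n in sequentially. 3 * exp (- (c1 / 2) * real n) \<le> 1 / real n ^ 3"
    using c1 by (intro eventually_exp_le_inverse_cube) auto
  ultimately show ?thesis
    using eventually_ratio_ge[of "2 * \<gamma>"] eventually_L_ge[of "1 + C"] eventually_ge_at_top[of 1] eventually_m_eq
  proof eventually_elim
    case (elim n)
    have n: "n \<ge> 1" using elim by simp
    interpret subgaussian_matrix M K "{..<m n}" "{..<n}" "A n" by (rule matrix[OF n])
    have ne: "{..<m n} \<noteq> {}" "{..<n} \<noteq> {}" using n m_pos[OF n] by (auto simp: lessThan_empty_iff)
    define l where "l = L n"
    have l: "l \<ge> 1" "l \<ge> 1 + C" using elim(5) C by (auto simp: l_def)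
    have l2: "l\<^sup>2 \<ge> 1" "l\<^sup>2 \<ge> C"
    proof -
      have "l * 1 \<le> l * l" using l by (intro mult_left_mono) auto
      then show "l\<^sup>2 \<ge> 1" "l\<^sup>2 \<ge> C" unfolding power2_eq_square using l by linarith+
    qed
    define u where "u = real n / l\<^sup>2"
    have u: "u > 0" "u \<le> real n"
    proof -
      have "0 < real n" "0 < l\<^sup>2" using n l2 by auto
      then show "u > 0" unfolding u_def by (rule divide_pos_pos)
      show "u \<le> real n" using mult_left_mono[OF l2(1), of "real n"] l2 by (simp add: u_def divide_le_eq)
    qed
    have gu2: "\<gamma> * u \<ge> 2"
    proof -
      have "2 * l\<^sup>2 \<le> \<gamma> * real n" using elim(1) n by (simp add: l_def field_simps)
      moreover have "l \<noteq> 0" using l by simp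
      ultimately show ?thesis by (simp add: u_def pos_le_divide_eq)
    qed
    define k where "k = sparsity n"
    have k_def': "k = nat \<lfloor>\<gamma> * u\<rfloor>" by (simp add: k_def sparsity_def \<gamma>_def u_def l_def)
    \<comment> \<open>Taking the floor of a number that is at least 2 loses at most half of
      it.\<close>
    have k: "real k \<le> \<gamma> * u" "\<gamma> / 2 * u \<le> real k" "k \<ge> 1"
    proof -
      have "real k = of_int \<lfloor>\<gamma> * u\<rfloor>" using gu2 by (simp add: k_def')
      then show "real k \<le> \<gamma> * u" "\<gamma> / 2 * u \<le> real k" using gu2 by linarith+
      then show "k \<ge> 1" using gu2 by linarith
    qed
    have m2: "2 * \<gamma> * real n \<le> real (m n)" using elim(4) n by (simp add: field_simps)
    have k2m: "2 * k \<le> m n"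
    proof -
      have "\<gamma> * u \<le> \<gamma> * real n" using u \<gamma> by (intro mult_left_mono) auto
      then have "2 * real k \<le> real (m n)" using k(1) m2 by linarith
      then show ?thesis by linarith
    qed
    \<comment> \<open>One estimate for j = k and j = 2 k, the two block sizes of
      \<open>rip_event\<close>.\<close>
    have ch: "real (m n choose j) \<le> exp (c1 / 4 * real n)" if j: "1 \<le> j" "j \<le> m n" "\<gamma> / 2 * u \<le> real j" "real j \<le> 2 * \<gamma> * u" for j
    proof -
      have "real (m n) / real j \<le> real (m n) / (\<gamma> / 2 * u)" using j \<gamma> u by (intro divide_left_mono) auto
      also have "\<dots> = exp (l\<^sup>2 / 2) * (2 * l\<^sup>2 / \<gamma>)"
        using elim(7) n l2 \<gamma> by (simp add: u_def l_def[symmetric] field_simps)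
      finally have "ln (real (m n) / real j) \<le> ln (exp (l\<^sup>2 / 2) * (2 * l\<^sup>2 / \<gamma>))"
      proof (subst ln_le_cancel_iff)
        show "0 < real (m n) / real j" using j by simp
        show "0 < exp (l\<^sup>2 / 2) * (2 * l\<^sup>2 / \<gamma>)" using \<gamma>(1) l(1) by (intro mult_pos_pos divide_pos_pos) auto
      qed
      also have "\<dots> = l\<^sup>2 / 2 + ln (2 * l\<^sup>2 / \<gamma>)" using \<gamma> l2 l by (subst ln_mult) auto
      finally have "1 + ln (real (m n) / real j) \<le> l\<^sup>2" using elim(2) by (simp add: l_def)
      then have "real j * (1 + ln (real (m n) / real j)) \<le> real j * l\<^sup>2" by (rule mult_left_mono) simp
      also have "\<dots> \<le> 2 * \<gamma> * u * l\<^sup>2" using j by (intro mult_right_mono) auto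
      also have "\<dots> = c1 / 4 * real n" using \<gamma> l by (simp add: u_def)
      finally show ?thesis using binomial_le_exp[OF j(1,2)] by (meson exp_le_cancel_iff order_trans)
    qed
    have kq: "C * real (2 * k) \<le> c1 / 4 * real n"
    proof -
      have "C * real (2 * k) \<le> C * (2 * (\<gamma> * u))" using k C by (intro mult_left_mono) auto
      also have "\<dots> = 2 * \<gamma> * (C * real n / l\<^sup>2)" by (simp add: u_def)
      also have "\<dots> \<le> 2 * \<gamma> * real n"
        using l2 \<gamma> mult_right_mono[OF l2(2), of "real n"] by (intro mult_left_mono) (auto simp: divide_le_eq mult.commute)
      finally show ?thesis using \<gamma> by simp
    qed
    have kc: "2 * k \<le> card {..<m n}" using k2m by simp
    have kq': "(2 + 1536 / ?s\<^sup>2) * real (2 * k) \<le> ?s\<^sup>2 / 9216 / 4 * real (card {..<n})"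
      using kq by (simp add: C_def c1_def)
    have "real (2 * k) \<le> 2 * \<gamma> * u" "\<gamma> / 2 * u \<le> real (2 * k)" "real k \<le> 2 * \<gamma> * u"
      using k u \<gamma> mult_pos_pos[OF \<gamma>(1) u(1)] by auto
    then have ch': "real (card {..<m n} choose (2 * k)) \<le> exp (?s\<^sup>2 / 9216 / 4 * real (card {..<n}))"
      "real (card {..<m n} choose k) \<le> exp (?s\<^sup>2 / 9216 / 4 * real (card {..<n}))"
      using ch[of "2 * k"] ch[of k] k k2m by (auto simp: c1_def)
    obtain B where B: "B \<in> events" "prob B \<le> 3 * exp (- (c1 / 2) * real n)"
      "\<And>\<omega> I y. \<omega> \<in> space M - B \<Longrightarrow> I \<subseteq> {..<m n} \<Longrightarrow> card I \<le> 2 * k \<Longrightarrow>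
         ?s / 384 * sqrt (real n) * L2_set y I \<le> L2_set (\<lambda>j. \<Sum>i\<in>I. y i * A n i j \<omega>) {..<n}"
      "\<And>\<omega> I. \<omega> \<in> space M - B \<Longrightarrow> I \<subseteq> {..<m n} \<Longrightarrow> card I = k \<Longrightarrow>
         L2_set (\<lambda>j. \<Sum>i\<in>I. A n i j \<omega>) {..<n} \<le> 2 / ?s * sqrt (real n * real k)"
      by (rule rip_event[OF ne k(3) kc kq' ch', unfolded card_lessThan c1_def[symmetric]]) (rule that)
    have "prob B \<le> 1 / real n ^ 3" using B(2) elim(3) by linarith
    then show ?case
      unfolding k_def[symmetric] l_def[symmetric] u_def[symmetric] using B k(2) by blast
  qed
qed

lemma exists_good_point:
  fixes \<epsilon> \<rho> :: real
  defines "s \<equiv> sq_rate K"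
  assumes n: "n \<ge> 1" and \<epsilon>: "0 < \<epsilon>" "\<epsilon> \<le> 1" and l: "L n > 0" and \<rho>: "\<rho> > 0"
    and c: "L2_set c {..<n} = 1"
    and rip: "\<And>I y. I \<subseteq> {..<m n} \<Longrightarrow> card I \<le> 2 * k \<Longrightarrow>
        s / 384 * sqrt (real n) * L2_set y I \<le> L2_set (\<lambda>j. \<Sum>i\<in>I. y i * A n i j \<omega>) {..<n}"
    and sums: "\<And>I. I \<subseteq> {..<m n} \<Longrightarrow> card I = k \<Longrightarrow>
        L2_set (\<lambda>j. \<Sum>i\<in>I. A n i j \<omega>) {..<n} \<le> 2 / s * sqrt (real n * real k)"
    and good: "lower_good {..<m n} {..<n} ((1 + \<epsilon>) * L n) ((s / 384 * \<rho>)\<^sup>2 * real n) (X n \<omega>) c"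
    and k: "s\<^sup>2 / 73728 / 2 * (real n / (L n)\<^sup>2) \<le> real k"
    and \<rho>\<epsilon>: "\<rho> \<le> \<epsilon> * s\<^sup>2 / 2048"
  shows "\<exists>x\<in>polyhedron_le_one (m n) n (X n \<omega>). (1 - \<rho>) / ((1 + 2 * \<epsilon>) * L n) \<le> dot {..<n} c x"
proof -
  have s: "s > 0" "s \<le> 1" using sq_rate_pos[of K] sq_rate_le[of K] by (auto simp: s_def)
  define T where "T = (1 + \<epsilon>) * L n"
  define \<eta> where "\<eta> = \<epsilon> * L n"
  define c0 where "c0 = s / 384 * sqrt (real n)"
  have T: "T > 0" "\<eta> > 0" using l \<epsilon> by (auto simp: T_def \<eta>_def)
  have nn: "real n > 0" using n by simp
  \<comment> \<open>As 147456 = 384^2, taking roots gives (s / 384) sqrt n \<le> L sqrt k, which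
    ties the restricted isometry constant to the sparsity.\<close>
  have ku: "s\<^sup>2 / 147456 * real n \<le> real k * (L n)\<^sup>2" using k l by (simp add: field_simps)
  have kpos: "real k > 0"
  proof (rule ccontr)
    assume "\<not> real k > 0"
    then have "s\<^sup>2 / 147456 * real n \<le> 0" using ku by simp
    moreover have "s\<^sup>2 / 147456 * real n > 0" using s nn by simp
    ultimately show False by linarith
  qed
  have \<rho>s: "\<rho> \<le> s / 2048"
  proof -
    have "\<epsilon> * s\<^sup>2 \<le> 1 * (s * 1)" unfolding power2_eq_square using \<epsilon> s by (intro mult_mono) auto
    then show ?thesis using \<rho>\<epsilon> by simp
  qed
  have eqb: "(c0 * \<rho>)\<^sup>2 = (s / 384 * \<rho>)\<^sup>2 * real n" by (simp add: c0_def power_mult_distrib power_divide)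
  \<comment> \<open>Through \<open>lower_good_imp\<close> this ensures that c violates at most k
    rows.\<close>
  have b: "(c0 * \<rho>)\<^sup>2 \<le> real k * T\<^sup>2"
  proof -
    have "(s / 384 * \<rho>)\<^sup>2 \<le> (s / 384 * 1)\<^sup>2" using s \<rho> \<rho>s by (intro power_mono mult_left_mono) auto
    then have "(c0 * \<rho>)\<^sup>2 \<le> s\<^sup>2 / 147456 * real n"
      unfolding eqb by (intro mult_right_mono) (auto simp: power_divide)
    also have "\<dots> \<le> real k * (L n)\<^sup>2" by (rule ku)
    also have "\<dots> \<le> real k * T\<^sup>2"
      using l \<epsilon> by (intro mult_left_mono power_mono) (auto simp: T_def)
    finally show ?thesis .
  qed
  have good': "lower_good {..<m n} {..<n} T ((c0 * \<rho>)\<^sup>2) (X n \<omega>) c" using good by (simp add: T_def eqb)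
  note B = lower_good_imp[OF finite_lessThan T(1) good' b]
  \<comment> \<open>After cancelling sqrt k this compares \<rho> (2 / s) sqrt n with \<epsilon> L
    sqrt k. By \<open>ku\<close> the latter is at least \<epsilon> (s / 384) sqrt n, so \<rho> of
    order \<epsilon> s^2 suffices.\<close>
  have kC: "\<rho> * (2 / s * sqrt (real n * real k)) < \<eta> * real k"
  proof -
    have "\<rho> * (2 / s) \<le> \<epsilon> * s\<^sup>2 / 2048 * (2 / s)" using \<rho>\<epsilon> s by (intro mult_right_mono) auto
    also have "\<dots> = \<epsilon> * (s / 1024)" using s by (simp add: power2_eq_square)
    also have "\<dots> < \<epsilon> * (s / 384)" using \<epsilon> s by simp
    finally have 1: "\<rho> * (2 / s) < \<epsilon> * (s / 384)" .
    have "sqrt (s\<^sup>2 / 147456 * real n) \<le> sqrt (real k * (L n)\<^sup>2)" using ku by (rule real_sqrt_le_mono)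
    then have 2: "s / 384 * sqrt (real n) \<le> sqrt (real k) * L n"
      using s l by (simp add: real_sqrt_mult real_sqrt_divide)
    have "\<rho> * (2 / s * sqrt (real n * real k)) = \<rho> * (2 / s) * (sqrt (real n) * sqrt (real k))"
      by (simp add: real_sqrt_mult)
    also have "\<dots> < \<epsilon> * (s / 384) * (sqrt (real n) * sqrt (real k))"
      using 1 nn kpos by (intro mult_strict_right_mono) auto
    also have "\<dots> = \<epsilon> * sqrt (real k) * (s / 384 * sqrt (real n))" by simp
    also have "\<dots> \<le> \<epsilon> * sqrt (real k) * (sqrt (real k) * L n)"
      using 2 \<epsilon> by (intro mult_left_mono) auto
    also have "\<dots> = \<eta> * real k" by (simp add: \<eta>_def)
    finally show ?thesis .
  qed
  obtain w where w: "L2_set w {..<n} \<le> \<rho>"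
    "\<And>i. i \<in> {..<m n} \<Longrightarrow> dot {..<n} c (X n \<omega> i) - dot {..<n} w (X n \<omega> i) \<le> T + \<eta>"
  proof (rule exists_small_correction[of "{..<m n}" "{..<n}" T \<eta> \<rho> c0 k "X n \<omega>" "2 / s * sqrt (real n * real k)" c])
    show "c0 \<ge> 0" using s by (simp add: c0_def)
    show "c0 * L2_set y I \<le> L2_set (\<lambda>j. \<Sum>i\<in>I. y i * X n \<omega> i j) {..<n}" if "I \<subseteq> {..<m n}" "card I \<le> 2 * k" for I y
      using rip[OF that, of y] by (simp add: c0_def)
    show "L2_set (\<lambda>j. \<Sum>i\<in>I. X n \<omega> i j) {..<n} \<le> 2 / s * sqrt (real n * real k)" if "I \<subseteq> {..<m n}" "card I = k" for I
      using sums[OF that] by simp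
  qed (use T \<rho> B kC that in auto)
  define D where "D = (1 + 2 * \<epsilon>) * L n"
  have D: "D > 0" "T + \<eta> = D" using l \<epsilon> by (simp_all add: D_def) (simp add: T_def \<eta>_def algebra_simps)
  define x where "x = (\<lambda>j\<in>{..<n}. 1 / D * (c j - w j))"
  have dx: "dot {..<n} x v = 1 / D * (dot {..<n} c v - dot {..<n} w v)" for v
  proof -
    have "dot {..<n} x v = dot {..<n} (\<lambda>j. 1 / D * (c j - w j)) v" by (rule dot_cong) (simp_all add: x_def)
    then show ?thesis by (simp only: dot_scale_left dot_diff_left)
  qed
  have "x \<in> polyhedron_le_one (m n) n (X n \<omega>)"
    unfolding polyhedron_dot dx using w(2) D by (auto simp: x_def field_simps)
  moreover have "(1 - \<rho>) / D \<le> dot {..<n} c x"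
  proof -
    have "dot {..<n} w c \<le> \<rho> * 1"
      using w(1) c \<rho> by (intro order_trans[OF dot_le] mult_mono) auto
    moreover have "dot {..<n} c c = 1" by (simp add: dot_self c)
    ultimately have "1 - \<rho> \<le> dot {..<n} c c - dot {..<n} w c" by simp
    then have "1 / D * (1 - \<rho>) \<le> 1 / D * (dot {..<n} c c - dot {..<n} w c)"
      using D by (intro mult_left_mono) auto
    then show ?thesis by (simp add: dot_commute[of _ c x] dx)
  qed
  ultimately show ?thesis unfolding D_def by blast
qed

end

section \<open>The almost sure limit\<close>

context random_polyhedra
begin

abbreviation width :: "nat \<Rightarrow> 'w \<Rightarrow> ennreal" where
  "width n \<omega> \<equiv> mean_width n (polyhedron_le_one (m n) n (X n \<omega>))"

lemma exp_\<tau>: "n \<ge> 1 \<Longrightarrow> exp (- (real n * (\<tau> n)\<^sup>2 / 2)) = 1 / real n ^ 3"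
proof -
  assume n: "n \<ge> 1"
  have "real n * (\<tau> n)\<^sup>2 / 2 = 3 * ln (real n)" using n by (simp add: \<tau>_def)
  then have "exp (- (real n * (\<tau> n)\<^sup>2 / 2)) = 1 / exp (3 * ln (real n))" by (simp add: exp_minus inverse_eq_divide)
  also have "exp (3 * ln (real n)) = real n ^ 3"
    using n exp_of_nat_mult[of 3 "ln (real n)"] by simp
  finally show ?thesis .
qed

lemma width_bounds_eventually:
  assumes \<epsilon>: "0 < \<epsilon>" "\<epsilon> \<le> 1 / 4"
  shows "\<forall>\<^sub>F n in sequentially. \<exists>B\<in>events. prob B \<le> 3 / real n ^ 2 \<and>
    (\<forall>\<omega>\<in>space M - B. ennreal (2 * (1 - \<epsilon>)\<^sup>2 / (1 + 2 * \<epsilon>)) \<le> ennreal (L n) * width n \<omega> \<and>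
       ennreal (L n) * width n \<omega> \<le> ennreal (2 * (1 + \<epsilon>) / (1 - \<epsilon>)\<^sup>2 + 2 * \<epsilon>))"
proof -
  define s where "s = sq_rate K"
  have s: "s > 0" "s \<le> 1" using sq_rate_pos[of K] sq_rate_le[of K] by (auto simp: s_def)
  define R where "R = 1536 / s"
  \<comment> \<open>The remainder of the weighted average then costs \<beta> R = \<epsilon> on a
    body of radius R.\<close>
  define \<beta> where "\<beta> = \<epsilon> / R"
  define \<rho> where "\<rho> = \<epsilon> * s\<^sup>2 / 2048"
  define d where "d = (s / 384 * \<rho>)\<^sup>2"
  have R: "R > 0" using s by (simp add: R_def)
  have \<beta>: "\<beta> > 0" "\<beta> * R = \<epsilon>" using R \<epsilon> by (auto simp: \<beta>_def)
  have \<rho>: "\<rho> > 0" "\<rho> \<le> \<epsilon>"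
  proof -
    have "\<epsilon> * s\<^sup>2 \<le> \<epsilon> * 1" using s \<epsilon> by (intro mult_left_mono) (auto simp: power_le_one)
    then show "\<rho> > 0" "\<rho> \<le> \<epsilon>" using s \<epsilon> by (auto simp: \<rho>_def)
  qed
  have d: "d > 0" using s \<rho> by (simp add: d_def)
  \<comment> \<open>Failing directions have measure at most 3/n and contribute at most R each; after
    scaling by L \<le> L^2 this is at most \<epsilon>.\<close>
  have "\<forall>\<^sub>F n in sequentially. (L n)\<^sup>2 / real n < \<epsilon> / (3 * R)" using L2_over_n \<epsilon> R by (intro order_tendstoD) auto
  moreover have "\<forall>\<^sub>F n in sequentially. 6 * ln (real n) / real n < 1 / 2" by real_asymp
  moreover have "\<forall>\<^sub>F n in sequentially. 3 / real n < \<epsilon>" using \<epsilon>(1) by real_asymp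
  ultimately show ?thesis
    using upper_tail_eventually[OF \<epsilon> \<beta>(1)] lower_tail_eventually[OF \<epsilon> d] bounded_event_eventually rip_eventually
      eventually_L_ge[of 1] eventually_gt_at_top[of 1]
  proof eventually_elim
    case (elim n)
    have n: "n \<ge> 1" "real n > 1" using elim by auto
    interpret subgaussian_matrix M K "{..<m n}" "{..<n}" "A n" by (rule matrix[OF n(1)])
    have ne: "{..<m n} \<noteq> {}" "{..<n} \<noteq> {}" using n m_pos[OF n(1)] by (auto simp: lessThan_empty_iff)
    let ?S = "sphere_uniform n"
    interpret S: prob_space ?S by (rule prob_space_sphere_uniform[OF n(1)])
    let ?N = "M \<Otimes>\<^sub>M ?S"
    have l: "L n \<ge> 1" using elim by simp
    have \<tau>n: "\<tau> n > 0" "(\<tau> n)\<^sup>2 \<le> 1 / 2" using elim(2) n by (auto simp: \<tau>_def)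
    define good where "good \<omega> c \<longleftrightarrow> upper_good {..<m n} {..<n} ((1 - \<epsilon>) * L n) \<epsilon> \<beta> (X n \<omega>) c \<and>
        lower_good {..<m n} {..<n} ((1 + \<epsilon>) * L n) (d * real n) (X n \<omega>) c" for \<omega> c
    \<comment> \<open>\<open>section_measure_tail\<close> requires one bound for all c, so only
      spread directions enter \<open>G\<close>; the others are counted separately in
      \<open>C0\<close>.\<close>
    define G where "G = {x \<in> space ?N. spread n (snd x) \<and> \<not> good (fst x) (snd x)}"
    have cj [measurable]: "(\<lambda>c. c j) \<in> borel_measurable ?S" if "j < n" for j
      unfolding measurable_cong_sets[OF sets_sphere_uniform refl]
      using that by (intro measurable_component_singleton) simp
    have Xm [measurable]: "(\<lambda>x. X n (fst x) i j) \<in> borel_measurable ?N" if "i \<in> {..<m n}" "j \<in> {..<n}" for i j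
      by (rule measurable_compose[OF measurable_fst entry_measurable[OF that]])
    have cm: "(\<lambda>x. snd x j) \<in> borel_measurable ?N" if "j \<in> {..<n}" for j
      by (rule measurable_compose[OF measurable_snd cj]) (use that in simp)
    have pg: "Measurable.pred ?N (\<lambda>x. good (fst x) (snd x))"
      unfolding good_def
      by (intro pred_intros_logic pred_upper_good pred_lower_good finite_lessThan ne Xm cm)
    have ps: "Measurable.pred ?N (\<lambda>x. spread n (snd x))"
    proof -
      note [measurable] = cm
      have "Measurable.pred ?N (\<lambda>x. L2_set (snd x) {..<n} = 1)" unfolding L2_set_def by measurable
      moreover have "Measurable.pred ?N (\<lambda>x. \<forall>j\<in>{..<n}. \<bar>snd x j\<bar> \<le> \<tau> n)"
        by (rule pred_intros_finite) (simp, measurable)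
      ultimately show ?thesis unfolding spread_def by simp
    qed
    have G: "G \<in> sets ?N" unfolding G_def using pg ps by measurable
    have Gp: "measure M {\<omega> \<in> space M. (\<omega>, c) \<in> G} \<le> 1 / real n ^ 3" if c: "c \<in> space ?S" for c
    proof (cases "spread n c")
      case False
      then have empty: "{\<omega> \<in> space M. (\<omega>, c) \<in> G} = {}" by (auto simp: G_def)
      show ?thesis unfolding empty by simp
    next
      case True
      let ?U = "{\<omega> \<in> space M. \<not> upper_good {..<m n} {..<n} ((1 - \<epsilon>) * L n) \<epsilon> \<beta> (X n \<omega>) c}"
      let ?V = "{\<omega> \<in> space M. \<not> lower_good {..<m n} {..<n} ((1 + \<epsilon>) * L n) (d * real n) (X n \<omega>) c}"
      have "Measurable.pred M (\<lambda>\<omega>. upper_good {..<m n} {..<n} ((1 - \<epsilon>) * L n) \<epsilon> \<beta> (X n \<omega>) c)"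
        "Measurable.pred M (\<lambda>\<omega>. lower_good {..<m n} {..<n} ((1 + \<epsilon>) * L n) (d * real n) (X n \<omega>) c)"
        by (intro pred_upper_good pred_lower_good finite_lessThan ne entry_measurable borel_measurable_const; assumption)+
      then have UV: "?U \<in> events" "?V \<in> events" by measurable
      have "{\<omega> \<in> space M. (\<omega>, c) \<in> G} \<subseteq> ?U \<union> ?V" by (auto simp: G_def good_def)
      then have "measure M {\<omega> \<in> space M. (\<omega>, c) \<in> G} \<le> prob (?U \<union> ?V)" using UV by (intro finite_measure_mono) auto
      also have "\<dots> \<le> prob ?U + prob ?V" by (rule measure_Un_le[OF UV])
      also have "\<dots> \<le> 1 / 2 / real n ^ 3 + 1 / 2 / real n ^ 3" using elim(4,5) True by (intro add_mono) auto
      finally show ?thesis by simp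
    qed
    note sec = section_measure_tail[OF prob_space_axioms S.prob_space_axioms G Gp]
    \<comment> \<open>The level 1/n tends to 0 faster than 1/L and loses only one factor n of
      1/n^3.\<close>
    define B3 where "B3 = {\<omega> \<in> space M. 1 / real n < measure ?S (Pair \<omega> -` G)}"
    have B3: "B3 \<in> events" "prob B3 \<le> 1 / real n ^ 2"
    proof -
      have p: "(0::real) \<le> 1 / real n ^ 3" "0 < 1 / real n" using n by auto
      show "B3 \<in> events" unfolding B3_def using sec(1)[OF _ p] by simp
      have "prob B3 \<le> 1 / real n ^ 3 / (1 / real n)" unfolding B3_def using sec(2)[OF _ p] by simp
      also have "\<dots> = 1 / real n ^ 2" using n by (simp add: power3_eq_cube power2_eq_square)
      finally show "prob B3 \<le> 1 / real n ^ 2" .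
    qed
    obtain B1 where B1: "B1 \<in> events" "prob B1 \<le> 1 / real n ^ 3"
      "\<And>\<omega> x. \<omega> \<in> space M - B1 \<Longrightarrow> x \<in> polyhedron_le_one (m n) n (X n \<omega>) \<Longrightarrow> L2_set x {..<n} \<le> R"
      using elim(6) unfolding R_def s_def by blast
    obtain B2 where B2: "B2 \<in> events" "prob B2 \<le> 1 / real n ^ 3"
      "\<And>\<omega> I y. \<omega> \<in> space M - B2 \<Longrightarrow> I \<subseteq> {..<m n} \<Longrightarrow> card I \<le> 2 * sparsity n \<Longrightarrow>
        s / 384 * sqrt (real n) * L2_set y I \<le> L2_set (\<lambda>j. \<Sum>i\<in>I. y i * A n i j \<omega>) {..<n}"
      "\<And>\<omega> I. \<omega> \<in> space M - B2 \<Longrightarrow> I \<subseteq> {..<m n} \<Longrightarrow> card I = sparsity n \<Longrightarrow>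
        L2_set (\<lambda>j. \<Sum>i\<in>I. A n i j \<omega>) {..<n} \<le> 2 / s * sqrt (real n * real (sparsity n))"
      using conjunct2[OF elim(7)] unfolding s_def by blast
    have k: "s\<^sup>2 / 73728 / 2 * (real n / (L n)\<^sup>2) \<le> real (sparsity n)"
      using conjunct1[OF elim(7)] by (simp add: s_def)
    define B where "B = B1 \<union> B2 \<union> B3"
    have "B \<in> events" using B1 B2 B3 by (simp add: B_def)
    moreover have "prob B \<le> 3 / real n ^ 2"
    proof -
      have "real n ^ 2 \<le> real n ^ 3" using n by (intro power_increasing) auto
      then have le: "1 / real n ^ 3 \<le> 1 / real n ^ 2" using n by (intro divide_left_mono) auto
      have "prob B \<le> prob B1 + prob B2 + prob B3"
        unfolding B_def using B1 B2 B3
        by (intro order_trans[OF measure_Un_le] add_right_mono measure_Un_le) auto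
      also have "\<dots> \<le> 1 / real n ^ 2 + 1 / real n ^ 2 + 1 / real n ^ 2" using B1 B2 B3 le by linarith
      finally show ?thesis by simp
    qed
    moreover have "ennreal (2 * (1 - \<epsilon>)\<^sup>2 / (1 + 2 * \<epsilon>)) \<le> ennreal (L n) * width n \<omega> \<and>
       ennreal (L n) * width n \<omega> \<le> ennreal (2 * (1 + \<epsilon>) / (1 - \<epsilon>)\<^sup>2 + 2 * \<epsilon>)"
      if \<omega>: "\<omega> \<in> space M - B" for \<omega>
    proof -
      define C0 where "C0 = {c \<in> space ?S. \<exists>j<n. \<tau> n < \<bar>c j\<bar>}"
      define C1 where "C1 = Pair \<omega> -` G"
      define Bad where "Bad = C0 \<union> C1"
      have C0m: "C0 \<in> sets ?S"
      proof -
        have "C0 = (\<Union>j\<in>{..<n}. {c \<in> space ?S. \<tau> n < \<bar>c j\<bar>})" by (auto simp: C0_def)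
        moreover have "{c \<in> space ?S. \<tau> n < \<bar>c j\<bar>} \<in> sets ?S" if "j \<in> {..<n}" for j
        proof -
          have [measurable]: "(\<lambda>c. c j) \<in> borel_measurable ?S" using cj that by simp
          show ?thesis by measurable
        qed
        ultimately show ?thesis by auto
      qed
      have C1m: "C1 \<in> sets ?S" unfolding C1_def using G by (rule sets_Pair1)
      have Badm: "Bad \<in> sets ?S" using C0m C1m by (simp add: Bad_def)
      have "measure ?S C0 \<le> 2 * real n * (1 / real n ^ 3)"
        using sphere_uniform_not_spread[OF n(1) \<tau>n] by (simp add: C0_def exp_\<tau>[OF n(1)])
      also have "\<dots> = 2 / real n / real n" using n by (simp add: power3_eq_cube)
      also have "\<dots> \<le> 2 / real n / 1" using n by (intro divide_left_mono) auto
      finally have "measure ?S C0 \<le> 2 / real n" by simp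
      moreover have "measure ?S C1 \<le> 1 / real n" using \<omega> by (auto simp: C1_def B_def B3_def)
      ultimately have mu: "measure ?S Bad \<le> 3 / real n"
        unfolding Bad_def using measure_Un_le[OF C0m C1m] by (simp add: add_divide_distrib[symmetric])
      have cg: "L2_set c {..<n} = 1 \<and> good \<omega> c" if c: "c \<in> unit_sphere n" "c \<notin> Bad" for c
      proof -
        have cS: "c \<in> space ?S" using c(1) by (simp add: unit_sphere_def sphere_uniform_def space_PiM)
        have "\<bar>c j\<bar> \<le> \<tau> n" if "j < n" for j
          by (rule ccontr) (use c(2) cS that in \<open>auto simp: Bad_def C0_def\<close>)
        then have "spread n c" using c(1) by (simp add: spread_def unit_sphereD)
        then show ?thesis using c cS \<omega> by (auto simp: Bad_def C1_def G_def space_pair_measure unit_sphereD)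
      qed
      let ?P = "polyhedron_le_one (m n) n (X n \<omega>)"
      have bd: "L2_set x {..<n} \<le> R" if "x \<in> ?P" for x using B1(3) \<omega> that by (auto simp: B_def)
      define U where "U = (1 + \<epsilon>) / ((1 - \<epsilon>) * ((1 - \<epsilon>) * L n))"
      have U0: "U \<ge> 0" using \<epsilon> l by (simp add: U_def)
      have "width n \<omega> \<le> ennreal (2 * (U + R * measure ?S Bad))"
      proof (rule mean_width_upper[OF n(1) Badm U0 _ _ bd])
        show "dot {..<n} c x \<le> U" if c: "c \<in> unit_sphere n" "c \<notin> Bad" and x: "x \<in> ?P" for c x
        proof -
          have "dot {..<n} c x \<le> (1 + \<beta> * R) / ((1 - \<epsilon>) * ((1 - \<epsilon>) * L n))"
          proof (rule upper_good_imp[OF finite_lessThan finite_lessThan ne])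
            show "upper_good {..<m n} {..<n} ((1 - \<epsilon>) * L n) \<epsilon> \<beta> (X n \<omega>) c" using cg[OF c] by (simp add: good_def)
            show "(1 - \<epsilon>) * L n > 0" using \<epsilon> l by simp
            show "\<And>i. i \<in> {..<m n} \<Longrightarrow> dot {..<n} x (X n \<omega> i) \<le> 1" using x by (simp add: polyhedron_dot)
          qed (use \<epsilon> \<beta> R bd[OF x] in auto)
          then show ?thesis by (simp add: U_def \<beta>)
        qed
      qed (use R in auto)
      then have "ennreal (L n) * width n \<omega> \<le> ennreal (L n) * ennreal (2 * (U + R * measure ?S Bad))"
        by (rule mult_left_mono) simp
      also have "\<dots> = ennreal (L n * (2 * (U + R * measure ?S Bad)))" using l by (subst ennreal_mult') auto
      also have "\<dots> \<le> ennreal (2 * (1 + \<epsilon>) / (1 - \<epsilon>)\<^sup>2 + 2 * \<epsilon>)"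
      proof (rule ennreal_leI)
        have "L n * R * measure ?S Bad \<le> (L n)\<^sup>2 * R * (3 / real n)"
          using l R mu by (intro mult_mono) (auto simp: power2_eq_square)
        also have "\<dots> = 3 * R * ((L n)\<^sup>2 / real n)" by simp
        also have "\<dots> \<le> 3 * R * (\<epsilon> / (3 * R))" using elim(1) R by (intro mult_left_mono) auto
        also have "\<dots> = \<epsilon>" using R by simp
        finally have 1: "L n * R * measure ?S Bad \<le> \<epsilon>" .
        have 2: "L n * U = (1 + \<epsilon>) / (1 - \<epsilon>)\<^sup>2" using l by (simp add: U_def power2_eq_square)
        have "L n * (2 * (U + R * measure ?S Bad)) = 2 * (L n * U) + 2 * (L n * R * measure ?S Bad)"
          by (simp add: algebra_simps)
        also have "\<dots> \<le> 2 * ((1 + \<epsilon>) / (1 - \<epsilon>)\<^sup>2) + 2 * \<epsilon>" using 1 unfolding 2 by simp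
        finally show "L n * (2 * (U + R * measure ?S Bad)) \<le> 2 * (1 + \<epsilon>) / (1 - \<epsilon>)\<^sup>2 + 2 * \<epsilon>" by simp
      qed
      finally have upper: "ennreal (L n) * width n \<omega> \<le> ennreal (2 * (1 + \<epsilon>) / (1 - \<epsilon>)\<^sup>2 + 2 * \<epsilon>)" .
      define l0 where "l0 = (1 - \<rho>) / ((1 + 2 * \<epsilon>) * L n)"
      have l0: "l0 \<ge> 0" using \<rho> \<epsilon> l by (simp add: l0_def)
      have "ennreal (2 * (l0 * (1 - measure ?S Bad))) \<le> width n \<omega>"
      proof (rule mean_width_lower[OF n(1) Badm l0])
        fix c assume c: "c \<in> unit_sphere n" "c \<notin> Bad"
        show "\<exists>x\<in>?P. l0 \<le> dot {..<n} c x"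
          unfolding l0_def
        proof (rule exists_good_point[OF n(1) \<epsilon>(1) _ _ \<rho>(1)])
          show "lower_good {..<m n} {..<n} ((1 + \<epsilon>) * L n) ((sq_rate K / 384 * \<rho>)\<^sup>2 * real n) (X n \<omega>) c"
            using cg[OF c] by (simp add: good_def d_def s_def)
          show "(sq_rate K)\<^sup>2 / 73728 / 2 * (real n / (L n)\<^sup>2) \<le> real (sparsity n)" using k by (simp add: s_def)
          show "sq_rate K / 384 * sqrt (real n) * L2_set y I \<le> L2_set (\<lambda>j. \<Sum>i\<in>I. y i * A n i j \<omega>) {..<n}"
            if "I \<subseteq> {..<m n}" "card I \<le> 2 * sparsity n" for I y
            using B2(3)[OF _ that, of \<omega> y] \<omega> by (simp add: s_def B_def)
          show "L2_set (\<lambda>j. \<Sum>i\<in>I. A n i j \<omega>) {..<n} \<le> 2 / sq_rate K * sqrt (real n * real (sparsity n))"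
            if "I \<subseteq> {..<m n}" "card I = sparsity n" for I
            using B2(4)[OF _ that, of \<omega>] \<omega> by (simp add: s_def B_def)
        qed (use \<epsilon> l cg[OF c] in \<open>auto simp: \<rho>_def s_def\<close>)
      qed
      then have low1: "ennreal (L n) * ennreal (2 * (l0 * (1 - measure ?S Bad))) \<le> ennreal (L n) * width n \<omega>"
        by (rule mult_left_mono) simp
      have eq: "ennreal (L n) * ennreal (2 * (l0 * (1 - measure ?S Bad))) = ennreal (L n * (2 * (l0 * (1 - measure ?S Bad))))"
        using l by (subst ennreal_mult') auto
      have low2: "ennreal (2 * (1 - \<epsilon>)\<^sup>2 / (1 + 2 * \<epsilon>)) \<le> ennreal (L n * (2 * (l0 * (1 - measure ?S Bad))))"
      proof (rule ennreal_leI)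
        have "(1 - \<epsilon>) * (1 - \<epsilon>) \<le> (1 - \<rho>) * (1 - measure ?S Bad)"
          using \<rho> \<epsilon> mu elim(3) by (intro mult_mono) auto
        then have "2 * (1 - \<epsilon>)\<^sup>2 / (1 + 2 * \<epsilon>) \<le> 2 * ((1 - \<rho>) * (1 - measure ?S Bad)) / (1 + 2 * \<epsilon>)"
          using \<epsilon> unfolding power2_eq_square by (intro divide_right_mono mult_left_mono) auto
        also have "\<dots> = L n * (2 * (l0 * (1 - measure ?S Bad)))" using l by (simp add: l0_def)
        finally show "2 * (1 - \<epsilon>)\<^sup>2 / (1 + 2 * \<epsilon>) \<le> L n * (2 * (l0 * (1 - measure ?S Bad)))" .
      qed
      show ?thesis using order_trans[OF low2 low1[unfolded eq]] upper by (rule conjI)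
    qed
    ultimately show ?case by (intro bexI[of _ B] conjI ballI) blast+
  qed
qed

lemma width_bounds_AE:
  assumes \<epsilon>: "0 < \<epsilon>" "\<epsilon> \<le> 1 / 4"
  shows "AE \<omega> in M. \<forall>\<^sub>F n in sequentially. ennreal (2 * (1 - \<epsilon>)\<^sup>2 / (1 + 2 * \<epsilon>)) \<le> ennreal (L n) * width n \<omega> \<and>
       ennreal (L n) * width n \<omega> \<le> ennreal (2 * (1 + \<epsilon>) / (1 - \<epsilon>)\<^sup>2 + 2 * \<epsilon>)"
proof -
  let ?ok = "\<lambda>n \<omega>. ennreal (2 * (1 - \<epsilon>)\<^sup>2 / (1 + 2 * \<epsilon>)) \<le> ennreal (L n) * width n \<omega> \<and>
       ennreal (L n) * width n \<omega> \<le> ennreal (2 * (1 + \<epsilon>) / (1 - \<epsilon>)\<^sup>2 + 2 * \<epsilon>)"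
  obtain n0 where n0: "\<And>n. n \<ge> n0 \<Longrightarrow> \<exists>B\<in>events. prob B \<le> 3 / real n ^ 2 \<and> (\<forall>\<omega>\<in>space M - B. ?ok n \<omega>)"
    using width_bounds_eventually[OF \<epsilon>] unfolding eventually_sequentially by blast
  \<comment> \<open>Below \<open>n0\<close> any event will do; this makes \<open>B\<close> a
    sequence over all n, as the Borel-Cantelli lemma expects.\<close>
  have "\<exists>B. \<forall>n. B n \<in> events \<and> (n \<ge> n0 \<longrightarrow> prob (B n) \<le> 3 / real n ^ 2 \<and> (\<forall>\<omega>\<in>space M - B n. ?ok n \<omega>))"
  proof (rule choice, rule allI)
    fix n show "\<exists>B. B \<in> events \<and> (n \<ge> n0 \<longrightarrow> prob B \<le> 3 / real n ^ 2 \<and> (\<forall>\<omega>\<in>space M - B. ?ok n \<omega>))"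
      using n0[of n] by (cases "n \<ge> n0") blast+
  qed
  then obtain B where B: "\<And>n. B n \<in> events" "\<And>n. n \<ge> n0 \<Longrightarrow> prob (B n) \<le> 3 / real n ^ 2"
    "\<And>n \<omega>. n \<ge> n0 \<Longrightarrow> \<omega> \<in> space M - B n \<Longrightarrow> ?ok n \<omega>"
    by blast
  have "summable (\<lambda>n. prob (B n))"
  proof (rule summable_comparison_test')
    show "summable (\<lambda>n. 3 * inverse (real n ^ 2))" by (intro summable_mult inverse_power_summable) simp
    show "norm (prob (B n)) \<le> 3 * inverse (real n ^ 2)" if "n \<ge> n0" for n
      using B(2)[OF that] by (simp add: divide_inverse)
  qed
  then have "AE \<omega> in M. \<forall>\<^sub>F n in sequentially. \<omega> \<in> space M - B n"
    by (intro borel_cantelli_AE1 B(1)) (simp_all add: emeasure_eq_measure)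
  then show ?thesis
  proof eventually_elim
    case (elim \<omega>)
    then show ?case using eventually_ge_at_top[of n0]
      by eventually_elim (rule B(3))
  qed
qed

lemma width_limit: "AE \<omega> in M. (\<lambda>n. ennreal (L n) * width n \<omega>) \<longlonglongrightarrow> 2"
proof -
  \<comment> \<open>A countable sequence of tolerances, so that one null set serves them all; the
    shift by 4 keeps each of them at most 1/4.\<close>
  define e where "e k = 1 / (real k + 4)" for k :: nat
  have e: "0 < e k" "e k \<le> 1 / 4" for k by (auto simp: e_def field_simps)
  define lo where "lo k = 2 * (1 - e k)\<^sup>2 / (1 + 2 * e k)" for k
  define up where "up k = 2 * (1 + e k) / (1 - e k)\<^sup>2 + 2 * e k" for k
  have "lo \<longlonglongrightarrow> 2" "up \<longlonglongrightarrow> 2" unfolding lo_def up_def e_def by real_asymp+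
  then have lim: "(\<lambda>k. ennreal (lo k)) \<longlonglongrightarrow> 2" "(\<lambda>k. ennreal (up k)) \<longlonglongrightarrow> 2"
    using tendsto_ennrealI[of lo 2] tendsto_ennrealI[of up 2] by simp_all
  have "AE \<omega> in M. \<forall>k. \<forall>\<^sub>F n in sequentially. ennreal (lo k) \<le> ennreal (L n) * width n \<omega> \<and>
       ennreal (L n) * width n \<omega> \<le> ennreal (up k)"
    unfolding AE_all_countable lo_def up_def using width_bounds_AE[OF e] by blast
  then show ?thesis
  proof eventually_elim
    case (elim \<omega>)
    show ?case
    proof (rule order_tendstoI)
      fix a :: ennreal assume "a < 2"
      then obtain k where k: "a < ennreal (lo k)"
        using order_tendstoD(1)[OF lim(1)] by (meson eventually_sequentially order_refl)
      show "\<forall>\<^sub>F n in sequentially. a < ennreal (L n) * width n \<omega>"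
        using elim[rule_format, of k] by eventually_elim (use k in auto)
    next
      fix a :: ennreal assume "2 < a"
      then obtain k where k: "ennreal (up k) < a"
        using order_tendstoD(2)[OF lim(2)] by (meson eventually_sequentially order_refl)
      show "\<forall>\<^sub>F n in sequentially. ennreal (L n) * width n \<omega> < a"
        using elim[rule_format, of k] by eventually_elim (use k in auto)
    qed
  qed
qed

end

theorem corollary1p4:
  fixes M :: "'w measure"
    and K :: real
    and m :: "nat \<Rightarrow> nat"
    and A :: "nat \<Rightarrow> nat \<Rightarrow> nat \<Rightarrow> 'w \<Rightarrow> real"
  assumes "prob_space M"
    and "K > 0"
    and "\<And>n. n \<ge> 1 \<Longrightarrow> m n > 0"
    and "filterlim (\<lambda>n. real (m n) / real n) at_top sequentially"
    and "(\<lambda>n. ln (real (m n)) powr (3/2)) \<in> o(\<lambda>n. sqrt (real n / ln (real n)))"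
    and "\<And>n. n \<ge> 1 \<Longrightarrow>
           prob_space.indep_vars M (\<lambda>_. borel) (\<lambda>(i, j). A n i j) ({..<m n} \<times> {..<n})"
    and "\<And>n i j. n \<ge> 1 \<Longrightarrow> i < m n \<Longrightarrow> j < n \<Longrightarrow> subgaussian M K (A n i j)"
    and "\<And>n i j. n \<ge> 1 \<Longrightarrow> i < m n \<Longrightarrow> j < n \<Longrightarrow> prob_space.expectation M (A n i j) = 0"
    and "\<And>n i j. n \<ge> 1 \<Longrightarrow> i < m n \<Longrightarrow> j < n \<Longrightarrow> prob_space.variance M (A n i j) = 1"
  shows "AE \<omega> in M.
           (\<lambda>n. ennreal (sqrt (2 * ln (real (m n) / real n)))
                * mean_width n (polyhedron_le_one (m n) n (\<lambda>i j. A n i j \<omega>)))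
           \<longlonglongrightarrow> 2"
proof -
  interpret prob_space M by fact
  interpret random_polyhedra M K m A
  proof (intro random_polyhedra.intro random_polyhedra_axioms.intro prob_space_axioms assms(3,4,5))
    show "subgaussian_matrix M K {..<m n} {..<n} (A n)" if "n \<ge> 1" for n
      by (intro subgaussian_matrix.intro subgaussian_matrix_axioms.intro prob_space_axioms finite_lessThan)
        (use assms that in auto)
  qed
  show ?thesis using width_limit by (simp add: L_def)
qed

end
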